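(* There exist positive constants $C_0$ and $C$ depending only on $n$ such that the following holds. Let $\lambda>1$, let $u$ be a nonzero solution of $\triangle^2u=\lambda^2u$ in $\Omega$, and let $N(y_0,r)$ be the associated frequency function. If $0<r\le 1$, $\overline{B_r(y_0)}\subset\Omega\times\mathbb{R}$ and $N(y_0,r)\ge C_0$, then $$\frac{d\ln N(y_0,r)}{dr}\ge -C.$$
   Context: Let $n\ge2$ and let $\Omega\subseteq\mathbb{R}^n$ be a bounded domain. For $\lambda>0$ and $u$ a nonzero solution of $\triangle^2u=\lambda^2u$ in $\Omega$, put $v=\triangle u-\lambda u$ (so $\triangle v+\lambda v=0$), and for $y=(x,x_{n+1})\in\Omega\times\mathbb{R}$ define $g(y)=u(x)e^{\sqrt\lambda x_{n+1}}$ and $h(y)=v(x)e^{\sqrt\lambda x_{n+1}}$; then $\triangle g=h+2\lambda g$ and $\triangle h=0$ in $\Omega\times\mathbb{R}$ (Laplacian in $n+1$ variables). $B_r(y_0)$ is the ball of radius $r$ in $\mathbb{R}^{n+1}$ centered at $y_0$. The frequency function is $$N(y_0,r)=r\,\frac{\int_{B_r(y_0)}\left(|\nabla g|^2+|\nabla h|^2+gh+2\lambda g^2\right)dy}{\int_{\partial B_r(y_0)}(g^2+h^2)\,d\sigma},$$ where $d\sigma$ is the $n$-dimensional Hausdorff measure on $\partial B_r(y_0)$. *)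

theory Defs
  imports "HOL-Analysis.Analysis"
begin

section \<open>Hausdorff measure\<close>

text \<open>Normalised so that in \<^term>\<open>m\<close>-dimensional Euclidean space the \<^term>\<open>m\<close>-dimensional
  Hausdorff measure is Lebesgue measure. The empty set is treated separately only to get
  \<open>0\<close> (and not \<open>0 ^ 0 = 1\<close>) when \<open>m = 0\<close>.\<close>

definition hausdorff_size :: "nat \<Rightarrow> 'a::metric_space set \<Rightarrow> real" where
  "hausdorff_size m U =
     (if U = {} then 0 else unit_ball_vol (real m) * (diameter U / 2) ^ m)"

text \<open>\<^const>\<open>diameter\<close> is meaningful only for bounded sets, hence the boundedness condition.\<close>

definition hausdorff_pre :: "nat \<Rightarrow> real \<Rightarrow> 'a::metric_space set \<Rightarrow> ennreal" where
  "hausdorff_pre m \<delta> A =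
     (INF U \<in> {U :: nat \<Rightarrow> 'a set. A \<subseteq> (\<Union>i. U i) \<and> (\<forall>i. bounded (U i) \<and> diameter (U i) \<le> \<delta>)}.
        \<Sum>i. ennreal (hausdorff_size m (U i)))"

definition hausdorff_outer :: "nat \<Rightarrow> 'a::metric_space set \<Rightarrow> ennreal" where
  "hausdorff_outer m A = (SUP \<delta> \<in> {0<..}. hausdorff_pre m \<delta> A)"

text \<open>The outer measure is a metric outer measure, so it is countably additive on the Borel sets
  and \<^const>\<open>measure_of\<close> is applied to a genuine measure.\<close>

definition hausdorff_measure :: "nat \<Rightarrow> 'a::metric_space measure" where
  "hausdorff_measure m = measure_of UNIV (sets borel) (hausdorff_outer m)"


section \<open>Differential operators on Euclidean space\<close>

definition partial_deriv :: "'a::euclidean_space \<Rightarrow> ('a \<Rightarrow> real) \<Rightarrow> 'a \<Rightarrow> real" where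
  "partial_deriv i f x = frechet_derivative f (at x) i"

definition grad :: "('a::euclidean_space \<Rightarrow> real) \<Rightarrow> 'a \<Rightarrow> 'a" where
  "grad f x = (\<Sum>i\<in>Basis. partial_deriv i f x *\<^sub>R i)"

definition laplacian :: "('a::euclidean_space \<Rightarrow> real) \<Rightarrow> 'a \<Rightarrow> real" where
  "laplacian f x = (\<Sum>i\<in>Basis. partial_deriv i (partial_deriv i f) x)"

text \<open>Class \<open>C\<^sup>k\<close>; intended for open \<^term>\<open>S\<close>.\<close>

fun Ck_on :: "nat \<Rightarrow> ('a::euclidean_space \<Rightarrow> real) \<Rightarrow> 'a set \<Rightarrow> bool" where
  "Ck_on 0 f S \<longleftrightarrow> continuous_on S f"
| "Ck_on (Suc k) f S \<longleftrightarrow>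
     (\<forall>x\<in>S. f differentiable (at x)) \<and> (\<forall>i\<in>Basis. Ck_on k (partial_deriv i f) S)"


section \<open>Bi-Laplace eigenfunctions and the frequency function\<close>

definition bounded_domain :: "'a::euclidean_space set \<Rightarrow> bool" where
  "bounded_domain \<Omega> \<longleftrightarrow> open \<Omega> \<and> connected \<Omega> \<and> \<Omega> \<noteq> {} \<and> bounded \<Omega>"

text \<open>Classical solutions: \<open>u\<close> is of class \<open>C\<^sup>4\<close> and the equation holds pointwise. No boundary
  condition is imposed.\<close>

definition bilaplace_solution :: "'a::euclidean_space set \<Rightarrow> real \<Rightarrow> ('a \<Rightarrow> real) \<Rightarrow> bool" where
  "bilaplace_solution \<Omega> lam u \<longleftrightarrow>
     Ck_on 4 u \<Omega> \<and> (\<forall>x\<in>\<Omega>. laplacian (laplacian u) x = lam\<^sup>2 * u x)"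

text \<open>\<open>\<real>\<^sup>n\<^sup>+\<^sup>1\<close> is \<open>(real ^ 'n) \<times> real\<close>; the norm of a product type is the Euclidean one.\<close>

definition exp_lift :: "real \<Rightarrow> (real ^ 'n \<Rightarrow> real) \<Rightarrow> (real ^ 'n) \<times> real \<Rightarrow> real" where
  "exp_lift lam w y = w (fst y) * exp (sqrt lam * snd y)"

definition freq_v :: "real \<Rightarrow> (real ^ 'n \<Rightarrow> real) \<Rightarrow> real ^ 'n \<Rightarrow> real" where
  "freq_v lam u x = laplacian u x - lam * u x"

definition freq_g :: "real \<Rightarrow> (real ^ 'n \<Rightarrow> real) \<Rightarrow> (real ^ 'n) \<times> real \<Rightarrow> real" where
  "freq_g lam u = exp_lift lam u"

definition freq_h :: "real \<Rightarrow> (real ^ 'n \<Rightarrow> real) \<Rightarrow> (real ^ 'n) \<times> real \<Rightarrow> real" where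
  "freq_h lam u = exp_lift lam (freq_v lam u)"

definition frequency ::
  "real \<Rightarrow> (real ^ 'n \<Rightarrow> real) \<Rightarrow> (real ^ 'n) \<times> real \<Rightarrow> real \<Rightarrow> real" where
  "frequency lam u y\<^sub>0 r =
     r * (LINT y : ball y\<^sub>0 r | lborel.
            (norm (grad (freq_g lam u) y))\<^sup>2 + (norm (grad (freq_h lam u) y))\<^sup>2
            + freq_g lam u y * freq_h lam u y + 2 * lam * (freq_g lam u y)\<^sup>2)
       / (LINT y : sphere y\<^sub>0 r | hausdorff_measure CARD('n).
            (freq_g lam u y)\<^sup>2 + (freq_h lam u y)\<^sup>2)"

end

theory Submission
  imports Defs
begin

text \<open>Write \<open>D\<close> for the volume integral and \<open>H\<close> for the surface integral in the frequency
  \<open>N = r D / H\<close>, and \<open>m = n + 1\<close>. Then \<open>H' = (m - 1) H / r + 2 D\<close>, and \<open>D'\<close> is computed by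
  Rellich's identity, in which the boundary term \<open>2 \<lambda> g\<^sup>2\<close> cancels against the volume term produced
  by \<open>2 \<lambda> g\<close> in \<open>\<triangle>g\<close>. After the Cauchy-Schwarz inequality on the sphere, \<open>(ln N)'\<close> is bounded
  below by \<open>1 / D\<close> times lower-order terms; if \<open>r D \<ge> H\<close>, a Poincare inequality with boundary
  term bounds these by a multiple of \<open>D\<close> depending only on \<open>n\<close>, because \<open>\<lambda>\<close> only enters through
  \<open>\<lambda> g\<^sup>2 \<ge> g\<^sup>2\<close>.

  Surface integrals are written as integrals against the cone measure on the unit sphere. The
  Hausdorff measure is a constant multiple of it, since both are invariant under reflections. The
  constant cancels in \<open>(ln N)'\<close> and is absorbed in \<open>C\<^sub>0\<close>, so its value is irrelevant; if it
  degenerates, the frequency is \<open>0\<close> and the hypothesis \<open>N \<ge> C\<^sub>0\<close> fails.\<close>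

section \<open>Scaling of Hausdorff measure\<close>

text \<open>Only concentric balls occur, and sphere integrals enter as radial derivatives:
  \<open>sphere_integral\<close> of a continuous function is the derivative of
  \<open>ball_integral\<close>. The divergence theorem follows by differentiating in the radius an
  identity with a weight vanishing on the sphere, which itself expresses translation invariance of
  Lebesgue measure. Conversely, no sphere integral is differentiated directly: \<open>H\<close> is
  first turned into a ball integral divided by the radius.

  The obstacle in the estimate is the product \<open>g * h\<close> in \<open>D\<close>, which has no
  sign, so that \<open>D\<close> does not visibly dominate the Dirichlet energy \<open>A\<close>.
  Two inequalities are coupled: Poincare bounds the integral \<open>E\<close> of g^2 + h^2 by r^2 (D
  + A) / 2, and the definition of \<open>D\<close> gives A <= D + E / 2. For r <= 1 they yield A <=
  5 D / 3 and E <= 4 r D / 3. The factor r in the second bound is essential, because the remainder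
  in (ln N)' is divided by r D, not by D. The computation yields the constant m + 2, which is
  rounded up to m + 3, that is n + 4.\<close>

lemma hausdorff_size_similarity_le:
  fixes T :: "'a::metric_space \<Rightarrow> 'a"
  assumes t: "t > 0" and T: "\<And>x y. dist (T x) (T y) = t * dist x y" and U: "bounded U"
  shows "bounded (T ` U)" "diameter (T ` U) \<le> t * diameter U"
    "hausdorff_size m (T ` U) \<le> t ^ m * hausdorff_size m U"
proof -
  show b: "bounded (T ` U)"
  proof -
    obtain x e where "\<And>y. y \<in> U \<Longrightarrow> dist x y \<le> e" using U unfolding bounded_def by blast
    then have "\<forall>y\<in>T ` U. dist (T x) y \<le> t * e"
      using t T by auto
    then show ?thesis unfolding bounded_def by blast
  qed
  show d: "diameter (T ` U) \<le> t * diameter U"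
  proof (cases "U = {}")
    case False
    have "dist a b \<le> diameter U" if "a \<in> U" "b \<in> U" for a b
      using U that diameter_bounded_bound by blast
    then show ?thesis
      unfolding diameter_def[of "T ` U"] using False t T by (auto intro!: cSUP_least)
  qed simp
  show "hausdorff_size m (T ` U) \<le> t ^ m * hausdorff_size m U"
  proof (cases "U = {}")
    case False
    have "(diameter (T ` U) / 2) ^ m \<le> (t * diameter U / 2) ^ m"
      using d diameter_ge_0[OF b] by (intro power_mono) auto
    also have "\<dots> = t ^ m * (diameter U / 2) ^ m"
      by (simp add: power_mult_distrib power_divide)
    finally have "unit_ball_vol (real m) * (diameter (T ` U) / 2) ^ m
        \<le> unit_ball_vol (real m) * (t ^ m * (diameter U / 2) ^ m)"
      by (intro mult_left_mono) auto
    then show ?thesis using False by (simp add: hausdorff_size_def algebra_simps)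
  qed (simp add: hausdorff_size_def)
qed

text \<open>Covers of \<open>A\<close> of mesh \<open>\<delta>\<close> are pushed forward by
  \<open>T\<close> to covers of mesh \<open>t * \<delta>\<close>. The factor
  \<open>1 / t ^ m\<close> stands on the left so that the infimum on the right can be treated cover
  by cover.\<close>

lemma hausdorff_pre_similarity_le:
  fixes T :: "'a::metric_space \<Rightarrow> 'a"
  assumes t: "t > 0" and T: "\<And>x y. dist (T x) (T y) = t * dist x y"
  shows "ennreal (1 / t ^ m) * hausdorff_pre m (t * \<delta>) (T ` A) \<le> hausdorff_pre m \<delta> A"
  unfolding hausdorff_pre_def[of m \<delta> A]
proof (rule INF_greatest)
  fix U :: "nat \<Rightarrow> 'a set"
  assume "U \<in> {U. A \<subseteq> (\<Union>i. U i) \<and> (\<forall>i. bounded (U i) \<and> diameter (U i) \<le> \<delta>)}"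
  then have cov: "A \<subseteq> (\<Union>i. U i)" and b: "\<And>i. bounded (U i)" and d: "\<And>i. diameter (U i) \<le> \<delta>"
    by auto
  note sim = hausdorff_size_similarity_le[OF t T b]
  have "diameter (T ` U i) \<le> t * \<delta>" for i
    using sim(2)[of i] mult_left_mono[OF d[of i], of t] t by linarith
  then have "hausdorff_pre m (t * \<delta>) (T ` A) \<le> (\<Sum>i. ennreal (hausdorff_size m (T ` U i)))"
    unfolding hausdorff_pre_def
    using cov sim(1) by (intro INF_lower2[of "\<lambda>i. T ` U i"]) (auto simp: image_UN[symmetric])
  also have "\<dots> \<le> (\<Sum>i. ennreal (t ^ m) * ennreal (hausdorff_size m (U i)))"
    using sim(3) t by (intro suminf_le) (auto simp: ennreal_mult'[symmetric] intro!: ennreal_leI)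
  also have "\<dots> = ennreal (t ^ m) * (\<Sum>i. ennreal (hausdorff_size m (U i)))"
    by simp
  finally have "ennreal (1 / t ^ m) * hausdorff_pre m (t * \<delta>) (T ` A)
      \<le> ennreal (1 / t ^ m) * (ennreal (t ^ m) * (\<Sum>i. ennreal (hausdorff_size m (U i))))"
    by (rule mult_left_mono) simp
  also have "\<dots> = (\<Sum>i. ennreal (hausdorff_size m (U i)))"
    using t by (simp add: mult.assoc[symmetric] ennreal_mult[symmetric])
  finally show "ennreal (1 / t ^ m) * hausdorff_pre m (t * \<delta>) (T ` A)
      \<le> (\<Sum>i. ennreal (hausdorff_size m (U i)))" .
qed

lemma hausdorff_outer_similarity_le:
  fixes T :: "'a::metric_space \<Rightarrow> 'a"
  assumes t: "t > 0" and T: "\<And>x y. dist (T x) (T y) = t * dist x y"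
  shows "hausdorff_outer m (T ` A) \<le> ennreal (t ^ m) * hausdorff_outer m A"
  unfolding hausdorff_outer_def[of m "T ` A"]
proof (rule SUP_least)
  fix \<delta> :: real assume d: "\<delta> \<in> {0<..}"
  have "hausdorff_pre m \<delta> (T ` A)
      = ennreal (t ^ m) * (ennreal (1 / t ^ m) * hausdorff_pre m (t * (\<delta> / t)) (T ` A))"
    using t by (simp add: mult.assoc[symmetric] ennreal_mult[symmetric])
  also have "\<dots> \<le> ennreal (t ^ m) * hausdorff_pre m (\<delta> / t) A"
    by (intro mult_left_mono hausdorff_pre_similarity_le[OF t T]) simp
  also have "\<dots> \<le> ennreal (t ^ m) * hausdorff_outer m A"
    unfolding hausdorff_outer_def using d t by (intro mult_left_mono SUP_upper) auto
  finally show "hausdorff_pre m \<delta> (T ` A) \<le> ennreal (t ^ m) * hausdorff_outer m A" .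
qed

lemma space_hausdorff_measure [simp]: "space (hausdorff_measure m) = UNIV"
  by (simp add: hausdorff_measure_def)

lemma sets_hausdorff_measure [simp, measurable_cong]: "sets (hausdorff_measure m) = sets borel"
  unfolding hausdorff_measure_def
  by (metis sets.sigma_sets_eq sets_measure_of space_borel subset_UNIV Pow_UNIV)

text \<open>No additivity of \<^const>\<open>hausdorff_outer\<close> is used: if it failed on the Borel sets,
  \<^const>\<open>measure_of\<close> would return the zero measure, which scales as well.\<close>

lemma emeasure_hausdorff_similarity:
  fixes T :: "'a::metric_space \<Rightarrow> 'a"
  assumes t: "t > 0" and T: "\<And>x y. dist (T x) (T y) = t * dist x y"
    and inv: "\<And>x. T (T' x) = x" "\<And>x. T' (T x) = x" and A: "A \<in> sets borel"
  shows "emeasure (hausdorff_measure m) (T ` A) = ennreal (t ^ m) * emeasure (hausdorff_measure m) A"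
proof -
  have T': "dist (T' x) (T' y) = (1 / t) * dist x y" for x y
    using T[of "T' x" "T' y"] inv t by simp
  have "continuous_on UNIV T'"
    by (rule lipschitz_on_continuous_on[of "1 / t"]) (use T' t in \<open>auto simp: lipschitz_on_def\<close>)
  then have "T' -` A \<in> sets borel"
    using A by (metis Int_UNIV_right borel_measurable_continuous_onI measurable_sets space_borel)
  moreover have im: "T ` A = T' -` A" using inv by (auto simp: image_iff) metis+
  ultimately have TA: "T ` A \<in> sets borel" by simp
  \<comment> \<open>The reverse inequality is the one-sided scaling bound applied to the inverse
    similarity, whose ratio is \<open>1 / t\<close>.\<close>
  have "hausdorff_outer m A = hausdorff_outer m (T' ` (T ` A))"
    using inv by (simp add: image_image)
  also have "\<dots> \<le> ennreal ((1 / t) ^ m) * hausdorff_outer m (T ` A)"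
    by (rule hausdorff_outer_similarity_le) (use t T' in auto)
  finally have "ennreal (t ^ m) * hausdorff_outer m A
      \<le> ennreal (t ^ m) * (ennreal ((1 / t) ^ m) * hausdorff_outer m (T ` A))"
    by (rule mult_left_mono) simp
  also have "\<dots> = hausdorff_outer m (T ` A)"
    using t by (simp add: mult.assoc[symmetric] ennreal_mult[symmetric] power_one_over)
  finally have eq: "hausdorff_outer m (T ` A) = ennreal (t ^ m) * hausdorff_outer m A"
    using hausdorff_outer_similarity_le[OF t T, of m A] by (intro antisym)
  have sig: "sigma_sets UNIV (sets borel) = (sets borel :: 'a set set)"
    using sets.sigma_sets_eq[of "borel :: 'a measure"] by simp
  show ?thesis
    unfolding hausdorff_measure_def emeasure_measure_of_conv sig using A TA eq by simp
qed

section \<open>Uniformly distributed measures\<close>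

lemma set_integrable_continuous_finite_measure:
  fixes f :: "'a::topological_space \<Rightarrow> real"
  assumes "finite_measure M" and "sets M = sets borel"
    and "compact S" "S \<in> sets borel" "continuous_on S f"
  shows "set_integrable M S f"
proof -
  interpret finite_measure M by fact
  obtain B where B: "\<And>x. x \<in> S \<Longrightarrow> \<bar>f x\<bar> \<le> B"
    using compact_imp_bounded[OF compact_continuous_image[OF assms(5,3)]]
    by (auto simp: bounded_iff)
  have meas: "(\<lambda>x. indicator S x *\<^sub>R f x) \<in> borel_measurable M"
    unfolding measurable_cong_sets[OF assms(2) refl]
    by (intro borel_measurable_continuous_on_indicator assms)
  have "integrable M (\<lambda>x. indicator S x *\<^sub>R f x)"
    by (rule integrable_const_bound[OF _ meas, where B = "\<bar>B\<bar>"]) (auto simp: indicator_def dest!: B)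
  then show ?thesis by (simp add: set_integrable_def)
qed

text \<open>Christensen's argument: averaging \<^term>\<open>f\<close> over balls of radius \<open>\<epsilon>\<close> and integrating the
  averages, Fubini exchanges the two measures up to a factor independent of \<^term>\<open>f\<close>.\<close>

lemma uniformly_distributed_integral_eq:
  fixes \<mu> \<nu> :: "'a::{metric_space, second_countable_topology} measure" and f :: "'a \<Rightarrow> real"
  assumes fin: "finite_measure \<mu>" "finite_measure \<nu>"
    and sets [measurable_cong]: "sets \<mu> = sets borel" "sets \<nu> = sets borel"
    and S: "compact S"
    and AE: "AE x in \<mu>. x \<in> S" "AE x in \<nu>. x \<in> S"
    and unif: "\<And>x y \<epsilon>. x \<in> S \<Longrightarrow> y \<in> S \<Longrightarrow> measure \<mu> (ball x \<epsilon>) = measure \<mu> (ball y \<epsilon>)"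
      "\<And>x y \<epsilon>. x \<in> S \<Longrightarrow> y \<in> S \<Longrightarrow> measure \<nu> (ball x \<epsilon>) = measure \<nu> (ball y \<epsilon>)"
    and f: "continuous_on S f"
  shows "measure \<nu> UNIV * (LINT x:S|\<mu>. f x) = measure \<mu> UNIV * (LINT x:S|\<nu>. f x)"
proof -
  interpret \<mu>: finite_measure \<mu> by fact
  interpret \<nu>: finite_measure \<nu> by fact
  interpret P: pair_sigma_finite \<mu> \<nu> by standard
  interpret PF: finite_measure "\<mu> \<Otimes>\<^sub>M \<nu>"
    by (rule finite_measure_pair_measure) (fact fin)+
  have sp: "space \<mu> = UNIV" "space \<nu> = UNIV"
    using sets[THEN sets_eq_imp_space_eq] by simp_all
  have Sb [measurable]: "S \<in> sets borel" using S by (simp add: compact_imp_closed)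
  define F where "F x = indicator S x *\<^sub>R f x" for x
  have F [measurable]: "F \<in> borel_measurable borel"
    unfolding F_def by (intro borel_measurable_continuous_on_indicator f Sb)
  obtain B where B: "\<And>x. x \<in> S \<Longrightarrow> \<bar>f x\<bar> \<le> B"
    using compact_imp_bounded[OF compact_continuous_image[OF f S]] by (auto simp: bounded_iff)
  have FB: "\<bar>F x\<bar> \<le> \<bar>B\<bar>" for x by (auto simp: F_def indicator_def dest!: B)
  let ?m = "measure \<mu> UNIV" and ?n = "measure \<nu> UNIV"
  show ?thesis
  proof (cases "S = {} \<or> ?n = 0")
    case True
    then show ?thesis
    proof
      assume "?n = 0"
      then have "emeasure \<nu> (space \<nu>) = 0" by (simp add: \<nu>.emeasure_eq_measure sp)
      then have "AE x in \<nu>. False" by (intro AE_I[where N = "space \<nu>"]) auto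
      then have "(LINT x:S|\<nu>. f x) = 0"
        unfolding set_lebesgue_integral_def by (intro integral_eq_zero_AE) auto
      then show ?thesis using \<open>?n = 0\<close> by simp
    qed (simp add: set_lebesgue_integral_def)
  next
    case False
    then obtain x0 where x0: "x0 \<in> S" and n: "?n > 0"
      using measure_nonneg[of \<nu> UNIV] by (auto simp: less_le)
    have main: "\<bar>?m * (\<integral>y. F y \<partial>\<nu>) - ?n * (\<integral>x. F x \<partial>\<mu>)\<bar> \<le> \<eta> * (?m * ?n)" if \<eta>: "\<eta> > 0" for \<eta>
    proof -
      have "uniformly_continuous_on S f" using f S compact_uniformly_continuous by blast
      then obtain \<epsilon> where \<epsilon>: "\<epsilon> > 0"
        "\<And>x y. x \<in> S \<Longrightarrow> y \<in> S \<Longrightarrow> dist x y < \<epsilon> \<Longrightarrow> \<bar>f x - f y\<bar> < \<eta>"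
        using \<eta> unfolding uniformly_continuous_on_def dist_real_def by metis
      define g where "g = measure \<mu> (ball x0 \<epsilon>)"
      define h where "h = measure \<nu> (ball x0 \<epsilon>)"
      \<comment> \<open>Otherwise every ball of radius \<open>\<epsilon>\<close> centred in
        \<open>S\<close> is null, and finitely many of them cover the compact set \<open>S\<close>,
        which carries all of \<open>\<nu>\<close>.\<close>
      have h: "h > 0"
      proof (rule ccontr)
        assume "\<not> h > 0"
        then have "h = 0" using h_def measure_nonneg[of \<nu> "ball x0 \<epsilon>"] by simp
        then have "measure \<nu> (ball x \<epsilon>) = 0" if "x \<in> S" for x
          using unif(2)[OF that x0] h_def by simp
        then have N: "ball x \<epsilon> \<in> null_sets \<nu>" if "x \<in> S" for x
          using that by (auto simp: null_sets_def \<nu>.emeasure_eq_measure sets)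
        obtain C where C: "C \<subseteq> S" "finite C" "S \<subseteq> (\<Union>x\<in>C. ball x \<epsilon>)"
          using compactE_image[OF S, of S "\<lambda>x. ball x \<epsilon>"] \<epsilon>(1) by (metis UN_I centre_in_ball open_ball subsetI)
        have "(\<Union>x\<in>C. ball x \<epsilon>) \<in> null_sets \<nu>"
          using C N by (intro null_sets_UN' countable_finite) auto
        then have "AE x in \<nu>. x \<notin> (\<Union>x\<in>C. ball x \<epsilon>)" by (rule AE_not_in)
        with AE(2) have "AE x in \<nu>. False" by eventually_elim (use C in auto)
        then have "emeasure \<nu> (space \<nu>) = 0" using AE_iff_measurable[of UNIV \<nu> "\<lambda>_. False"] by (simp add: sp sets)
        then show False using n by (simp add: measure_def sp)
      qed
      \<comment> \<open>Integrating this symmetric kernel in one variable gives a ball measure: the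
        constant \<open>g\<close> for \<open>\<mu>\<close> and \<open>h\<close> for
        \<open>\<nu>\<close>, as long as the other variable lies in \<open>S\<close>.\<close>
      define K :: "'a \<Rightarrow> 'a \<Rightarrow> real" where "K x y = indicator {p. dist (fst p) (snd p) < \<epsilon>} (x, y)" for x y
      have op: "open {p::'a \<times> 'a. dist (fst p) (snd p) < \<epsilon>}"
        by (intro open_Collect_less continuous_intros)
      have setsP: "sets (\<mu> \<Otimes>\<^sub>M \<nu>) = sets (borel :: ('a \<times> 'a) measure)"
        unfolding borel_prod[symmetric] by (rule sets_pair_measure_cong) (fact sets)+
      have [measurable]: "(\<lambda>p. K (fst p) (snd p)) \<in> borel_measurable (\<mu> \<Otimes>\<^sub>M \<nu>)"
        unfolding K_def measurable_cong_sets[OF setsP refl] prod.collapse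
        by (intro borel_measurable_indicator borel_open op)
      have [measurable]: "(\<lambda>p. F (fst p)) \<in> borel_measurable (\<mu> \<Otimes>\<^sub>M \<nu>)"
         "(\<lambda>p. F (snd p)) \<in> borel_measurable (\<mu> \<Otimes>\<^sub>M \<nu>)"
        using measurable_compose[OF measurable_fst, of F \<mu> borel \<nu>]
          measurable_compose[OF measurable_snd, of F \<nu> borel \<mu>] F
        by (simp_all add: measurable_cong_sets[OF sets(1) refl] measurable_cong_sets[OF sets(2) refl])
      have K01: "0 \<le> K x y" "K x y \<le> 1" for x y by (auto simp: K_def indicator_def)
      have intg: "integrable (\<mu> \<Otimes>\<^sub>M \<nu>) (\<lambda>p. K (fst p) (snd p) * G p)"
        if [measurable]: "G \<in> borel_measurable (\<mu> \<Otimes>\<^sub>M \<nu>)" and G: "\<And>p. \<bar>G p\<bar> \<le> c" for G :: "'a \<times> 'a \<Rightarrow> real" and c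
      proof (rule PF.integrable_const_bound[where B = c])
        have "\<bar>K (fst p) (snd p) * G p\<bar> \<le> 1 * c" for p
          unfolding abs_mult using K01 G by (intro mult_mono) auto
        then show "AE p in \<mu> \<Otimes>\<^sub>M \<nu>. norm (K (fst p) (snd p) * G p) \<le> c" by simp
      qed measurable
      have iF2: "integrable (\<mu> \<Otimes>\<^sub>M \<nu>) (\<lambda>p. K (fst p) (snd p) * F (snd p))" by (rule intg) (use FB in auto)
      have iF1: "integrable (\<mu> \<Otimes>\<^sub>M \<nu>) (\<lambda>p. K (fst p) (snd p) * F (fst p))" by (rule intg) (use FB in auto)
      have i1: "integrable (\<mu> \<Otimes>\<^sub>M \<nu>) (\<lambda>p. K (fst p) (snd p) * 1)" by (rule intg[where c = 1]) auto
      have Kmu: "(\<integral>x. K x y \<partial>\<mu>) = g" if "y \<in> S" for y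
      proof -
        have "(\<integral>x. K x y \<partial>\<mu>) = (\<integral>x. indicator (ball y \<epsilon>) x \<partial>\<mu>)"
          by (intro Bochner_Integration.integral_cong) (auto simp: K_def indicator_def dist_commute)
        then show ?thesis using unif(1)[OF that x0] by (simp add: g_def sp)
      qed
      have Knu: "(\<integral>y. K x y \<partial>\<nu>) = h" if "x \<in> S" for x
      proof -
        have "(\<integral>y. K x y \<partial>\<nu>) = (\<integral>y. indicator (ball x \<epsilon>) y \<partial>\<nu>)"
          by (intro Bochner_Integration.integral_cong) (auto simp: K_def indicator_def)
        then show ?thesis using unif(2)[OF that x0] by (simp add: h_def sp)
      qed
      have F2: "(\<integral>p. K (fst p) (snd p) * F (snd p) \<partial>(\<mu> \<Otimes>\<^sub>M \<nu>)) = g * (\<integral>y. F y \<partial>\<nu>)"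
      proof -
        have "(\<integral>p. K (fst p) (snd p) * F (snd p) \<partial>(\<mu> \<Otimes>\<^sub>M \<nu>)) = (\<integral>y. (\<integral>x. K x y * F y \<partial>\<mu>) \<partial>\<nu>)"
          using P.integral_snd[of "\<lambda>x y. K x y * F y"] iF2 by (simp add: case_prod_beta')
        also have "\<dots> = (\<integral>y. g * F y \<partial>\<nu>)"
          by (intro Bochner_Integration.integral_cong) (auto simp: F_def indicator_def Kmu)
        finally show ?thesis by simp
      qed
      have F1: "(\<integral>p. K (fst p) (snd p) * F (fst p) \<partial>(\<mu> \<Otimes>\<^sub>M \<nu>)) = h * (\<integral>x. F x \<partial>\<mu>)"
      proof -
        have "(\<integral>p. K (fst p) (snd p) * F (fst p) \<partial>(\<mu> \<Otimes>\<^sub>M \<nu>)) = (\<integral>x. (\<integral>y. K x y * F x \<partial>\<nu>) \<partial>\<mu>)"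
          using P.integral_fst'[OF iF1] by (simp add: case_prod_beta')
        also have "\<dots> = (\<integral>x. h * F x \<partial>\<mu>)"
          by (intro Bochner_Integration.integral_cong) (auto simp: F_def indicator_def Knu)
        finally show ?thesis by simp
      qed
      have one1: "(\<integral>p. K (fst p) (snd p) * 1 \<partial>(\<mu> \<Otimes>\<^sub>M \<nu>)) = h * ?m"
      proof -
        have "(\<integral>p. K (fst p) (snd p) * 1 \<partial>(\<mu> \<Otimes>\<^sub>M \<nu>)) = (\<integral>x. (\<integral>y. K x y \<partial>\<nu>) \<partial>\<mu>)"
          using P.integral_fst'[OF i1] by (simp add: case_prod_beta')
        also have "\<dots> = (\<integral>x. h \<partial>\<mu>)"
          using AE(1) borel_measurable_integrable[OF P.integrable_fst'[OF i1]]
          by (intro integral_cong_AE) (auto elim!: eventually_mono simp: Knu)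
        finally show ?thesis by (simp add: sp)
      qed
      have one2: "(\<integral>p. K (fst p) (snd p) * 1 \<partial>(\<mu> \<Otimes>\<^sub>M \<nu>)) = g * ?n"
      proof -
        have "(\<integral>p. K (fst p) (snd p) * 1 \<partial>(\<mu> \<Otimes>\<^sub>M \<nu>)) = (\<integral>y. (\<integral>x. K x y \<partial>\<mu>) \<partial>\<nu>)"
          using P.integral_snd[of "\<lambda>x y. K x y"] i1 by (simp add: case_prod_beta')
        also have "\<dots> = (\<integral>x. g \<partial>\<nu>)"
          using AE(2) borel_measurable_integrable[OF P.integrable_snd[of "\<lambda>x y. K x y"]] i1
          by (intro integral_cong_AE) (auto elim!: eventually_mono simp: Kmu case_prod_beta')
        finally show ?thesis by (simp add: sp)
      qed
      have AEP: "AE p in \<mu> \<Otimes>\<^sub>M \<nu>. fst p \<in> S \<and> snd p \<in> S"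
      proof (rule P.AE_pair_measure)
        have "{x \<in> space (\<mu> \<Otimes>\<^sub>M \<nu>). fst x \<in> S \<and> snd x \<in> S} = S \<times> S"
          by (auto simp: space_pair_measure sp)
        then show "{x \<in> space (\<mu> \<Otimes>\<^sub>M \<nu>). fst x \<in> S \<and> snd x \<in> S} \<in> sets (\<mu> \<Otimes>\<^sub>M \<nu>)"
          by (simp add: sets Sb)
        show "AE x in \<mu>. AE y in \<nu>. fst (x, y) \<in> S \<and> snd (x, y) \<in> S"
          using AE(1) by eventually_elim (use AE(2) in auto)
      qed
      \<comment> \<open>Where \<open>K\<close> does not vanish the two arguments are
        \<open>\<epsilon>\<close>-close, so replacing \<open>F (snd p)\<close> by
        \<open>F (fst p)\<close> costs at most \<open>\<eta>\<close> times the total mass of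
        \<open>K\<close>.\<close>
      have "\<bar>g * (\<integral>y. F y \<partial>\<nu>) - h * (\<integral>x. F x \<partial>\<mu>)\<bar>
          = \<bar>\<integral>p. K (fst p) (snd p) * F (snd p) - K (fst p) (snd p) * F (fst p) \<partial>(\<mu> \<Otimes>\<^sub>M \<nu>)\<bar>"
        using iF1 iF2 by (simp add: F1 F2)
      also have "\<dots> \<le> (\<integral>p. \<eta> * (K (fst p) (snd p) * 1) \<partial>(\<mu> \<Otimes>\<^sub>M \<nu>))"
      proof (rule order_trans[OF integral_abs_bound integral_mono_AE])
        show "integrable (\<mu> \<Otimes>\<^sub>M \<nu>) (\<lambda>x. \<bar>K (fst x) (snd x) * F (snd x) - K (fst x) (snd x) * F (fst x)\<bar>)"
          using iF1 iF2 by (intro integrable_abs Bochner_Integration.integrable_diff)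
        show "integrable (\<mu> \<Otimes>\<^sub>M \<nu>) (\<lambda>p. \<eta> * (K (fst p) (snd p) * 1))"
          using i1 by (intro integrable_mult_right)
        show "AE x in \<mu> \<Otimes>\<^sub>M \<nu>. \<bar>K (fst x) (snd x) * F (snd x) - K (fst x) (snd x) * F (fst x)\<bar>
            \<le> \<eta> * (K (fst x) (snd x) * 1)"
          using AEP
        proof eventually_elim
          case (elim p)
          have "\<bar>f (snd p) - f (fst p)\<bar> \<le> \<eta>" if "dist (fst p) (snd p) < \<epsilon>"
            using \<epsilon>(2)[of "snd p" "fst p"] elim that by (simp add: dist_commute)
          then show ?case using elim by (cases "dist (fst p) (snd p) < \<epsilon>") (simp_all add: K_def F_def)
        qed
      qed
      also have "\<dots> = \<eta> * (h * ?m)" by (subst integral_mult_right_zero, subst one1) simp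
      finally have le: "\<bar>g * (\<integral>y. F y \<partial>\<nu>) - h * (\<integral>x. F x \<partial>\<mu>)\<bar> \<le> \<eta> * (h * ?m)" .
      \<comment> \<open>The mass of \<open>K\<close> computed in both orders fixes the ratio of
        \<open>g\<close> and \<open>h\<close>; this trades the ball measures for the total
        masses.\<close>
      have gn: "g * ?n = h * ?m" using one1 one2 by simp
      have "h * \<bar>?m * (\<integral>y. F y \<partial>\<nu>) - ?n * (\<integral>x. F x \<partial>\<mu>)\<bar>
          = \<bar>(h * ?m) * (\<integral>y. F y \<partial>\<nu>) - ?n * (h * (\<integral>x. F x \<partial>\<mu>))\<bar>"
        using h abs_mult[of h "?m * (\<integral>y. F y \<partial>\<nu>) - ?n * (\<integral>x. F x \<partial>\<mu>)"] by (simp add: algebra_simps)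
      also have "\<dots> = \<bar>?n * (g * (\<integral>y. F y \<partial>\<nu>) - h * (\<integral>x. F x \<partial>\<mu>))\<bar>"
        unfolding gn[symmetric] by (simp add: algebra_simps)
      also have "\<dots> \<le> ?n * (\<eta> * (h * ?m))" using le n by (simp add: abs_mult)
      finally have "h * \<bar>?m * (\<integral>y. F y \<partial>\<nu>) - ?n * (\<integral>x. F x \<partial>\<mu>)\<bar> \<le> h * (\<eta> * (?m * ?n))"
        by (simp add: algebra_simps)
      then show ?thesis using h by simp
    qed
    have "\<bar>?m * (\<integral>y. F y \<partial>\<nu>) - ?n * (\<integral>x. F x \<partial>\<mu>)\<bar> \<le> 0"
    proof (rule field_le_epsilon)
      fix e :: real assume "e > 0"
      moreover have "e / (?m * ?n + 1) * (?m * ?n) \<le> e"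
      proof -
        have "0 \<le> ?m * ?n" by simp
        then have "?m * ?n + 1 > 0" by linarith
        then show ?thesis using \<open>e > 0\<close> by (simp add: divide_le_eq distrib_left)
      qed
      moreover have "?m * ?n + 1 > 0" by (simp add: add_nonneg_pos)
      ultimately show "\<bar>?m * (\<integral>y. F y \<partial>\<nu>) - ?n * (\<integral>x. F x \<partial>\<mu>)\<bar> \<le> 0 + e"
        using main[of "e / (?m * ?n + 1)"] by simp
    qed
    then show ?thesis by (simp add: F_def set_lebesgue_integral_def)
  qed
qed

section \<open>Surface measure on spheres\<close>

lemma borel_measurable_isometry:
  fixes R :: "'a::euclidean_space \<Rightarrow> 'a"
  assumes "\<And>x y. dist (R x) (R y) = dist x y"
  shows "R \<in> borel_measurable borel"
proof (intro borel_measurable_continuous_onI lipschitz_on_continuous_on)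
  show "1-lipschitz_on UNIV R" using assms by (auto simp: lipschitz_on_def)
qed

text \<open>By Vitali's theorem an open set is, up to a null set, a disjoint union of balls, and an
  isometry preserves the volume of balls.\<close>

lemma distr_lborel_isometry:
  fixes R R' :: "'a::euclidean_space \<Rightarrow> 'a"
  assumes iso: "\<And>x y. dist (R x) (R y) = dist x y"
    and inv: "\<And>x. R (R' x) = x" "\<And>x. R' (R x) = x"
  shows "distr lborel borel R = lborel"
proof -
  have iso': "dist (R' x) (R' y) = dist x y" for x y by (metis inv(1) iso)
  have [measurable]: "R \<in> borel_measurable borel" using borel_measurable_isometry[OF iso] .
  have im: "R -` A = R' ` A" for A using inv by (auto simp: image_iff) metis
  have vb: "R -` ball a \<rho> = ball (R' a) \<rho>" for a \<rho>
    using iso[of "R' a"] inv(1) by auto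
  have key: "emeasure lborel (R -` U) = emeasure lborel U" if U: "open U" for U
  proof -
    define K where "K = {(a, \<rho>). 0 < \<rho> \<and> ball a \<rho> \<subseteq> U}"
    have "\<exists>i. i \<in> K \<and> x \<in> ball (fst i) (snd i) \<and> snd i < d" if xd: "x \<in> U" "0 < d" for x d
    proof -
      obtain e where e: "e > 0" "ball x e \<subseteq> U" using U xd openE by blast
      have "ball x (min e (d/2)) \<subseteq> U" using e by auto
      then show ?thesis using e xd by (intro exI[of _ "(x, min e (d/2))"]) (auto simp: K_def)
    qed
    from Vitali_covering_theorem_balls[of U K fst snd, OF this]
    obtain C where C: "countable C" "C \<subseteq> K"
       "pairwise (\<lambda>i j. disjnt (ball (fst i) (snd i)) (ball (fst j) (snd j))) C"
       "negligible (U - (\<Union>i\<in>C. ball (fst i) (snd i)))" .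
    define D where "D = (\<Union>i\<in>C. ball (fst i) (snd i))"
    have DU: "D \<subseteq> U" using C(2) by (fastforce simp: D_def K_def)
    have [measurable]: "U \<in> sets borel" "D \<in> sets borel" using U by (auto simp: D_def intro!: borel_open)
    have null: "A \<in> null_sets lborel" if "negligible A" "A \<in> sets borel" for A :: "'a set"
      using that by (simp add: negligible_iff_null_sets null_sets_completion_iff)
    \<comment> \<open>An isometry is Lipschitz, so the part of \<open>U\<close> missed by the Vitali
      balls stays null under it. It remains to compare disjoint unions of balls with equal
      radii.\<close>
    have "negligible (R' ` (U - D))"
    proof (rule negligible_locally_Lipschitz_image)
      show "negligible (U - D)" using C(4) by (simp add: D_def)
      show "\<exists>T B. open T \<and> x \<in> T \<and> (\<forall>y\<in>(U - D) \<inter> T. norm (R' y - R' x) \<le> B * norm (y - x))" for x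
        using iso' by (intro exI[of _ UNIV] exI[of _ 1]) (auto simp: dist_norm)
    qed simp
    moreover have "R -` A \<in> sets borel" if "A \<in> sets borel" for A
      using measurable_sets_borel[of R borel A] that by simp
    ultimately have N2: "R -` (U - D) \<in> null_sets lborel" "R -` U \<in> sets borel"
      using null[of "R -` (U - D)"] unfolding im[symmetric] by simp_all
    have N1: "U - D \<in> null_sets lborel" using C(4) null[of "U - D"] by (simp add: D_def[symmetric])
    have "emeasure lborel (R -` U) = emeasure lborel (R -` U - R -` (U - D))"
      using N2 by (intro emeasure_Diff_null_set[symmetric]) auto
    also have "R -` U - R -` (U - D) = (\<Union>i\<in>C. ball (R' (fst i)) (snd i))"
      using DU by (auto simp: D_def vb[symmetric])
    also have "emeasure lborel \<dots> = (\<integral>\<^sup>+i. emeasure lborel (ball (R' (fst i)) (snd i)) \<partial>count_space C)"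
    proof (rule emeasure_UN_countable[OF _ C(1)])
      have "disjnt (ball (R' (fst i)) (snd i)) (ball (R' (fst j)) (snd j))" if "i \<in> C" "j \<in> C" "i \<noteq> j" for i j
        unfolding vb[symmetric] using C(3) that by (auto simp: pairwise_def disjnt_def)
      then show "disjoint_family_on (\<lambda>i. ball (R' (fst i)) (snd i)) C"
        by (auto simp: disjoint_family_on_def disjnt_def)
    qed simp
    also have "\<dots> = (\<integral>\<^sup>+i. emeasure lborel (ball (fst i) (snd i)) \<partial>count_space C)"
    proof (rule nn_integral_cong)
      fix i assume "i \<in> space (count_space C)"
      then have "snd i \<ge> 0" using C(2) by (auto simp: K_def)
      then show "emeasure lborel (ball (R' (fst i)) (snd i)) = emeasure lborel (ball (fst i) (snd i))"
        by (simp add: emeasure_ball)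
    qed
    also have "\<dots> = emeasure lborel D"
      unfolding D_def
    proof (rule emeasure_UN_countable[OF _ C(1), symmetric])
      show "disjoint_family_on (\<lambda>i. ball (fst i) (snd i)) C"
        using C(3) by (auto simp: disjoint_family_on_def pairwise_def disjnt_def)
    qed simp
    also have "D = U - (U - D)" using DU by blast
    also have "emeasure lborel \<dots> = emeasure lborel U"
      using N1 by (intro emeasure_Diff_null_set) auto
    finally show ?thesis .
  qed
  show ?thesis
  proof (rule lborel_eqI[symmetric])
    fix l u :: 'a assume "\<And>b. b \<in> Basis \<Longrightarrow> l \<bullet> b \<le> u \<bullet> b"
    then show "emeasure (distr lborel borel R) (box l u) = (\<Prod>b\<in>Basis. (u - l) \<bullet> b)"
      using key[of "box l u"] by (subst emeasure_distr) (auto simp: emeasure_lborel_box inner_diff_left)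
  qed simp
qed

text \<open>The reflection in the hyperplane orthogonal to \<open>x - y\<close> exchanges two points
  of equal norm. It is an involution and so serves as its own inverse in both invariance arguments.
  If \<open>x = y\<close>, division by zero makes \<open>R\<close> the identity.\<close>

lemma exists_reflection:
  fixes x y :: "'a::real_inner"
  assumes xy: "norm x = norm y"
  obtains R where "linear R" "\<And>z. R (R z) = z" "\<And>z. norm (R z) = norm z" "R x = y"
proof -
  define w where "w = x - y"
  define R where "R z = z - (2 * (z \<bullet> w) / (w \<bullet> w)) *\<^sub>R w" for z
  have lin: "linear R"
    unfolding R_def by (rule linearI) (simp_all add: inner_add_left distrib_left add_divide_distrib
      scaleR_add_left scaleR_diff_right mult.left_commute)
  have Rw: "R w = - w"
    by (cases "w = 0") (auto simp: R_def scaleR_2[symmetric] algebra_simps)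
  have inv: "R (R z) = z" for z
  proof -
    have "R (R z) = R z - (2 * (z \<bullet> w) / (w \<bullet> w)) *\<^sub>R R w"
      using lin by (subst (2) R_def) (simp add: linear_diff linear_scale)
    then show ?thesis by (simp add: Rw) (simp add: R_def)
  qed
  have nrm: "norm (R z) = norm z" for z
  proof -
    have "(R z) \<bullet> (R z) = z \<bullet> z"
    proof (cases "w = 0")
      case False
      define k where "k = 2 * (z \<bullet> w) / (w \<bullet> w)"
      have k: "k * (w \<bullet> w) = 2 * (z \<bullet> w)" using False by (simp add: k_def)
      have "(R z) \<bullet> (R z) = z \<bullet> z - 2 * k * (z \<bullet> w) + k * (k * (w \<bullet> w))"
        unfolding R_def k_def[symmetric]
        by (simp add: inner_diff_left inner_diff_right inner_commute algebra_simps)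
      then show ?thesis unfolding k by simp
    qed (simp add: R_def)
    then show ?thesis by (simp add: norm_eq_sqrt_inner)
  qed
  have "R x = y"
  proof (cases "w = 0")
    case False
    have "x \<bullet> x = y \<bullet> y" using xy by (simp add: norm_eq_sqrt_inner)
    then have "2 * (x \<bullet> w) = w \<bullet> w"
      by (simp add: w_def inner_diff_left inner_diff_right inner_commute)
    then show ?thesis using False by (simp add: R_def w_def)
  qed (simp add: R_def w_def)
  with lin inv nrm that show ?thesis by blast
qed

text \<open>Surface measure of the unit sphere, up to the factor \<open>DIM('a)\<close>: the Lebesgue measure of
  the cone over a subset of the sphere.\<close>

definition sphere_measure :: "'a::euclidean_space measure" where
  "sphere_measure = distr (restrict_space lborel (ball 0 1)) borel sgn"

lemma measurable_sgn_vector [measurable]: "(sgn :: 'a::euclidean_space \<Rightarrow> 'a) \<in> borel_measurable borel"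
  unfolding sgn_div_norm by measurable

lemma measurable_sgn_restrict:
  "(sgn :: 'a::euclidean_space \<Rightarrow> 'a) \<in> borel_measurable (restrict_space lborel (ball 0 1))"
  by (intro measurable_restrict_space1) simp

lemma sets_sphere_measure [simp, measurable_cong]: "sets sphere_measure = sets borel"
  and space_sphere_measure [simp]: "space sphere_measure = UNIV"
  by (simp_all add: sphere_measure_def)

lemma emeasure_sphere_measure:
  assumes "A \<in> sets borel"
  shows "emeasure sphere_measure A = emeasure lborel (sgn -` A \<inter> ball (0::'a::euclidean_space) 1)"
  unfolding sphere_measure_def
  by (subst emeasure_distr[OF measurable_sgn_restrict assms])
    (subst emeasure_restrict_space, auto simp: space_restrict_space Int_commute)

lemma finite_sphere_measure: "finite_measure (sphere_measure :: 'a::euclidean_space measure)"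
  by (rule finite_measureI) (auto simp: emeasure_sphere_measure emeasure_ball)

lemma measure_sphere_measure_pos: "measure (sphere_measure :: 'a::euclidean_space measure) UNIV > 0"
  using content_ball_pos[of 1 "0::'a"] by (simp add: measure_def emeasure_sphere_measure)

text \<open>The apex \<open>0\<close> of the cone, where \<open>sgn\<close> is \<open>0\<close>, is
  the only point sent off the sphere.\<close>

lemma AE_sphere_measure: "AE \<omega> in sphere_measure. \<omega> \<in> sphere (0::'a::euclidean_space) 1"
proof -
  have "AE y in lborel. y \<noteq> (0::'a)"
    by (intro AE_I[where N = "{0}"]) (auto simp: emeasure_lborel_singleton)
  then have "AE y in lborel. y \<in> ball (0::'a) 1 \<longrightarrow> sgn y \<in> sphere 0 1"
    by eventually_elim (auto simp: norm_sgn)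
  then show ?thesis
    unfolding sphere_measure_def
    by (subst AE_distr_iff[OF measurable_sgn_restrict]) (auto simp: AE_restrict_space_iff)
qed

text \<open>A linear isometry commutes with \<open>sgn\<close>, so a reflection taking
  \<open>x\<close> to \<open>y\<close> carries the cone over one cap onto the cone over the other,
  and Lebesgue measure is invariant under it.\<close>

lemma measure_sphere_measure_ball:
  fixes x y :: "'a::euclidean_space"
  assumes "x \<in> sphere 0 1" "y \<in> sphere 0 1"
  shows "measure sphere_measure (ball x \<epsilon>) = measure sphere_measure (ball y \<epsilon>)"
proof -
  have "norm x = norm y" using assms by simp
  then obtain R where R: "linear R" "\<And>z. R (R z) = z" "\<And>z. norm (R z) = norm z" "R x = y"
    using exists_reflection by blast
  have iso: "dist (R a) (R b) = dist a b" for a b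
    by (simp add: dist_norm linear_diff[OF R(1), symmetric] R(3))
  have sgn: "sgn (R z) = R (sgn z)" for z
    by (simp add: sgn_div_norm R(3) linear_scale[OF R(1)])
  let ?A = "\<lambda>x. sgn -` ball x \<epsilon> \<inter> ball (0::'a) 1"
  have [measurable]: "?A y \<in> sets borel" using measurable_sets_borel[OF measurable_sgn_vector, of "ball y \<epsilon>"] by simp
  have "R -` ?A y = ?A x"
    by (auto simp: sgn R(4)[symmetric] iso R(3))
  moreover have "emeasure lborel (?A y) = emeasure (distr lborel borel R) (?A y)"
    by (simp add: distr_lborel_isometry[OF iso R(2,2)])
  ultimately have "emeasure lborel (?A y) = emeasure lborel (?A x)"
    by (subst (asm) emeasure_distr) (auto intro: borel_measurable_isometry[OF iso])
  then show ?thesis by (simp add: measure_def emeasure_sphere_measure)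
qed

text \<open>Reflections make caps of equal radius equally large for the Hausdorff measure too. If
  the sphere has finite measure, the comparison of uniformly distributed measures applies; if it is
  infinite, \<open>c = 0\<close> works by the default value of non-integrable integrals.\<close>

lemma hausdorff_unit_sphere_integral:
  "\<exists>c\<ge>0. \<forall>f :: 'a \<Rightarrow> real. continuous_on (sphere (0::'a::euclidean_space) 1) f \<longrightarrow>
     (LINT y:sphere 0 1|hausdorff_measure k. f y) = c * (LINT \<omega>:sphere 0 1|sphere_measure. f \<omega>)"
proof -
  let ?S = "sphere (0::'a) 1" and ?H = "hausdorff_measure k :: 'a measure"
  have cap: "emeasure ?H (ball x \<epsilon> \<inter> ?S) = emeasure ?H (ball y \<epsilon> \<inter> ?S)"
    if xy: "x \<in> ?S" "y \<in> ?S" for x y \<epsilon>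
  proof -
    have "norm x = norm y" using xy by simp
    then obtain R where R: "linear R" "\<And>z. R (R z) = z" "\<And>z. norm (R z) = norm z" "R x = y"
      using exists_reflection by blast
    have iso: "dist (R a) (R b) = dist a b" for a b
      by (simp add: dist_norm linear_diff[OF R(1), symmetric] R(3))
    have *: "R z \<in> ball y \<epsilon> \<inter> ?S" if "z \<in> ball x \<epsilon> \<inter> ?S" for z
      using that by (auto simp: R(4)[symmetric] iso R(3))
    have **: "R z \<in> ball x \<epsilon> \<inter> ?S" if "z \<in> ball y \<epsilon> \<inter> ?S" for z
      using that iso[of x "R z"] by (auto simp: R)
    have "R ` (ball x \<epsilon> \<inter> ?S) = ball y \<epsilon> \<inter> ?S"
      using * ** R(2) by (metis (no_types, lifting) image_eqI image_subsetI subsetI subset_antisym)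
    then show ?thesis
      using emeasure_hausdorff_similarity[of 1 R R "ball x \<epsilon> \<inter> ?S" k] iso R(2) by simp
  qed
  show ?thesis
  proof (cases "emeasure ?H ?S < \<infinity>")
    case True
    define \<mu> where "\<mu> = density ?H (\<lambda>x. ennreal (indicator ?S x))"
    have em: "emeasure \<mu> A = emeasure ?H (?S \<inter> A)" if "A \<in> sets borel" for A
      using that emeasure_restricted[of ?S ?H A] by (simp add: \<mu>_def ennreal_indicator)
    have "finite_measure \<mu>"
      by (rule finite_measureI) (use True em[of UNIV] in \<open>auto simp: \<mu>_def\<close>)
    moreover have "sets \<mu> = sets borel" by (simp add: \<mu>_def)
    moreover have "AE x in \<mu>. x \<in> ?S"
      unfolding \<mu>_def by (subst AE_density) (auto simp: indicator_def)
    moreover have "measure \<mu> (ball x \<epsilon>) = measure \<mu> (ball y \<epsilon>)" if "x \<in> ?S" "y \<in> ?S" for x y \<epsilon>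
      using cap[OF that] by (simp add: measure_def em Int_commute)
    ultimately have mu: "finite_measure \<mu>" "sets \<mu> = sets borel" "AE x in \<mu>. x \<in> ?S"
      "\<And>x y \<epsilon>. x \<in> ?S \<Longrightarrow> y \<in> ?S \<Longrightarrow> measure \<mu> (ball x \<epsilon>) = measure \<mu> (ball y \<epsilon>)" by blast+
    have eq: "measure (sphere_measure :: 'a measure) UNIV * (LINT x:?S|\<mu>. f x)
        = measure \<mu> UNIV * (LINT x:?S|sphere_measure. f x)" if "continuous_on ?S f" for f :: "'a \<Rightarrow> real"
      by (rule uniformly_distributed_integral_eq[OF mu(1) finite_sphere_measure mu(2)
            sets_sphere_measure compact_sphere mu(3) AE_sphere_measure mu(4)
            measure_sphere_measure_ball that])
    have "(LINT x:?S|\<mu>. f x) = (LINT x:?S|?H. f x)" if "continuous_on ?S f" for f :: "'a \<Rightarrow> real"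
    proof -
      have "(\<lambda>x. indicator ?S x *\<^sub>R f x) \<in> borel_measurable ?H"
        using borel_measurable_continuous_on_indicator[OF _ that]
        by (simp add: measurable_cong_sets[OF sets_hausdorff_measure refl])
      moreover have "indicator ?S \<in> borel_measurable ?H"
        by (intro borel_measurable_indicator) simp
      ultimately show ?thesis
        unfolding set_lebesgue_integral_def \<mu>_def
        by (subst integral_density) (auto intro!: Bochner_Integration.integral_cong simp: indicator_def)
    qed
    then show ?thesis using eq measure_sphere_measure_pos[where 'a='a]
      by (intro exI[of _ "measure \<mu> UNIV / measure (sphere_measure :: 'a measure) UNIV"])
        (auto simp: field_simps)
  next
    case False
    have "(LINT y:?S|?H. f y) = 0" if f: "continuous_on ?S f" for f :: "'a \<Rightarrow> real"
    proof (cases "\<forall>x\<in>?S. f x = 0")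
      case True
      then have "(\<lambda>x. indicator ?S x *\<^sub>R f x) = (\<lambda>x. 0)" by (auto simp: indicator_def)
      then show ?thesis by (simp add: set_lebesgue_integral_def)
    next
      case nz: False
      then obtain x0 where x0: "x0 \<in> ?S" "f x0 \<noteq> 0" by blast
      define e where "e = \<bar>f x0\<bar> / 2"
      have e: "e > 0" using x0 by (simp add: e_def)
      obtain \<epsilon> where \<epsilon>: "\<epsilon> > 0" "\<And>x. x \<in> ?S \<Longrightarrow> dist x x0 < \<epsilon> \<Longrightarrow> dist (f x) (f x0) < e"
        using f x0(1) e unfolding continuous_on_iff by blast
      \<comment> \<open>Finitely many caps congruent to the one around \<open>x0\<close> cover the
        sphere, so an infinite total forces that single cap to have infinite measure; on it
        \<open>f\<close> stays away from \<open>0\<close>.\<close>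
      obtain C where C: "C \<subseteq> ?S" "finite C" "?S \<subseteq> (\<Union>x\<in>C. ball x \<epsilon>)"
        using compactE_image[OF compact_sphere, of ?S "\<lambda>x. ball x \<epsilon>"] \<epsilon>(1)
        by (metis UN_I centre_in_ball open_ball subsetI)
      have "emeasure ?H ?S \<le> emeasure ?H (\<Union>x\<in>C. ball x \<epsilon> \<inter> ?S)"
      proof (intro emeasure_mono)
        show "?S \<subseteq> (\<Union>x\<in>C. ball x \<epsilon> \<inter> ?S)" using C by auto
        show "(\<Union>x\<in>C. ball x \<epsilon> \<inter> ?S) \<in> sets ?H" using C by (intro sets.finite_UN) auto
      qed
      also have "\<dots> \<le> (\<Sum>x\<in>C. emeasure ?H (ball x \<epsilon> \<inter> ?S))"
        using C by (intro emeasure_subadditive_finite) auto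
      also have "\<dots> = (\<Sum>x\<in>C. emeasure ?H (ball x0 \<epsilon> \<inter> ?S))"
        using C x0 by (intro sum.cong refl cap) auto
      finally have "of_nat (card C) * emeasure ?H (ball x0 \<epsilon> \<inter> ?S) = \<infinity>"
        using False top_unique by (auto simp: less_top[symmetric])
      then have inf: "emeasure ?H (ball x0 \<epsilon> \<inter> ?S) = \<infinity>"
        by (auto simp: ennreal_mult_eq_top_iff)
      have "\<not> integrable ?H (\<lambda>x. indicator ?S x *\<^sub>R f x)"
      proof
        assume "integrable ?H (\<lambda>x. indicator ?S x *\<^sub>R f x)"
        then have "(\<integral>\<^sup>+x. ennreal (norm (indicator ?S x *\<^sub>R f x)) \<partial>?H) < \<infinity>"
          by (simp add: integrable_iff_bounded)
        moreover have "(\<integral>\<^sup>+x. ennreal e * indicator (ball x0 \<epsilon> \<inter> ?S) x \<partial>?H)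
            \<le> (\<integral>\<^sup>+x. ennreal (norm (indicator ?S x *\<^sub>R f x)) \<partial>?H)"
        proof (rule nn_integral_mono)
          fix x
          show "ennreal e * indicator (ball x0 \<epsilon> \<inter> ?S) x \<le> ennreal (norm (indicator ?S x *\<^sub>R f x))"
          proof (cases "x \<in> ball x0 \<epsilon> \<inter> ?S")
            case True
            then have "\<bar>f x - f x0\<bar> < e" using \<epsilon>(2)[of x] by (simp add: dist_real_def dist_commute)
            then have "e \<le> \<bar>f x\<bar>" unfolding e_def by linarith
            then show ?thesis using True by (auto intro!: ennreal_leI)
          qed simp
        qed
        moreover have "(\<integral>\<^sup>+x. ennreal e * indicator (ball x0 \<epsilon> \<inter> ?S) x \<partial>?H) = \<infinity>"
          by (subst nn_integral_cmult_indicator) (use inf e in \<open>auto simp: ennreal_mult_eq_top_iff\<close>)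
        ultimately show False by (simp add: top_unique)
      qed
      then show ?thesis by (simp add: set_lebesgue_integral_def not_integrable_integral_eq)
    qed
    then show ?thesis by (intro exI[of _ 0]) auto
  qed
qed

text \<open>The constant is not computed; it is \<open>0\<close> when the Hausdorff measure of the sphere is
  \<open>0\<close> or \<open>\<infinity>\<close>.\<close>

lemma hausdorff_sphere_integral:
  "\<exists>c\<ge>0. \<forall>(y\<^sub>0::'a::euclidean_space) r (f :: 'a \<Rightarrow> real). r > 0 \<and> continuous_on (sphere y\<^sub>0 r) f \<longrightarrow>
     (LINT y:sphere y\<^sub>0 r|hausdorff_measure k. f y)
       = c * (r ^ k * (LINT \<omega>:sphere 0 1|sphere_measure. f (y\<^sub>0 + r *\<^sub>R \<omega>)))"
proof -
  let ?H = "hausdorff_measure k :: 'a measure"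
  obtain c where c: "c \<ge> 0" "\<And>f :: 'a \<Rightarrow> real. continuous_on (sphere (0::'a) 1) f \<Longrightarrow>
     (LINT y:sphere 0 1|?H. f y) = c * (LINT \<omega>:sphere 0 1|sphere_measure. f \<omega>)"
    using hausdorff_unit_sphere_integral by blast
  have "(LINT y:sphere y\<^sub>0 r|?H. f y) = c * (r ^ k * (LINT \<omega>:sphere 0 1|sphere_measure. f (y\<^sub>0 + r *\<^sub>R \<omega>)))"
    if r: "r > 0" and f: "continuous_on (sphere y\<^sub>0 r) f" for y\<^sub>0 :: 'a and r and f :: "'a \<Rightarrow> real"
  proof -
    define T where "T \<omega> = y\<^sub>0 + r *\<^sub>R \<omega>" for \<omega> :: 'a
    define T' where "T' y = (1/r) *\<^sub>R (y - y\<^sub>0)" for y :: 'a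
    have inv: "T (T' y) = y" "T' (T y) = y" for y using r by (auto simp: T_def T'_def)
    have T: "dist (T x) (T y) = r * dist x y" for x y
      using r by (simp add: T_def dist_norm scaleR_diff_right[symmetric])
    have Tm: "T \<in> borel_measurable ?H"
      unfolding measurable_cong_sets[OF sets_hausdorff_measure refl] T_def by measurable
    \<comment> \<open>Scaling expresses the Hausdorff measure through its own image under
      \<open>T\<close>, so the change of variables becomes integration against an image measure with
      constant density.\<close>
    have HT: "?H = scale_measure (ennreal (r ^ k)) (distr ?H borel T)"
    proof (rule measure_eqI)
      fix A assume "A \<in> sets ?H"
      then have A: "A \<in> sets borel" by simp
      have pre: "T -` A \<in> sets borel" using measurable_sets[OF Tm A] by simp
      have "T ` (T -` A) = A" using inv by (auto simp: image_iff) metis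
      then show "emeasure ?H A = emeasure (scale_measure (ennreal (r ^ k)) (distr ?H borel T)) A"
        using emeasure_hausdorff_similarity[OF r T inv pre, of k] A by (simp add: emeasure_distr[OF Tm])
    qed simp
    have ST: "T \<omega> \<in> sphere y\<^sub>0 r \<longleftrightarrow> \<omega> \<in> sphere 0 1" for \<omega>
      using r by (auto simp: T_def dist_norm)
    have meas: "(\<lambda>y. indicator (sphere y\<^sub>0 r) y *\<^sub>R f y) \<in> borel_measurable borel"
      by (intro borel_measurable_continuous_on_indicator f) auto
    have "(LINT y:sphere y\<^sub>0 r|?H. f y)
        = (\<integral>y. indicator (sphere y\<^sub>0 r) y *\<^sub>R f y \<partial>scale_measure (ennreal (r ^ k)) (distr ?H borel T))"
      unfolding set_lebesgue_integral_def by (subst HT) (rule refl)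
    also have "\<dots> = (\<integral>y. indicator (sphere y\<^sub>0 r) y *\<^sub>R f y \<partial>density (distr ?H borel T) (\<lambda>_. ennreal (r ^ k)))"
      by (rule arg_cong2[where f = "integral\<^sup>L"]) (auto intro!: measure_eqI simp: emeasure_density_const)
    also have "\<dots> = (\<integral>y. r ^ k *\<^sub>R (indicator (sphere y\<^sub>0 r) y *\<^sub>R f y) \<partial>distr ?H borel T)"
      using meas r by (subst integral_density) auto
    also have "\<dots> = r ^ k * (\<integral>\<omega>. indicator (sphere y\<^sub>0 r) (T \<omega>) *\<^sub>R f (T \<omega>) \<partial>?H)"
      using meas by (subst integral_distr[OF Tm]) auto
    also have "(\<integral>\<omega>. indicator (sphere y\<^sub>0 r) (T \<omega>) *\<^sub>R f (T \<omega>) \<partial>?H) = (LINT \<omega>:sphere 0 1|?H. f (T \<omega>))"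
      unfolding set_lebesgue_integral_def
      by (intro Bochner_Integration.integral_cong refl) (simp add: ST indicator_def del: mem_sphere)
    also have "\<dots> = c * (LINT \<omega>:sphere 0 1|sphere_measure. f (T \<omega>))"
    proof (rule c(2), rule continuous_on_compose2[OF f])
      show "continuous_on (sphere 0 1) T" unfolding T_def by (intro continuous_intros)
    qed (use ST in auto)
    finally show ?thesis by (simp add: T_def)
  qed
  then show ?thesis using c(1) by blast
qed

section \<open>Integrals over balls and spheres\<close>

definition ball_integral :: "'a::euclidean_space \<Rightarrow> real \<Rightarrow> ('a \<Rightarrow> real) \<Rightarrow> real" where
  "ball_integral y\<^sub>0 r f = (LINT y:ball y\<^sub>0 r|lborel. f y)"

text \<open>The cone measure of the unit sphere is the volume of the unit ball; the factor
  \<open>DIM('a)\<close> turns it into surface area, so that this is the radial derivative of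
  \<open>ball_integral\<close>.\<close>

definition sphere_integral :: "'a::euclidean_space \<Rightarrow> real \<Rightarrow> ('a \<Rightarrow> real) \<Rightarrow> real" where
  "sphere_integral y\<^sub>0 r f =
     DIM('a) * (r ^ (DIM('a) - 1) * (LINT \<omega>:sphere 0 1|sphere_measure. f (y\<^sub>0 + r *\<^sub>R \<omega>)))"

lemma set_integrable_ball:
  fixes f :: "'a::euclidean_space \<Rightarrow> real"
  assumes "continuous_on (cball y\<^sub>0 r) f"
  shows "set_integrable lborel (ball y\<^sub>0 r) f"
proof (rule set_integrable_subset)
  show "set_integrable lborel (cball y\<^sub>0 r) f"
    using borel_integrable_compact[OF _ assms] by (simp add: set_integrable_def)
qed auto

lemma continuous_on_scaled_sphere:
  fixes f :: "'a::euclidean_space \<Rightarrow> real"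
  assumes "r > 0" "continuous_on (sphere y\<^sub>0 r) f"
  shows "continuous_on (sphere 0 1) (\<lambda>\<omega>. f (y\<^sub>0 + r *\<^sub>R \<omega>))"
  by (rule continuous_on_compose2[OF assms(2)])
    (use assms(1) in \<open>auto intro!: continuous_intros simp: dist_norm\<close>)

lemma set_integrable_sphere:
  fixes f :: "'a::euclidean_space \<Rightarrow> real"
  assumes "r > 0" "continuous_on (sphere y\<^sub>0 r) f"
  shows "set_integrable sphere_measure (sphere 0 1) (\<lambda>\<omega>. f (y\<^sub>0 + r *\<^sub>R \<omega>))"
  by (rule set_integrable_continuous_finite_measure)
    (auto intro!: continuous_on_scaled_sphere[OF assms] finite_sphere_measure)

section \<open>Linearity and monotonicity of ball and sphere integrals\<close>

lemma ball_integral_add: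
  assumes "continuous_on (cball y\<^sub>0 r) f" "continuous_on (cball y\<^sub>0 r) g"
  shows "ball_integral y\<^sub>0 r (\<lambda>y. f y + g y) = ball_integral y\<^sub>0 r f + ball_integral y\<^sub>0 r g"
  unfolding ball_integral_def by (intro set_integral_add set_integrable_ball assms)

lemma ball_integral_diff:
  assumes "continuous_on (cball y\<^sub>0 r) f" "continuous_on (cball y\<^sub>0 r) g"
  shows "ball_integral y\<^sub>0 r (\<lambda>y. f y - g y) = ball_integral y\<^sub>0 r f - ball_integral y\<^sub>0 r g"
  unfolding ball_integral_def by (intro set_integral_diff set_integrable_ball assms)

lemma ball_integral_cmult: "ball_integral y\<^sub>0 r (\<lambda>y. c * f y) = c * ball_integral y\<^sub>0 r f"
  unfolding ball_integral_def by simp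

lemma ball_integral_sum:
  assumes "\<And>i. i \<in> I \<Longrightarrow> continuous_on (cball y\<^sub>0 r) (f i)" "finite I"
  shows "ball_integral y\<^sub>0 r (\<lambda>y. \<Sum>i\<in>I. f i y) = (\<Sum>i\<in>I. ball_integral y\<^sub>0 r (f i))"
  using assms(2,1)
proof (induction I rule: finite_induct)
  case (insert i I)
  then show ?case by (simp add: ball_integral_add continuous_on_sum)
qed (simp add: ball_integral_def set_lebesgue_integral_def)

lemma ball_integral_mono:
  assumes "continuous_on (cball y\<^sub>0 r) f" "continuous_on (cball y\<^sub>0 r) g"
    and "\<And>y. y \<in> ball y\<^sub>0 r \<Longrightarrow> f y \<le> g y"
  shows "ball_integral y\<^sub>0 r f \<le> ball_integral y\<^sub>0 r g"
  unfolding ball_integral_def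
  using assms(3) by (intro set_integral_mono set_integrable_ball assms(1,2)) auto

lemma ball_integral_nonneg:
  assumes "\<And>y. y \<in> ball y\<^sub>0 r \<Longrightarrow> f y \<ge> 0"
  shows "ball_integral y\<^sub>0 r f \<ge> 0"
  unfolding ball_integral_def set_lebesgue_integral_def
  by (rule Bochner_Integration.integral_nonneg) (use assms in \<open>auto simp: indicator_def\<close>)

lemma ball_integral_cong:
  "(\<And>y. y \<in> ball y\<^sub>0 r \<Longrightarrow> f y = g y) \<Longrightarrow> ball_integral y\<^sub>0 r f = ball_integral y\<^sub>0 r g"
  unfolding ball_integral_def by (intro set_lebesgue_integral_cong) auto

lemma sphere_integral_add:
  assumes "r > 0" "continuous_on (sphere y\<^sub>0 r) f" "continuous_on (sphere y\<^sub>0 r) g"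
  shows "sphere_integral y\<^sub>0 r (\<lambda>y. f y + g y) = sphere_integral y\<^sub>0 r f + sphere_integral y\<^sub>0 r g"
  unfolding sphere_integral_def
  using set_integral_add(2)[OF set_integrable_sphere[OF assms(1,2)] set_integrable_sphere[OF assms(1,3)]]
  by (simp add: algebra_simps)

lemma sphere_integral_cmult: "sphere_integral y\<^sub>0 r (\<lambda>y. c * f y) = c * sphere_integral y\<^sub>0 r f"
  unfolding sphere_integral_def by simp

lemma sphere_integral_diff:
  assumes "r > 0" "continuous_on (sphere y\<^sub>0 r) f" "continuous_on (sphere y\<^sub>0 r) g"
  shows "sphere_integral y\<^sub>0 r (\<lambda>y. f y - g y) = sphere_integral y\<^sub>0 r f - sphere_integral y\<^sub>0 r g"
  unfolding sphere_integral_def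
  using set_integral_diff(2)[OF set_integrable_sphere[OF assms(1,2)] set_integrable_sphere[OF assms(1,3)]]
  by (simp add: right_diff_distrib)

lemma sphere_integral_sum:
  assumes "r > 0" "\<And>i. i \<in> I \<Longrightarrow> continuous_on (sphere y\<^sub>0 r) (f i)" "finite I"
  shows "sphere_integral y\<^sub>0 r (\<lambda>y. \<Sum>i\<in>I. f i y) = (\<Sum>i\<in>I. sphere_integral y\<^sub>0 r (f i))"
  using assms(3,2)
proof (induction I rule: finite_induct)
  case (insert i I)
  then show ?case using assms(1) by (simp add: sphere_integral_add continuous_on_sum)
qed (simp add: sphere_integral_def set_lebesgue_integral_def)

lemma sphere_integral_nonneg:
  assumes "r > 0" "\<And>y. y \<in> sphere y\<^sub>0 r \<Longrightarrow> f y \<ge> 0"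
  shows "sphere_integral y\<^sub>0 r f \<ge> 0"
proof -
  have "(LINT \<omega>:sphere 0 1|sphere_measure. f (y\<^sub>0 + r *\<^sub>R \<omega>)) \<ge> 0"
    unfolding set_lebesgue_integral_def
    by (rule Bochner_Integration.integral_nonneg) (use assms in \<open>auto simp: indicator_def dist_norm\<close>)
  then show ?thesis unfolding sphere_integral_def using assms(1) by simp
qed

lemma sphere_integral_mono:
  assumes "r > 0" "continuous_on (sphere y\<^sub>0 r) f" "continuous_on (sphere y\<^sub>0 r) g"
    and "\<And>y. y \<in> sphere y\<^sub>0 r \<Longrightarrow> f y \<le> g y"
  shows "sphere_integral y\<^sub>0 r f \<le> sphere_integral y\<^sub>0 r g"
  using sphere_integral_nonneg[of r y\<^sub>0 "\<lambda>y. g y - f y"] sphere_integral_diff[of r y\<^sub>0 g f] assms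
  by auto

lemma sphere_integral_cong:
  assumes "r > 0" "\<And>y. y \<in> sphere y\<^sub>0 r \<Longrightarrow> f y = g y"
  shows "sphere_integral y\<^sub>0 r f = sphere_integral y\<^sub>0 r g"
proof -
  have "(LINT \<omega>:sphere 0 1|sphere_measure. f (y\<^sub>0 + r *\<^sub>R \<omega>))
      = (LINT \<omega>:sphere 0 1|sphere_measure. g (y\<^sub>0 + r *\<^sub>R \<omega>))"
    by (intro set_lebesgue_integral_cong) (use assms in \<open>auto simp: dist_norm\<close>)
  then show ?thesis by (simp add: sphere_integral_def)
qed

section \<open>Differentiating a ball integral in the radius\<close>

lemma lborel_integral_affine:
  fixes f :: "'a::euclidean_space \<Rightarrow> real"
  assumes "c \<noteq> 0" and f [measurable]: "f \<in> borel_measurable borel"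
  shows "(\<integral>x. f x \<partial>lborel) = \<bar>c\<bar> ^ DIM('a) * (\<integral>x. f (t + c *\<^sub>R x) \<partial>lborel)"
  by (subst lborel_affine[OF assms(1), of t]) (simp add: integral_density integral_distr)

text \<open>On a thin shell around the sphere of radius \<^term>\<open>r\<close>, \<^term>\<open>f\<close> is close to its
  \<open>0\<close>-homogeneous extension from that sphere, whose integral over a ball is explicit.\<close>

lemma has_real_derivative_ball_integral:
  fixes f :: "'a::euclidean_space \<Rightarrow> real"
  assumes r: "0 < r" "r < R" and f: "continuous_on (cball y\<^sub>0 R) f"
  shows "((\<lambda>s. ball_integral y\<^sub>0 s f) has_real_derivative sphere_integral y\<^sub>0 r f) (at r)"
proof -
  let ?m = "DIM('a)"
  define J where "J = (LINT \<omega>:sphere 0 1|sphere_measure. f (y\<^sub>0 + r *\<^sub>R \<omega>))"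
  define G where "G \<omega> = indicator (sphere 0 1) \<omega> *\<^sub>R f (y\<^sub>0 + r *\<^sub>R \<omega>)" for \<omega>
  have fS: "continuous_on (sphere y\<^sub>0 r) f"
    by (rule continuous_on_subset[OF f]) (use r in auto)
  have G [measurable]: "G \<in> borel_measurable borel"
    unfolding G_def
    by (intro borel_measurable_continuous_on_indicator continuous_on_scaled_sphere r fS) auto
  obtain B where B: "\<And>x. x \<in> cball y\<^sub>0 R \<Longrightarrow> \<bar>f x\<bar> \<le> B"
    using compact_imp_bounded[OF compact_continuous_image[OF f compact_cball]]
    unfolding bounded_iff real_norm_def by blast
  have GB: "\<bar>G \<omega>\<bar> \<le> \<bar>B\<bar>" for \<omega>
    using B[of "y\<^sub>0 + r *\<^sub>R \<omega>"] r by (auto simp: G_def indicator_def dist_norm)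
  define P where "P y = G (sgn (y - y\<^sub>0))" for y
  have P [measurable]: "P \<in> borel_measurable borel" unfolding P_def by measurable
  have J: "J = (\<integral>y. indicator (ball 0 1) y *\<^sub>R G (sgn y) \<partial>lborel)"
    unfolding J_def set_lebesgue_integral_def G_def[symmetric] sphere_measure_def
    by (subst integral_distr[OF measurable_sgn_restrict G]) (simp add: integral_restrict_space)
  \<comment> \<open>\<open>P\<close> is constant along rays from the centre, so rescaling the ball
    contributes nothing but the Jacobian.\<close>
  have Z: "ball_integral y\<^sub>0 s P = s ^ ?m * J" if s: "s > 0" for s
  proof -
    have "(\<integral>y. indicator (ball y\<^sub>0 s) y *\<^sub>R P y \<partial>lborel)
        = \<bar>s\<bar> ^ ?m * (\<integral>x. indicator (ball y\<^sub>0 s) (y\<^sub>0 + s *\<^sub>R x) *\<^sub>R P (y\<^sub>0 + s *\<^sub>R x) \<partial>lborel)"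
      using s by (intro lborel_integral_affine) (auto intro!: borel_measurable_times borel_measurable_indicator P)
    also have "(\<integral>x. indicator (ball y\<^sub>0 s) (y\<^sub>0 + s *\<^sub>R x) *\<^sub>R P (y\<^sub>0 + s *\<^sub>R x) \<partial>lborel) = J"
      unfolding J using s
      by (intro Bochner_Integration.integral_cong)
        (auto simp: P_def indicator_def dist_norm sgn_scaleR)
    finally show ?thesis using s by (simp add: ball_integral_def set_lebesgue_integral_def)
  qed
  have Pint: "set_integrable lborel A P" if "A \<in> sets borel" "A \<subseteq> cball y\<^sub>0 R" for A
    unfolding set_integrable_def
  proof (rule Bochner_Integration.integrable_bound)
    show "integrable lborel (\<lambda>x. indicator (cball y\<^sub>0 R) x *\<^sub>R \<bar>B\<bar>)"
      by (rule borel_integrable_compact) auto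
    show "AE x in lborel. norm (indicator A x *\<^sub>R P x) \<le> norm (indicator (cball y\<^sub>0 R) x *\<^sub>R \<bar>B\<bar>)"
      using that(2) GB by (intro AE_I2) (auto simp: P_def indicator_def simp del: mem_cball)
  qed (use that in measurable)
  have fint: "set_integrable lborel A f" if "A \<in> sets borel" "A \<subseteq> cball y\<^sub>0 R" for A
    by (rule set_integrable_subset[of lborel "cball y\<^sub>0 R" f])
      (use that borel_integrable_compact[OF compact_cball f] in \<open>simp_all add: set_integrable_def\<close>)
  define W where "W s = ball_integral y\<^sub>0 s (\<lambda>y. f y - P y)" for s
  define V where "V = unit_ball_vol (real ?m)"
  have V: "V \<ge> 0" by (simp add: V_def)
  have shell: "\<bar>W b - W a\<bar> \<le> \<eta> * (V * (b ^ ?m - a ^ ?m))"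
    if ab: "0 < a" "a \<le> b" "b \<le> R" and \<eta>: "\<eta> > 0"
      and close: "\<And>y. y \<in> ball y\<^sub>0 b - ball y\<^sub>0 a \<Longrightarrow> \<bar>f y - P y\<bar> \<le> \<eta>" for a b \<eta>
  proof -
    let ?A = "ball y\<^sub>0 b - ball y\<^sub>0 a"
    have sub: "ball y\<^sub>0 a \<subseteq> cball y\<^sub>0 R" "?A \<subseteq> cball y\<^sub>0 R" using ab by auto
    have fPint: "set_integrable lborel A (\<lambda>y. f y - P y)" if "A \<in> sets borel" "A \<subseteq> cball y\<^sub>0 R" for A
      using that by (intro set_integral_diff fint Pint)
    have un: "ball y\<^sub>0 b = ball y\<^sub>0 a \<union> ?A" using ab by auto
    have "W b = W a + (LINT y:?A|lborel. f y - P y)"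
      unfolding W_def ball_integral_def
      by (subst un, rule set_integral_Un) (use sub in \<open>auto intro!: fPint\<close>)
    then have "\<bar>W b - W a\<bar> = \<bar>LINT y:?A|lborel. f y - P y\<bar>" by simp
    also have "\<dots> \<le> (LINT y:?A|lborel. \<bar>f y - P y\<bar>)"
      using set_integral_norm_bound[OF fPint[of ?A]] sub by simp
    also have "\<dots> \<le> (LINT y:?A|lborel. \<eta>)"
    proof (rule set_integral_mono)
      show "set_integrable lborel ?A (\<lambda>y. \<bar>f y - P y\<bar>)"
        using fPint[of ?A] sub by (intro set_integrable_abs) auto
      show "set_integrable lborel ?A (\<lambda>_. \<eta>)"
        by (rule set_integrable_subset[of lborel "cball y\<^sub>0 R" "\<lambda>_. \<eta>"])
          (use sub borel_integrable_compact[of "cball y\<^sub>0 R" "\<lambda>_. \<eta>"]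
            in \<open>simp_all add: set_integrable_def\<close>)
    qed (use close in auto)
    also have "\<dots> = \<eta> * measure lborel ?A"
      by (simp add: set_lebesgue_integral_def mult.commute)
    also have "measure lborel ?A = V * (b ^ ?m - a ^ ?m)"
      using ab emeasure_lborel_ball_finite[of y\<^sub>0 b]
      by (subst measure_Diff) (auto simp: content_ball V_def algebra_simps)
    finally show ?thesis .
  qed
  \<comment> \<open>Between the radii \<open>r\<close> and \<open>s\<close> the error
    \<open>f - P\<close> is at most \<open>\<eta>\<close>, by uniform continuity, on a shell whose
    volume is of order \<open>\<bar>s - r\<bar>\<close>. Hence the error term does not contribute to
    the derivative.\<close>
  have dW: "(W has_real_derivative 0) (at r)"
    unfolding has_field_derivative_iff
  proof (rule tendstoI)
    fix e :: real assume e: "e > 0"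
    \<comment> \<open>Strictly above the derivative of \<open>s ^ ?m\<close> at \<open>r\<close>,
      hence above the difference quotients near \<open>r\<close>.\<close>
    define K where "K = real ?m * r ^ (?m - 1) + 1"
    have K: "K > 0" using r by (auto simp: K_def intro!: add_nonneg_pos)
    have "((\<lambda>s. (s ^ ?m - r ^ ?m) / (s - r)) \<longlongrightarrow> real ?m * r ^ (?m - 1)) (at r)"
      using DERIV_pow[of ?m r UNIV] by (simp add: has_field_derivative_iff)
    then have ev1: "eventually (\<lambda>s. (s ^ ?m - r ^ ?m) / (s - r) < K) (at r)"
      by (rule order_tendstoD) (simp add: K_def)
    define \<eta> where "\<eta> = e / 2 / (V * K + 1)"
    have pos: "V * K + 1 > 0" using V K by (simp add: add_nonneg_pos)
    then have \<eta>: "\<eta> > 0" using e by (simp add: \<eta>_def)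
    have "\<eta> * (V * K) < e"
    proof -
      have "\<eta> * (V * K) \<le> \<eta> * (V * K + 1)" using \<eta> by simp
      also have "\<dots> = e / 2"
        unfolding \<eta>_def by (rule nonzero_eq_divide_eq[THEN iffD1, OF _ refl]) (use pos in simp)
      finally show ?thesis using e by simp
    qed
    note \<eta>e = this
    have "uniformly_continuous_on (cball y\<^sub>0 R) f"
      using f by (rule compact_uniformly_continuous) simp
    then obtain \<delta> where "\<delta> > 0"
      "\<forall>y\<in>cball y\<^sub>0 R. \<forall>x\<in>cball y\<^sub>0 R. dist x y < \<delta> \<longrightarrow> dist (f x) (f y) < \<eta>"
      using \<eta> unfolding uniformly_continuous_on_def by blast
    then have \<delta>: "\<delta> > 0"
      "\<And>x y. x \<in> cball y\<^sub>0 R \<Longrightarrow> y \<in> cball y\<^sub>0 R \<Longrightarrow> dist x y < \<delta> \<Longrightarrow> \<bar>f x - f y\<bar> < \<eta>"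
      unfolding dist_real_def by blast+
    have cl: "\<bar>f y - P y\<bar> \<le> \<eta>" if "0 < norm (y - y\<^sub>0)" "norm (y - y\<^sub>0) \<le> R" "\<bar>norm (y - y\<^sub>0) - r\<bar> < \<delta>" for y
    proof -
      define \<rho> where "\<rho> = norm (y - y\<^sub>0)"
      define \<omega> where "\<omega> = sgn (y - y\<^sub>0)"
      have w: "norm \<omega> = 1" using that by (auto simp: \<omega>_def norm_sgn)
      have y: "y = y\<^sub>0 + \<rho> *\<^sub>R \<omega>" using that by (simp add: \<rho>_def \<omega>_def sgn_div_norm)
      have "dist y (y\<^sub>0 + r *\<^sub>R \<omega>) = \<bar>\<rho> - r\<bar>"
        by (subst y) (simp add: dist_norm scaleR_diff_left[symmetric] w)
      then have "\<bar>f y - f (y\<^sub>0 + r *\<^sub>R \<omega>)\<bar> < \<eta>"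
        using that r w by (intro \<delta>(2)) (auto simp: dist_norm \<rho>_def norm_minus_commute)
      then show ?thesis using w by (simp add: P_def G_def \<omega>_def)
    qed
    have ev2: "eventually (\<lambda>s. s \<in> {0<..<R} \<inter> ball r \<delta>) (at r)"
      by (rule eventually_at_in_open') (use r \<delta> in auto)
    have "eventually (\<lambda>s. s \<noteq> r) (at r)" by (rule eventually_neq_at_within)
    with ev1 ev2 show "eventually (\<lambda>s. dist ((W s - W r) / (s - r)) 0 < e) (at r)"
    proof eventually_elim
      case (elim s)
      then have s: "0 < s" "s < R" "\<bar>s - r\<bar> < \<delta>" "s \<noteq> r" by (auto simp: dist_real_def)
      have "\<bar>W s - W r\<bar> \<le> \<eta> * (V * \<bar>s ^ ?m - r ^ ?m\<bar>)"
      proof (cases "r \<le> s")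
        case True
        have "\<bar>W s - W r\<bar> \<le> \<eta> * (V * (s ^ ?m - r ^ ?m))"
          by (rule shell) (use True r s \<eta> in \<open>auto intro!: cl simp: dist_norm norm_minus_commute\<close>)
        also have "s ^ ?m - r ^ ?m = \<bar>s ^ ?m - r ^ ?m\<bar>" using True r power_mono[of r s ?m] by simp
        finally show ?thesis .
      next
        case False
        have "\<bar>W r - W s\<bar> \<le> \<eta> * (V * (r ^ ?m - s ^ ?m))"
          by (rule shell) (use False r s \<eta> in \<open>auto intro!: cl simp: dist_norm norm_minus_commute\<close>)
        also have "r ^ ?m - s ^ ?m = \<bar>s ^ ?m - r ^ ?m\<bar>" using False s power_mono[of s r ?m] by simp
        finally show ?thesis by (simp add: abs_minus_commute)
      qed
      then have "\<bar>W s - W r\<bar> / \<bar>s - r\<bar> \<le> \<eta> * (V * \<bar>s ^ ?m - r ^ ?m\<bar>) / \<bar>s - r\<bar>"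
        by (rule divide_right_mono) simp
      also have "\<dots> = \<eta> * (V * (\<bar>s ^ ?m - r ^ ?m\<bar> / \<bar>s - r\<bar>))" by simp
      also have "\<bar>s ^ ?m - r ^ ?m\<bar> / \<bar>s - r\<bar> = (s ^ ?m - r ^ ?m) / (s - r)"
      proof (cases "r < s")
        case True
        then show ?thesis using r power_mono[of r s ?m] by simp
      next
        case False
        then have "s ^ ?m \<le> r ^ ?m" using s power_mono[of s r ?m] by simp
        then have "\<bar>s ^ ?m - r ^ ?m\<bar> = - (s ^ ?m - r ^ ?m)" "\<bar>s - r\<bar> = - (s - r)"
          using False by linarith+
        then show ?thesis by (simp only: minus_divide_divide)
      qed
      also have "\<eta> * (V * ((s ^ ?m - r ^ ?m) / (s - r))) \<le> \<eta> * (V * K)"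
        using elim V \<eta> by (intro mult_left_mono) auto
      also have "\<dots> < e" by (rule \<eta>e)
      finally show ?case by (simp add: dist_real_def abs_divide)
    qed
  qed
  have "((\<lambda>s. W s + s ^ ?m * J) has_real_derivative 0 + (real ?m * r ^ (?m - 1)) * J) (at r)"
    using dW by (intro DERIV_add DERIV_cmult_right) (use DERIV_pow[of ?m r UNIV] in simp_all)
  moreover have eq: "W s + s ^ ?m * J = ball_integral y\<^sub>0 s f" if "s \<in> {0<..<R}" for s
  proof -
    have "W s = ball_integral y\<^sub>0 s f - ball_integral y\<^sub>0 s P"
      unfolding W_def ball_integral_def
      using that by (intro set_integral_diff fint Pint) auto
    then show ?thesis using Z[of s] that by simp
  qed
  ultimately have "((\<lambda>s. ball_integral y\<^sub>0 s f) has_real_derivative 0 + (real ?m * r ^ (?m - 1)) * J) (at r)"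
    using r by (elim has_field_derivative_transform_within_open[where S = "{0<..<R}"]) auto
  then show ?thesis by (simp add: sphere_integral_def J_def mult.assoc)
qed


text \<open>The integral of \<open>(r\<^sup>2 - |y - y\<^sub>0|\<^sup>2)\<^sub>+ p\<close> over the whole space is invariant under
  translations in direction \<^term>\<open>e\<close>; the weight makes the extension by zero Lipschitz.\<close>

lemma weighted_divergence_ball:
  fixes p :: "'a::euclidean_space \<Rightarrow> real"
  assumes r: "0 < r"
    and p: "\<And>x. x \<in> cball y\<^sub>0 r \<Longrightarrow> (p has_derivative p' x) (at x)"
    and cont: "\<And>v. continuous_on (cball y\<^sub>0 r) (\<lambda>x. p' x v)"
  shows "ball_integral y\<^sub>0 r (\<lambda>y. (r\<^sup>2 - (norm (y - y\<^sub>0))\<^sup>2) * p' y e - 2 * ((y - y\<^sub>0) \<bullet> e) * p y) = 0"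
proof -
  define w where "w y = r\<^sup>2 - (norm (y - y\<^sub>0))\<^sup>2" for y
  \<comment> \<open>The integrand extended by zero. It is globally Lipschitz because the weight
    \<open>w\<close> vanishes on the sphere; \<open>d\<close> will be its derivative in direction
    \<open>e\<close> off the sphere.\<close>
  define q where "q y = indicator (cball y\<^sub>0 r) y *\<^sub>R (w y * p y)" for y
  define d where "d y = indicator (ball y\<^sub>0 r) y *\<^sub>R (w y * p' y e - 2 * ((y - y\<^sub>0) \<bullet> e) * p y)" for y
  have pc: "continuous_on (cball y\<^sub>0 r) p"
    using p by (meson continuous_at_imp_continuous_on has_derivative_continuous)
  have wc: "continuous_on A w" for A unfolding w_def by (intro continuous_intros)
  have q [measurable]: "q \<in> borel_measurable borel"
    unfolding q_def by (intro borel_measurable_continuous_on_indicator continuous_intros wc pc) auto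
  have q_int: "integrable lborel q"
    unfolding q_def by (intro borel_integrable_compact continuous_intros wc pc) auto
  have d [measurable]: "d \<in> borel_measurable borel"
    unfolding d_def
    by (intro borel_measurable_continuous_on_indicator continuous_intros wc
        continuous_on_subset[OF pc] continuous_on_subset[OF cont]) auto
  obtain M where M: "\<And>x. x \<in> cball y\<^sub>0 r \<Longrightarrow> \<bar>p x\<bar> \<le> M"
    using compact_imp_bounded[OF compact_continuous_image[OF pc compact_cball]]
    unfolding bounded_iff real_norm_def by blast
  have "\<forall>i. \<exists>B. \<forall>x \<in> cball y\<^sub>0 r. \<bar>p' x i\<bar> \<le> B"
    using compact_imp_bounded[OF compact_continuous_image[OF cont compact_cball]]
    unfolding bounded_iff real_norm_def by blast
  then obtain B where B: "\<And>i x. x \<in> cball y\<^sub>0 r \<Longrightarrow> \<bar>p' x i\<bar> \<le> B i" by metis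
  define L where "L = (\<Sum>i\<in>Basis. B i)"
  have B0: "B i \<ge> 0" for i using B[of y\<^sub>0 i] r by auto
  then have L0: "L \<ge> 0" by (simp add: L_def sum_nonneg)
  have M0: "M \<ge> 0" using M[of y\<^sub>0] r by auto
  have onorm: "onorm (p' x) \<le> L" if x: "x \<in> cball y\<^sub>0 r" for x
  proof (rule onorm_le)
    fix v
    interpret bounded_linear "p' x" using p[OF x] by (rule has_derivative_bounded_linear)
    have "p' x v = p' x (\<Sum>i\<in>Basis. (v \<bullet> i) *\<^sub>R i)" by (simp add: euclidean_representation)
    also have "\<dots> = (\<Sum>i\<in>Basis. (v \<bullet> i) * p' x i)" by (simp add: sum scaleR)
    also have "norm \<dots> \<le> (\<Sum>i\<in>Basis. norm v * B i)"
      by (rule sum_norm_le) (use B[OF x] in \<open>auto simp: abs_mult intro!: mult_mono Basis_le_norm\<close>)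
    also have "\<dots> = L * norm v" by (simp add: L_def sum_distrib_left[symmetric])
    finally show "norm (p' x v) \<le> L * norm v" .
  qed
  have plip: "\<bar>p x - p y\<bar> \<le> L * norm (x - y)" if "x \<in> cball y\<^sub>0 r" "y \<in> cball y\<^sub>0 r" for x y
    using differentiable_bound[of "cball y\<^sub>0 r" p p' L x y] onorm that p has_derivative_at_withinI
    by (metis convex_cball real_norm_def)
  have wlip: "\<bar>w x - w y\<bar> \<le> 2 * r * norm (x - y)" if "x \<in> cball y\<^sub>0 r" "y \<in> cball y\<^sub>0 r" for x y
  proof -
    have "w x - w y = (norm (y - y\<^sub>0) - norm (x - y\<^sub>0)) * (norm (y - y\<^sub>0) + norm (x - y\<^sub>0))"
      by (simp add: w_def power2_eq_square algebra_simps)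
    also have "\<bar>\<dots>\<bar> \<le> norm (x - y) * (2 * r)"
      unfolding abs_mult
    proof (rule mult_mono)
      show "\<bar>norm (y - y\<^sub>0) - norm (x - y\<^sub>0)\<bar> \<le> norm (x - y)"
        using norm_triangle_ineq3[of "y - y\<^sub>0" "x - y\<^sub>0"] by (simp add: norm_minus_commute)
    qed (use that in \<open>auto simp: dist_norm norm_minus_commute\<close>)
    finally show ?thesis by (simp add: mult.commute)
  qed
  \<comment> \<open>The first summand pays for the variation of \<open>p\<close>, the second for
    that of the weight \<open>w\<close>.\<close>
  define K where "K = r\<^sup>2 * L + 2 * r * M"
  have K0: "K \<ge> 0" using L0 M0 r by (simp add: K_def)
  have in_in: "\<bar>q x - q y\<bar> \<le> K * norm (x - y)" if xy: "x \<in> cball y\<^sub>0 r" "y \<in> cball y\<^sub>0 r" for x y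
  proof -
    have "\<bar>w x\<bar> \<le> r\<^sup>2"
      using xy(1) power_mono[of "norm (x - y\<^sub>0)" r 2] by (auto simp: w_def dist_norm norm_minus_commute)
    then have "\<bar>w x * (p x - p y)\<bar> \<le> r\<^sup>2 * (L * norm (x - y))"
      unfolding abs_mult using plip[OF xy] by (intro mult_mono) auto
    moreover have "\<bar>(w x - w y) * p y\<bar> \<le> (2 * r * norm (x - y)) * M"
      unfolding abs_mult using wlip[OF xy] M[OF xy(2)] r by (intro mult_mono) auto
    moreover have "q x - q y = w x * (p x - p y) + (w x - w y) * p y"
      using xy by (simp add: q_def algebra_simps)
    ultimately show ?thesis by (simp add: K_def algebra_simps)
  qed
  \<comment> \<open>If \<open>y\<close> lies outside the ball, \<open>x\<close> is within
    \<open>norm (x - y)\<close> of the sphere, and the weight vanishes there to first order.\<close>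
  have in_out: "\<bar>q x\<bar> \<le> K * norm (x - y)" if xy: "x \<in> cball y\<^sub>0 r" "y \<notin> cball y\<^sub>0 r" for x y
  proof -
    have nx: "norm (x - y\<^sub>0) \<le> r" "norm (y - y\<^sub>0) > r"
      using xy by (auto simp: dist_norm norm_minus_commute)
    have tri: "norm (y - y\<^sub>0) \<le> norm (x - y\<^sub>0) + norm (x - y)"
      using norm_triangle_ineq[of "x - y\<^sub>0" "y - x"] by (simp add: norm_minus_commute)
    have "w x = (r + norm (x - y\<^sub>0)) * (r - norm (x - y\<^sub>0))"
      by (simp add: w_def power2_eq_square algebra_simps)
    also have "\<bar>\<dots>\<bar> \<le> (2 * r) * norm (x - y)"
      unfolding abs_mult using nx tri r by (intro mult_mono) auto
    finally have "\<bar>w x * p x\<bar> \<le> (2 * r * norm (x - y)) * M"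
      unfolding abs_mult using M[OF xy(1)] r by (intro mult_mono) auto
    also have "\<dots> \<le> K * norm (x - y)" using L0 by (simp add: K_def algebra_simps)
    finally show ?thesis using xy by (simp add: q_def)
  qed
  have qlip: "\<bar>q x - q y\<bar> \<le> K * norm (x - y)" for x y
  proof (cases "x \<in> cball y\<^sub>0 r")
    case True
    then show ?thesis using in_in[of x y] in_out[of x y]
      by (cases "y \<in> cball y\<^sub>0 r") (auto simp: q_def)
  next
    case False
    then have "q x = 0" by (simp add: q_def)
    then show ?thesis using in_out[of y x] False K0
      by (cases "y \<in> cball y\<^sub>0 r") (auto simp: norm_minus_commute q_def)
  qed
  define t where "t k = inverse (real (Suc k))" for k
  have t0: "t k > 0" "t k \<le> 1" for k by (auto simp: t_def inverse_le_1_iff)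
  have tlim: "t \<longlonglongrightarrow> 0" unfolding t_def by (rule LIMSEQ_inverse_real_of_nat)
  \<comment> \<open>Each difference quotient has integral \<open>0\<close> by translation
    invariance. Dominated convergence passes this on to the derivative \<open>d\<close>.\<close>
  define D where "D k y = (q (t k *\<^sub>R e + y) - q y) / t k" for k y
  have shift_int: "integrable lborel (\<lambda>y. q (c + y))" "(\<integral>y. q (c + y) \<partial>lborel) = (\<integral>y. q y \<partial>lborel)" for c
    using integrable_distr_eq[of "(+) c" lborel borel q] integral_distr[of "(+) c" lborel borel q] q_int
    by (simp_all add: lborel_distr_plus)
  have D0: "(\<integral>y. D k y \<partial>lborel) = 0" for k
    unfolding D_def using shift_int q_int by simp
  \<comment> \<open>Since \<open>t k \<le> 1\<close>, all difference quotients vanish outside the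
    ball enlarged by \<open>norm e\<close>; inside, the Lipschitz constant bounds them.\<close>
  define b where "b y = indicator (cball y\<^sub>0 (r + norm e)) y *\<^sub>R (K * norm e)" for y
  have lim: "(\<lambda>k. \<integral>y. D k y \<partial>lborel) \<longlonglongrightarrow> (\<integral>y. d y \<partial>lborel)"
  proof (rule integral_dominated_convergence)
    show "integrable lborel b" unfolding b_def by (rule borel_integrable_compact) auto
    show "D k \<in> borel_measurable lborel" for k unfolding D_def by measurable
    show "AE y in lborel. norm (D k y) \<le> b y" for k
    proof (rule AE_I2)
      fix y
      show "norm (D k y) \<le> b y"
      proof (cases "y \<in> cball y\<^sub>0 (r + norm e)")
        case True
        have "\<bar>q (t k *\<^sub>R e + y) - q y\<bar> \<le> K * (t k * norm e)"
          using qlip[of "t k *\<^sub>R e + y" y] t0[of k] by simp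
        then have "\<bar>q (t k *\<^sub>R e + y) - q y\<bar> / t k \<le> K * norm e"
          using t0[of k] by (simp add: divide_le_eq algebra_simps)
        then show ?thesis using True t0[of k] by (simp add: D_def b_def abs_divide)
      next
        case False
        then have far: "norm (y - y\<^sub>0) > r + norm e" by (auto simp: dist_norm norm_minus_commute)
        have "norm (t k *\<^sub>R e) \<le> norm e" using t0[of k] mult_right_mono[of "t k" 1 "norm e"] by simp
        moreover have "norm (y - y\<^sub>0) \<le> norm (t k *\<^sub>R e + y - y\<^sub>0) + norm (t k *\<^sub>R e)"
          using norm_triangle_ineq4[of "t k *\<^sub>R e + y - y\<^sub>0" "t k *\<^sub>R e"] by (simp add: algebra_simps)
        ultimately have "norm (t k *\<^sub>R e + y - y\<^sub>0) > r" using far by linarith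
        then have "q (t k *\<^sub>R e + y) = 0" by (auto simp: q_def dist_norm norm_minus_commute)
        moreover have "norm (y - y\<^sub>0) > r" using far norm_ge_zero[of e] by linarith
        then have "q y = 0" by (auto simp: q_def dist_norm norm_minus_commute)
        ultimately show ?thesis using False by (simp add: D_def b_def)
      qed
    qed
    \<comment> \<open>Across the sphere \<open>q\<close> may have a kink, so convergence is only
      claimed almost everywhere.\<close>
    have "sphere y\<^sub>0 r \<in> null_sets lborel"
      using negligible_sphere[of y\<^sub>0 r] by (simp add: negligible_iff_null_sets null_sets_completion_iff)
    then have "AE y in lborel. y \<notin> sphere y\<^sub>0 r" by (rule AE_not_in)
    then show "AE y in lborel. (\<lambda>k. D k y) \<longlonglongrightarrow> d y"
    proof eventually_elim
      case (elim y)
      have qd: "((\<lambda>s. q (s *\<^sub>R e + y)) has_real_derivative d y) (at 0)"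
      proof (cases "y \<in> ball y\<^sub>0 r")
        case True
        have "(p has_derivative p' y) (at (0 *\<^sub>R e + y))" using p[of y] True by simp
        then have "((\<lambda>s. p (s *\<^sub>R e + y)) has_derivative (\<lambda>s. p' y (s *\<^sub>R e))) (at 0)"
          by (rule has_derivative_compose[rotated]) (auto intro!: derivative_eq_intros)
        moreover have "p' y (s *\<^sub>R e) = p' y e * s" for s
          using p[of y] True has_derivative_bounded_linear[of p "p' y" "at y"]
          by (simp add: bounded_linear.linear linear_scale)
        ultimately have pd: "((\<lambda>s. p (s *\<^sub>R e + y)) has_real_derivative p' y e) (at 0)"
          by (simp add: has_field_derivative_def)
        have "((\<lambda>s. w (s *\<^sub>R e + y)) has_real_derivative - (2 * ((y - y\<^sub>0) \<bullet> e))) (at 0)"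
        proof -
          have "w (s *\<^sub>R e + y) = r\<^sup>2 - (norm (y - y\<^sub>0))\<^sup>2 - 2 * s * ((y - y\<^sub>0) \<bullet> e) - s\<^sup>2 * (e \<bullet> e)" for s
            unfolding w_def power2_norm_eq_inner
            by (simp add: inner_diff_left inner_diff_right inner_add_left inner_add_right inner_commute
                power2_eq_square algebra_simps)
          then show ?thesis by (auto intro!: derivative_eq_intros)
        qed
        from DERIV_mult[OF this pd]
        have "((\<lambda>s. w (s *\<^sub>R e + y) * p (s *\<^sub>R e + y)) has_real_derivative d y) (at 0)"
          using True by (simp add: d_def algebra_simps)
        moreover have "open ((\<lambda>s. s *\<^sub>R e + y) -` ball y\<^sub>0 r)"
          by (intro open_vimage continuous_intros open_ball)
        ultimately show ?thesis
          by (elim has_field_derivative_transform_within_open) (use True in \<open>auto simp: q_def\<close>)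
      next
        case False
        then have y: "y \<in> - cball y\<^sub>0 r" using elim by auto
        have "open ((\<lambda>s. s *\<^sub>R e + y) -` (- cball y\<^sub>0 r))"
          by (intro open_vimage continuous_intros) auto
        moreover have "((\<lambda>s. 0) has_real_derivative 0) (at (0::real))" by simp
        ultimately have "((\<lambda>s. q (s *\<^sub>R e + y)) has_real_derivative 0) (at 0)"
          by (elim has_field_derivative_transform_within_open) (use y in \<open>auto simp: q_def\<close>)
        then show ?thesis using False by (simp add: d_def)
      qed
      then have "((\<lambda>s. (q (s *\<^sub>R e + y) - q y) / s) \<longlongrightarrow> d y) (at 0)"
        by (simp add: has_field_derivative_iff)
      moreover have "filterlim t (at 0) sequentially"
        using tlim t0(1) by (intro filterlim_atI) (auto intro!: always_eventually simp: less_imp_neq[symmetric])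
      ultimately show ?case
        unfolding D_def by (rule filterlim_compose)
    qed
  qed auto
  then have "(\<integral>y. d y \<partial>lborel) = 0" by (simp add: D0 LIMSEQ_const_iff)
  then show ?thesis
    by (simp add: ball_integral_def set_lebesgue_integral_def d_def w_def)
qed

lemma sphere_integral_norm_cmult:
  assumes "0 < r"
  shows "sphere_integral y\<^sub>0 r (\<lambda>y. (norm (y - y\<^sub>0))\<^sup>2 * f y) = r\<^sup>2 * sphere_integral y\<^sub>0 r f"
  using sphere_integral_cong[OF assms, of y\<^sub>0 "\<lambda>y. (norm (y - y\<^sub>0))\<^sup>2 * f y" "\<lambda>y. r\<^sup>2 * f y"]
  by (simp add: sphere_integral_cmult dist_norm norm_minus_commute)

text \<open>Differentiating the weighted identity in the radius.\<close>

lemma divergence_ball: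
  fixes p :: "'a::euclidean_space \<Rightarrow> real"
  assumes r: "0 < r" "r < R"
    and p: "\<And>x. x \<in> cball y\<^sub>0 R \<Longrightarrow> (p has_derivative p' x) (at x)"
    and cont: "\<And>v. continuous_on (cball y\<^sub>0 R) (\<lambda>x. p' x v)"
  shows "r * ball_integral y\<^sub>0 r (\<lambda>x. p' x e) = sphere_integral y\<^sub>0 r (\<lambda>y. ((y - y\<^sub>0) \<bullet> e) * p y)"
proof -
  have pc: "continuous_on (cball y\<^sub>0 R) p"
    using p by (meson continuous_at_imp_continuous_on has_derivative_continuous)
  define A where "A s = ball_integral y\<^sub>0 s (\<lambda>x. p' x e)" for s
  define N where "N s = ball_integral y\<^sub>0 s (\<lambda>x. (norm (x - y\<^sub>0))\<^sup>2 * p' x e)" for s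
  define Q where "Q s = ball_integral y\<^sub>0 s (\<lambda>x. ((x - y\<^sub>0) \<bullet> e) * p x)" for s
  have cN: "continuous_on (cball y\<^sub>0 R) (\<lambda>x. (norm (x - y\<^sub>0))\<^sup>2 * p' x e)"
    by (intro continuous_intros cont)
  have cQ: "continuous_on (cball y\<^sub>0 R) (\<lambda>x. ((x - y\<^sub>0) \<bullet> e) * p x)"
    by (intro continuous_intros pc)
  have eq: "s\<^sup>2 * A s - N s = 2 * Q s" if s: "s \<in> {0<..<R}" for s
  proof -
    have sub: "cball y\<^sub>0 s \<subseteq> cball y\<^sub>0 R" using s by auto
    have "0 = ball_integral y\<^sub>0 s (\<lambda>y. (s\<^sup>2 - (norm (y - y\<^sub>0))\<^sup>2) * p' y e - 2 * ((y - y\<^sub>0) \<bullet> e) * p y)"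
      using weighted_divergence_ball[of s y\<^sub>0 p p' e] s sub p continuous_on_subset[OF cont sub] by auto
    also have "\<dots> = ball_integral y\<^sub>0 s (\<lambda>y. (s\<^sup>2 * p' y e - (norm (y - y\<^sub>0))\<^sup>2 * p' y e) - 2 * (((y - y\<^sub>0) \<bullet> e) * p y))"
      by (rule ball_integral_cong) (simp add: algebra_simps)
    also have "\<dots> = (s\<^sup>2 * A s - N s) - 2 * Q s"
      unfolding A_def N_def Q_def
      by (subst ball_integral_diff, (intro continuous_intros continuous_on_subset[OF cont sub]
          continuous_on_subset[OF pc sub])+)+ (simp add: ball_integral_cmult)
    finally show ?thesis by simp
  qed
  have dA: "(A has_real_derivative sphere_integral y\<^sub>0 r (\<lambda>x. p' x e)) (at r)"
    unfolding A_def by (rule has_real_derivative_ball_integral[OF r cont])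
  have dN: "(N has_real_derivative r\<^sup>2 * sphere_integral y\<^sub>0 r (\<lambda>x. p' x e)) (at r)"
    unfolding N_def using has_real_derivative_ball_integral[OF r cN]
      sphere_integral_norm_cmult[OF r(1), of y\<^sub>0 "\<lambda>x. p' x e"] by metis
  have dQ: "(Q has_real_derivative sphere_integral y\<^sub>0 r (\<lambda>x. ((x - y\<^sub>0) \<bullet> e) * p x)) (at r)"
    unfolding Q_def by (rule has_real_derivative_ball_integral[OF r cQ])
  \<comment> \<open>On the sphere of radius \<open>r\<close> the factor
    \<open>norm (y - y\<^sub>0)\<close> equals \<open>r\<close>, so the sphere integrals coming from
    \<open>A\<close> and \<open>N\<close> cancel. Only the derivative of the factor
    \<open>s\<^sup>2\<close> survives, which is the volume side of the divergence theorem.\<close>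
  have "((\<lambda>s. s\<^sup>2 * A s - N s) has_real_derivative 2 * r * A r) (at r)"
    by (rule derivative_eq_intros dA dN refl | simp)+
  then have "((\<lambda>s. 2 * Q s) has_real_derivative 2 * r * A r) (at r)"
    by (rule has_field_derivative_transform_within_open[where S = "{0<..<R}"]) (use r eq in auto)
  moreover have "((\<lambda>s. 2 * Q s) has_real_derivative
      2 * sphere_integral y\<^sub>0 r (\<lambda>x. ((x - y\<^sub>0) \<bullet> e) * p x)) (at r)"
    by (intro DERIV_cmult dQ)
  ultimately show ?thesis using DERIV_unique A_def by fastforce
qed

section \<open>Green, Rellich and Poincare identities on balls\<close>

lemma second_difference_mean_value:
  fixes f :: "'a::real_normed_vector \<Rightarrow> real"
  assumes h: "h > 0"
    and f: "\<And>s t. 0 \<le> s \<Longrightarrow> s \<le> h \<Longrightarrow> 0 \<le> t \<Longrightarrow> t \<le> h \<Longrightarrow>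
      (f has_derivative f' (x + s *\<^sub>R a + t *\<^sub>R b)) (at (x + s *\<^sub>R a + t *\<^sub>R b))"
    and fa: "\<And>s t. 0 \<le> s \<Longrightarrow> s \<le> h \<Longrightarrow> 0 \<le> t \<Longrightarrow> t \<le> h \<Longrightarrow>
      ((\<lambda>y. f' y a) has_derivative f'' (x + s *\<^sub>R a + t *\<^sub>R b)) (at (x + s *\<^sub>R a + t *\<^sub>R b))"
  shows "\<exists>s t. 0 < s \<and> s < h \<and> 0 < t \<and> t < h \<and>
    f (x + h *\<^sub>R a + h *\<^sub>R b) - f (x + h *\<^sub>R a) - f (x + h *\<^sub>R b) + f x
      = h * h * f'' (x + s *\<^sub>R a + t *\<^sub>R b) b"
proof -
  have line: "((\<lambda>s. u (z + s *\<^sub>R v)) has_real_derivative U v) (at s)"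
    if "(u has_derivative U) (at (z + s *\<^sub>R v))" for u :: "'a \<Rightarrow> real" and U z v s
  proof -
    have "((\<lambda>s. u (z + s *\<^sub>R v)) has_derivative (\<lambda>k. U (k *\<^sub>R v))) (at s)"
      by (rule has_derivative_compose[where g = u and f = "\<lambda>s. z + s *\<^sub>R v", OF _ that]) (auto intro!: derivative_eq_intros)
    moreover have "U (k *\<^sub>R v) = U v * k" for k
      using has_derivative_bounded_linear[OF that] by (simp add: bounded_linear.linear linear_scale)
    ultimately show ?thesis by (simp add: has_field_derivative_def)
  qed
  \<comment> \<open>The second difference is a first difference of \<open>\<phi>\<close>. The mean
    value theorem is used along \<open>a\<close> for \<open>\<phi>\<close> and then along
    \<open>b\<close> for the derivative in direction \<open>a\<close>.\<close>
  define \<phi> where "\<phi> s = f ((x + h *\<^sub>R b) + s *\<^sub>R a) - f (x + s *\<^sub>R a)" for s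
  have "\<exists>s>0. s < h \<and> \<phi> h - \<phi> 0 = (h - 0) * (f' ((x + h *\<^sub>R b) + s *\<^sub>R a) a - f' (x + s *\<^sub>R a) a)"
  proof (rule MVT2[OF h])
    fix s assume s: "0 \<le> s" "s \<le> h"
    show "(\<phi> has_real_derivative f' ((x + h *\<^sub>R b) + s *\<^sub>R a) a - f' (x + s *\<^sub>R a) a) (at s)"
      unfolding \<phi>_def
      using f[of s h] f[of s 0] s h by (intro DERIV_diff line) (simp_all add: algebra_simps)
  qed
  then obtain s where s: "0 < s" "s < h"
    "\<phi> h - \<phi> 0 = h * (f' ((x + h *\<^sub>R b) + s *\<^sub>R a) a - f' (x + s *\<^sub>R a) a)" by auto
  have "\<exists>t>0. t < h \<and> f' (x + s *\<^sub>R a + h *\<^sub>R b) a - f' (x + s *\<^sub>R a + 0 *\<^sub>R b) a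
      = (h - 0) * f'' (x + s *\<^sub>R a + t *\<^sub>R b) b"
  proof (rule MVT2[OF h])
    fix t assume "0 \<le> t" "t \<le> h"
    then show "((\<lambda>t. f' (x + s *\<^sub>R a + t *\<^sub>R b) a) has_real_derivative
        f'' (x + s *\<^sub>R a + t *\<^sub>R b) b) (at t)"
      using s by (intro line[of "\<lambda>y. f' y a"] fa) auto
  qed
  then obtain t where t: "0 < t" "t < h"
    "f' (x + s *\<^sub>R a + h *\<^sub>R b) a - f' (x + s *\<^sub>R a) a = h * f'' (x + s *\<^sub>R a + t *\<^sub>R b) b" by auto
  have "f (x + h *\<^sub>R a + h *\<^sub>R b) - f (x + h *\<^sub>R a) - f (x + h *\<^sub>R b) + f x = \<phi> h - \<phi> 0"
    by (simp add: \<phi>_def add_ac)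
  also have "\<dots> = h * (f' (x + s *\<^sub>R a + h *\<^sub>R b) a - f' (x + s *\<^sub>R a) a)"
    unfolding s(3) by (simp add: add_ac)
  also have "\<dots> = h * h * f'' (x + s *\<^sub>R a + t *\<^sub>R b) b"
    unfolding t(3) by simp
  finally show ?thesis using s(1,2) t(1,2) by blast
qed

text \<open>The second difference is symmetric in \<open>a\<close> and \<open>b\<close>, so the
  intermediate values of the two mixed derivatives produced by
  \<open>second_difference_mean_value\<close> agree; continuity at \<open>x\<close> does the
  rest.\<close>

lemma second_derivative_commute:
  fixes f :: "'a::real_normed_vector \<Rightarrow> real"
  assumes S: "open S" "x \<in> S"
    and f: "\<And>y. y \<in> S \<Longrightarrow> (f has_derivative f' y) (at y)"
    and fa: "\<And>y. y \<in> S \<Longrightarrow> ((\<lambda>y. f' y a) has_derivative fa y) (at y)"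
    and fb: "\<And>y. y \<in> S \<Longrightarrow> ((\<lambda>y. f' y b) has_derivative fb y) (at y)"
    and cont: "continuous_on S (\<lambda>y. fa y b)" "continuous_on S (\<lambda>y. fb y a)"
  shows "fa x b = fb x a"
proof -
  have "\<bar>fa x b - fb x a\<bar> \<le> 0 + e" if e: "e > 0" for e
  proof -
    have "isCont (\<lambda>y. fa y b) x" "isCont (\<lambda>y. fb y a) x"
      using cont S by (auto simp: continuous_on_eq_continuous_at)
    then have "\<exists>d>0. \<forall>y. dist y x < d \<longrightarrow> dist (fa y b) (fa x b) < e / 2"
      "\<exists>d>0. \<forall>y. dist y x < d \<longrightarrow> dist (fb y a) (fb x a) < e / 2"
      using half_gt_zero[OF e] unfolding continuous_at_eps_delta dist_norm by blast+
    then obtain d1 d2 where d: "d1 > 0" "d2 > 0"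
      "\<And>y. dist y x < d1 \<Longrightarrow> dist (fa y b) (fa x b) < e / 2"
      "\<And>y. dist y x < d2 \<Longrightarrow> dist (fb y a) (fb x a) < e / 2"
      by blast
    obtain d3 where d3: "d3 > 0" "ball x d3 \<subseteq> S" using S openE by blast
    define \<delta> where "\<delta> = min d1 (min d2 d3)"
    \<comment> \<open>Keeps the parallelogram spanned by \<open>h *\<^sub>R a\<close> and
      \<open>h *\<^sub>R b\<close> within \<open>\<delta> / 2\<close> of \<open>x\<close>; the
      \<open>1\<close> guards against \<open>a = b = 0\<close>.\<close>
    define h where "h = \<delta> / (2 * (norm a + norm b + 1))"
    have pos: "norm a + norm b + 1 > 0" by (simp add: add_nonneg_pos)
    have \<delta>: "\<delta> > 0" using d d3 by (simp add: \<delta>_def)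
    have h: "h > 0" using \<delta> pos by (simp add: h_def)
    have near: "dist (x + s *\<^sub>R a + t *\<^sub>R b) x < \<delta>" if "0 \<le> s" "s \<le> h" "0 \<le> t" "t \<le> h" for s t
    proof -
      have "dist (x + s *\<^sub>R a + t *\<^sub>R b) x \<le> s * norm a + t * norm b"
        using norm_triangle_ineq[of "s *\<^sub>R a" "t *\<^sub>R b"] that by (simp add: dist_norm add.assoc)
      also have "\<dots> \<le> h * norm a + h * norm b" using that by (intro add_mono mult_right_mono) auto
      also have "\<dots> \<le> h * (norm a + norm b + 1)" using h by (simp add: distrib_left)
      also have "\<dots> = \<delta> / 2"
        using pos by (simp add: h_def nonzero_divide_eq_eq field_split_simps)
      also have "\<dots> < \<delta>" using \<delta> by simp
      finally show ?thesis .
    qed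
    have inS: "x + s *\<^sub>R a + t *\<^sub>R b \<in> S" "x + s *\<^sub>R b + t *\<^sub>R a \<in> S"
      if "0 \<le> s" "s \<le> h" "0 \<le> t" "t \<le> h" for s t
      using near[of s t] near[of t s] that d3(2)
      by (auto simp: \<delta>_def dist_commute add_ac subset_iff)
    have "\<exists>s t. 0 < s \<and> s < h \<and> 0 < t \<and> t < h \<and>
      f (x + h *\<^sub>R a + h *\<^sub>R b) - f (x + h *\<^sub>R a) - f (x + h *\<^sub>R b) + f x
        = h * h * fa (x + s *\<^sub>R a + t *\<^sub>R b) b"
      by (rule second_difference_mean_value[OF h f fa]) (rule inS, assumption+)+
    then obtain s t where st: "0 < s" "s < h" "0 < t" "t < h"
      "f (x + h *\<^sub>R a + h *\<^sub>R b) - f (x + h *\<^sub>R a) - f (x + h *\<^sub>R b) + f x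
        = h * h * fa (x + s *\<^sub>R a + t *\<^sub>R b) b"
      by blast
    have "\<exists>s t. 0 < s \<and> s < h \<and> 0 < t \<and> t < h \<and>
      f (x + h *\<^sub>R b + h *\<^sub>R a) - f (x + h *\<^sub>R b) - f (x + h *\<^sub>R a) + f x
        = h * h * fb (x + s *\<^sub>R b + t *\<^sub>R a) a"
      by (rule second_difference_mean_value[OF h f fb]) (rule inS, assumption+)+
    then obtain s' t' where st': "0 < s'" "s' < h" "0 < t'" "t' < h"
      "f (x + h *\<^sub>R b + h *\<^sub>R a) - f (x + h *\<^sub>R b) - f (x + h *\<^sub>R a) + f x
        = h * h * fb (x + s' *\<^sub>R b + t' *\<^sub>R a) a"
      by blast
    have "h * h * fa (x + s *\<^sub>R a + t *\<^sub>R b) b = h * h * fb (x + s' *\<^sub>R b + t' *\<^sub>R a) a"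
    proof -
      have "x + h *\<^sub>R b + h *\<^sub>R a = x + h *\<^sub>R a + h *\<^sub>R b" by (simp add: add_ac)
      from st'(5)[unfolded this] st(5) show ?thesis by linarith
    qed
    then have "fa (x + s *\<^sub>R a + t *\<^sub>R b) b = fb (x + s' *\<^sub>R b + t' *\<^sub>R a) a" using h by simp
    moreover have "\<bar>fa (x + s *\<^sub>R a + t *\<^sub>R b) b - fa x b\<bar> < e / 2"
      using d(3)[of "x + s *\<^sub>R a + t *\<^sub>R b"] near[of s t] st by (simp add: dist_real_def \<delta>_def)
    moreover have "\<bar>fb (x + s' *\<^sub>R b + t' *\<^sub>R a) a - fb x a\<bar> < e / 2"
      using d(4)[of "x + s' *\<^sub>R b + t' *\<^sub>R a"] near[of t' s'] st'
      by (simp add: dist_real_def \<delta>_def add_ac)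
    ultimately show ?thesis by linarith
  qed
  then have "\<bar>fa x b - fb x a\<bar> \<le> 0" by (rule field_le_epsilon)
  then show ?thesis by simp
qed

section \<open>Integral identities for a C^2 function on a ball\<close>

lemma sum_inner_Basis:
  fixes z :: "'a::euclidean_space \<Rightarrow> real"
  shows "j \<in> Basis \<Longrightarrow> (\<Sum>k\<in>Basis. (j \<bullet> k) * z k) = z j"
  by (simp add: inner_Basis if_distrib[of "\<lambda>x. x * _"] cong: if_cong)

text \<open>The identities are proved for radii \<open>r < R\<close>; the margin allows
  differentiation of ball integrals at \<open>r\<close>. Differentials are given in coordinates, so
  \<open>sum_inner_Basis\<close> evaluates them at basis vectors.\<close>

locale C2_cball =
  fixes q :: "'a::euclidean_space \<Rightarrow> real" and G :: "'a \<Rightarrow> 'a \<Rightarrow> real"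
    and G2 :: "'a \<Rightarrow> 'a \<Rightarrow> 'a \<Rightarrow> real" and y\<^sub>0 :: 'a and R :: real
  assumes dq: "y \<in> cball y\<^sub>0 R \<Longrightarrow> (q has_derivative (\<lambda>v. \<Sum>i\<in>Basis. (v \<bullet> i) * G i y)) (at y)"
    and dG: "i \<in> Basis \<Longrightarrow> y \<in> cball y\<^sub>0 R \<Longrightarrow>
      (G i has_derivative (\<lambda>v. \<Sum>k\<in>Basis. (v \<bullet> k) * G2 i k y)) (at y)"
    and cG2: "i \<in> Basis \<Longrightarrow> k \<in> Basis \<Longrightarrow> continuous_on (cball y\<^sub>0 R) (G2 i k)"
    and sym: "i \<in> Basis \<Longrightarrow> k \<in> Basis \<Longrightarrow> y \<in> cball y\<^sub>0 R \<Longrightarrow> G2 i k y = G2 k i y"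
begin

text \<open>Not normalised: on the sphere of radius \<open>r\<close> this is \<open>r\<close> times
  the outer normal derivative, whence the powers of \<open>r\<close> in the identities
  below.\<close>

definition "radial y = (\<Sum>i\<in>Basis. ((y - y\<^sub>0) \<bullet> i) * G i y)"
definition "energy y = (\<Sum>i\<in>Basis. (G i y)\<^sup>2)"
definition "lapl y = (\<Sum>i\<in>Basis. G2 i i y)"

lemma cq: "continuous_on (cball y\<^sub>0 R) q"
  using dq by (meson continuous_at_imp_continuous_on has_derivative_continuous)

lemma cG: "i \<in> Basis \<Longrightarrow> continuous_on (cball y\<^sub>0 R) (G i)"
  using dG by (meson continuous_at_imp_continuous_on has_derivative_continuous)

lemma continuous_radial: "continuous_on (cball y\<^sub>0 R) radial"
  unfolding radial_def by (intro continuous_intros cG)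

lemma continuous_energy: "continuous_on (cball y\<^sub>0 R) energy"
  unfolding energy_def by (intro continuous_intros cG)

lemma energy_nonneg: "energy y \<ge> 0"
  by (simp add: energy_def sum_nonneg)

lemma radial_square_le:
  assumes "y \<in> cball y\<^sub>0 r"
  shows "(radial y)\<^sup>2 \<le> r\<^sup>2 * energy y"
proof -
  have "(radial y)\<^sup>2 \<le> (\<Sum>i\<in>Basis. ((y - y\<^sub>0) \<bullet> i)\<^sup>2) * energy y"
    unfolding radial_def energy_def by (rule Cauchy_Schwarz_ineq_sum)
  also have "(\<Sum>i\<in>Basis. ((y - y\<^sub>0) \<bullet> i)\<^sup>2) = (norm (y - y\<^sub>0))\<^sup>2"
    unfolding power2_norm_eq_inner by (subst (2) euclidean_inner) (simp add: power2_eq_square)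
  also have "(norm (y - y\<^sub>0))\<^sup>2 * energy y \<le> r\<^sup>2 * energy y"
    using assms by (intro mult_right_mono power_mono energy_nonneg) (auto simp: dist_norm norm_minus_commute)
  finally show ?thesis .
qed

lemma sub_cball: "r < R \<Longrightarrow> cball y\<^sub>0 r \<subseteq> cball y\<^sub>0 R" "r < R \<Longrightarrow> sphere y\<^sub>0 r \<subseteq> cball y\<^sub>0 R"
  by auto

text \<open>Divergence theorem for the field q grad q, one component for each basis vector.\<close>

lemma green:
  assumes r: "0 < r" "r < R"
  shows "r * ball_integral y\<^sub>0 r (\<lambda>y. energy y + q y * lapl y) = sphere_integral y\<^sub>0 r (\<lambda>y. q y * radial y)"
proof -
  define p' where "p' j y v = q y * (\<Sum>k\<in>Basis. (v \<bullet> k) * G2 j k y)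
     + (\<Sum>i\<in>Basis. (v \<bullet> i) * G i y) * G j y" for j y v
  have c: "continuous_on (cball y\<^sub>0 R) (\<lambda>y. p' j y v)" if "j \<in> Basis" for j v
    unfolding p'_def by (intro continuous_intros cq cG cG2 that)
  have D: "r * ball_integral y\<^sub>0 r (\<lambda>y. p' j y j) = sphere_integral y\<^sub>0 r (\<lambda>y. ((y - y\<^sub>0) \<bullet> j) * (q y * G j y))"
    if j: "j \<in> Basis" for j
  proof (rule divergence_ball[OF r, where p' = "p' j"])
    show "((\<lambda>y. q y * G j y) has_derivative p' j x) (at x)" if "x \<in> cball y\<^sub>0 R" for x
      unfolding p'_def by (rule has_derivative_mult[OF dq[OF that] dG[OF j that]])
  qed (rule c[OF j])
  have "r * ball_integral y\<^sub>0 r (\<lambda>y. energy y + q y * lapl y)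
      = r * ball_integral y\<^sub>0 r (\<lambda>y. \<Sum>j\<in>Basis. p' j y j)"
    by (simp add: p'_def energy_def lapl_def sum_inner_Basis sum.distrib
        sum_distrib_left power2_eq_square add.commute)
  also have "\<dots> = (\<Sum>j\<in>Basis. r * ball_integral y\<^sub>0 r (\<lambda>y. p' j y j))"
    by (subst ball_integral_sum) (auto intro!: continuous_on_subset[OF c sub_cball(1)] r simp: sum_distrib_left)
  also have "\<dots> = (\<Sum>j\<in>Basis. sphere_integral y\<^sub>0 r (\<lambda>y. ((y - y\<^sub>0) \<bullet> j) * (q y * G j y)))"
    by (rule sum.cong) (simp_all add: D)
  also have "\<dots> = sphere_integral y\<^sub>0 r (\<lambda>y. \<Sum>j\<in>Basis. ((y - y\<^sub>0) \<bullet> j) * (q y * G j y))"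
    by (rule sphere_integral_sum[symmetric])
      (auto intro!: r continuous_intros continuous_on_subset[OF cq sub_cball(2)] continuous_on_subset[OF cG sub_cball(2)])
  finally show ?thesis
    by (simp add: radial_def sum_distrib_left mult.left_commute)
qed

text \<open>Divergence theorem for the field q^2 (y - y0). It trades a sphere integral for a ball
  integral, which can be differentiated in the radius and estimated pointwise.\<close>

lemma position_identity:
  assumes r: "0 < r" "r < R"
  shows "r * sphere_integral y\<^sub>0 r (\<lambda>y. (q y)\<^sup>2)
    = ball_integral y\<^sub>0 r (\<lambda>y. DIM('a) * (q y)\<^sup>2 + 2 * (q y * radial y))"
proof -
  define p' where "p' j y v = (q y)\<^sup>2 * (v \<bullet> j)
     + (2 * q y * (\<Sum>i\<in>Basis. (v \<bullet> i) * G i y)) * ((y - y\<^sub>0) \<bullet> j)" for j y v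
  have c: "continuous_on (cball y\<^sub>0 R) (\<lambda>y. p' j y v)" if "j \<in> Basis" for j v
    unfolding p'_def by (intro continuous_intros cq cG cG2 that)
  have D: "r * ball_integral y\<^sub>0 r (\<lambda>y. p' j y j)
      = sphere_integral y\<^sub>0 r (\<lambda>y. ((y - y\<^sub>0) \<bullet> j) * ((q y)\<^sup>2 * ((y - y\<^sub>0) \<bullet> j)))"
    if j: "j \<in> Basis" for j
  proof (rule divergence_ball[OF r, where p' = "p' j"])
    show "((\<lambda>y. (q y)\<^sup>2 * ((y - y\<^sub>0) \<bullet> j)) has_derivative p' j x) (at x)" if "x \<in> cball y\<^sub>0 R" for x
      unfolding p'_def by (rule derivative_eq_intros dq[OF that] refl | simp add: mult_ac)+
  qed (rule c[OF j])
  have "(\<Sum>j\<in>Basis. p' j y j) = DIM('a) * (q y)\<^sup>2 + 2 * (q y * radial y)" for y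
  proof -
    have "(\<Sum>j\<in>Basis. p' j y j) = (\<Sum>j\<in>Basis. (q y)\<^sup>2 + 2 * q y * G j y * ((y - y\<^sub>0) \<bullet> j))"
      by (rule sum.cong) (simp_all add: p'_def sum_inner_Basis)
    then show ?thesis by (simp add: radial_def sum.distrib sum_distrib_left mult_ac)
  qed
  then have "r * ball_integral y\<^sub>0 r (\<lambda>y. DIM('a) * (q y)\<^sup>2 + 2 * (q y * radial y))
      = r * ball_integral y\<^sub>0 r (\<lambda>y. \<Sum>j\<in>Basis. p' j y j)"
    by simp
  also have "\<dots> = (\<Sum>j\<in>Basis. r * ball_integral y\<^sub>0 r (\<lambda>y. p' j y j))"
    by (subst ball_integral_sum) (auto intro!: continuous_on_subset[OF c sub_cball(1)] r simp: sum_distrib_left)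
  also have "\<dots> = (\<Sum>j\<in>Basis. sphere_integral y\<^sub>0 r (\<lambda>y. ((y - y\<^sub>0) \<bullet> j) * ((q y)\<^sup>2 * ((y - y\<^sub>0) \<bullet> j))))"
    by (rule sum.cong) (simp_all add: D)
  also have "\<dots> = sphere_integral y\<^sub>0 r (\<lambda>y. \<Sum>j\<in>Basis. ((y - y\<^sub>0) \<bullet> j) * ((q y)\<^sup>2 * ((y - y\<^sub>0) \<bullet> j)))"
    by (rule sphere_integral_sum[symmetric])
      (auto intro!: r continuous_intros continuous_on_subset[OF cq sub_cball(2)])
  also have "(\<lambda>y. \<Sum>j\<in>Basis. ((y - y\<^sub>0) \<bullet> j) * ((q y)\<^sup>2 * ((y - y\<^sub>0) \<bullet> j))) = (\<lambda>y. (norm (y - y\<^sub>0))\<^sup>2 * (q y)\<^sup>2)"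
    unfolding power2_norm_eq_inner
    by (rule ext, subst (3) euclidean_inner) (simp add: sum_distrib_left sum_distrib_right mult_ac)
  finally have "r * ball_integral y\<^sub>0 r (\<lambda>y. DIM('a) * (q y)\<^sup>2 + 2 * (q y * radial y))
      = r\<^sup>2 * sphere_integral y\<^sub>0 r (\<lambda>y. (q y)\<^sup>2)"
    using sphere_integral_norm_cmult[OF r(1), of y\<^sub>0 "\<lambda>y. (q y)\<^sup>2"] by simp
  then show ?thesis using r by (simp add: power2_eq_square)
qed

text \<open>Divergence theorem for the Rellich-Pohozaev field 2 \<open>radial\<close> grad q -
  \<open>energy\<close> (y - y0), whose divergence contains second derivatives only through the
  Laplacian.\<close>

lemma rellich:
  assumes r: "0 < r" "r < R"
  shows "r * ball_integral y\<^sub>0 r (\<lambda>y. 2 * (radial y * lapl y) + (2 - real DIM('a)) * energy y)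
    = 2 * sphere_integral y\<^sub>0 r (\<lambda>y. (radial y)\<^sup>2) - r\<^sup>2 * sphere_integral y\<^sub>0 r energy"
proof -
  define dr where "dr y v = (\<Sum>i\<in>Basis. ((y - y\<^sub>0) \<bullet> i) * (\<Sum>k\<in>Basis. (v \<bullet> k) * G2 i k y) + (v \<bullet> i) * G i y)" for y v
  define de where "de y v = (\<Sum>i\<in>Basis. 2 * G i y * (\<Sum>k\<in>Basis. (v \<bullet> k) * G2 i k y))" for y v
  define p' where "p' j y v = (2 * radial y) * (\<Sum>k\<in>Basis. (v \<bullet> k) * G2 j k y) + (2 * dr y v) * G j y
     - (energy y * (v \<bullet> j) + de y v * ((y - y\<^sub>0) \<bullet> j))" for j y v
  have drad: "(radial has_derivative dr y) (at y)" if "y \<in> cball y\<^sub>0 R" for y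
    unfolding radial_def dr_def by (rule derivative_eq_intros dG that refl | assumption | simp add: mult_ac)+
  have den: "(energy has_derivative de y) (at y)" if "y \<in> cball y\<^sub>0 R" for y
    unfolding energy_def de_def by (rule derivative_eq_intros dG that refl | assumption | simp add: mult_ac)+
  have c: "continuous_on (cball y\<^sub>0 R) (\<lambda>y. p' j y v)" if "j \<in> Basis" for j v
    unfolding p'_def dr_def de_def by (intro continuous_intros continuous_radial continuous_energy cG cG2 that)
  have D: "r * ball_integral y\<^sub>0 r (\<lambda>y. p' j y j)
      = sphere_integral y\<^sub>0 r (\<lambda>y. ((y - y\<^sub>0) \<bullet> j) * (2 * radial y * G j y - energy y * ((y - y\<^sub>0) \<bullet> j)))"
    if j: "j \<in> Basis" for j
  proof (rule divergence_ball[OF r, where p' = "p' j"])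
    show "((\<lambda>y. 2 * radial y * G j y - energy y * ((y - y\<^sub>0) \<bullet> j)) has_derivative p' j x) (at x)"
      if "x \<in> cball y\<^sub>0 R" for x
      unfolding p'_def by (rule derivative_eq_intros drad den dG j that refl | simp add: mult_ac)+
  qed (rule c[OF j])
  have div: "(\<Sum>j\<in>Basis. p' j y j) = 2 * (radial y * lapl y) + (2 - real DIM('a)) * energy y"
    if y: "y \<in> cball y\<^sub>0 R" for y
  proof -
    \<comment> \<open>The Hessian term. It arises from differentiating \<open>radial\<close> and
      again, with opposite sign, from differentiating \<open>energy\<close>; by \<open>sym\<close>
      the two contributions cancel.\<close>
    define T where "T = (\<Sum>i\<in>Basis. \<Sum>j\<in>Basis. ((y - y\<^sub>0) \<bullet> i) * G2 i j y * G j y)"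
    have dr: "(\<Sum>j\<in>Basis. dr y j * G j y) = T + energy y"
    proof -
      have "(\<Sum>j\<in>Basis. dr y j * G j y) = (\<Sum>j\<in>Basis. (\<Sum>i\<in>Basis. ((y - y\<^sub>0) \<bullet> i) * G2 i j y * G j y) + (G j y)\<^sup>2)"
        by (rule sum.cong) (simp_all add: dr_def sum_inner_Basis sum.distrib distrib_right sum_distrib_right power2_eq_square)
      also have "\<dots> = T + energy y"
        unfolding T_def energy_def sum.distrib by (subst sum.swap) simp
      finally show ?thesis .
    qed
    have de: "(\<Sum>j\<in>Basis. de y j * ((y - y\<^sub>0) \<bullet> j)) = 2 * T"
    proof -
      have "(\<Sum>j\<in>Basis. de y j * ((y - y\<^sub>0) \<bullet> j))
          = (\<Sum>j\<in>Basis. \<Sum>i\<in>Basis. 2 * (((y - y\<^sub>0) \<bullet> j) * G2 j i y * G i y))"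
        using sym[OF _ _ y]
        by (intro sum.cong refl) (simp_all add: de_def sum_inner_Basis sum_distrib_right sum_distrib_left mult_ac cong: sum.cong)
      then show ?thesis by (simp add: T_def sum_distrib_left)
    qed
    have "(\<Sum>j\<in>Basis. p' j y j)
        = 2 * radial y * lapl y + 2 * (\<Sum>j\<in>Basis. dr y j * G j y)
          - (energy y * DIM('a) + (\<Sum>j\<in>Basis. de y j * ((y - y\<^sub>0) \<bullet> j)))"
      by (simp add: p'_def sum_inner_Basis lapl_def sum.distrib sum_subtractf sum_distrib_left mult_ac)
    then show ?thesis unfolding dr de by (simp add: algebra_simps)
  qed
  have "r * ball_integral y\<^sub>0 r (\<lambda>y. 2 * (radial y * lapl y) + (2 - real DIM('a)) * energy y)
      = r * ball_integral y\<^sub>0 r (\<lambda>y. \<Sum>j\<in>Basis. p' j y j)"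
    by (intro arg_cong[where f = "(*) r"] ball_integral_cong div[symmetric]) (use r in auto)
  also have "\<dots> = (\<Sum>j\<in>Basis. r * ball_integral y\<^sub>0 r (\<lambda>y. p' j y j))"
    by (subst ball_integral_sum) (auto intro!: continuous_on_subset[OF c sub_cball(1)] r simp: sum_distrib_left)
  also have "\<dots> = (\<Sum>j\<in>Basis. sphere_integral y\<^sub>0 r
      (\<lambda>y. ((y - y\<^sub>0) \<bullet> j) * (2 * radial y * G j y - energy y * ((y - y\<^sub>0) \<bullet> j))))"
    by (rule sum.cong) (simp_all add: D)
  also have "\<dots> = sphere_integral y\<^sub>0 r
      (\<lambda>y. \<Sum>j\<in>Basis. ((y - y\<^sub>0) \<bullet> j) * (2 * radial y * G j y - energy y * ((y - y\<^sub>0) \<bullet> j)))"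
    by (rule sphere_integral_sum[symmetric])
      (auto intro!: r continuous_intros continuous_on_subset[OF continuous_radial sub_cball(2)]
        continuous_on_subset[OF continuous_energy sub_cball(2)] continuous_on_subset[OF cG sub_cball(2)])
  also have "(\<lambda>y. \<Sum>j\<in>Basis. ((y - y\<^sub>0) \<bullet> j) * (2 * radial y * G j y - energy y * ((y - y\<^sub>0) \<bullet> j)))
      = (\<lambda>y. 2 * (radial y)\<^sup>2 - (norm (y - y\<^sub>0))\<^sup>2 * energy y)"
  proof
    fix y
    have "(\<Sum>j\<in>Basis. ((y - y\<^sub>0) \<bullet> j) * (2 * radial y * G j y - energy y * ((y - y\<^sub>0) \<bullet> j)))
       = 2 * radial y * radial y - energy y * ((y - y\<^sub>0) \<bullet> (y - y\<^sub>0))"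
      unfolding radial_def[of y] euclidean_inner[of "y - y\<^sub>0" "y - y\<^sub>0"]
      by (simp add: sum_subtractf right_diff_distrib sum_distrib_left mult_ac)
    then show "(\<Sum>j\<in>Basis. ((y - y\<^sub>0) \<bullet> j) * (2 * radial y * G j y - energy y * ((y - y\<^sub>0) \<bullet> j)))
       = 2 * (radial y)\<^sup>2 - (norm (y - y\<^sub>0))\<^sup>2 * energy y"
      by (simp add: power2_norm_eq_inner power2_eq_square[of "radial y"] mult.commute)
  qed
  also have "sphere_integral y\<^sub>0 r (\<lambda>y. 2 * (radial y)\<^sup>2 - (norm (y - y\<^sub>0))\<^sup>2 * energy y)
      = 2 * sphere_integral y\<^sub>0 r (\<lambda>y. (radial y)\<^sup>2) - r\<^sup>2 * sphere_integral y\<^sub>0 r energy"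
    by (subst sphere_integral_diff)
      (auto intro!: r continuous_intros continuous_on_subset[OF continuous_radial sub_cball(2)]
        continuous_on_subset[OF continuous_energy sub_cball(2)]
        simp: sphere_integral_cmult sphere_integral_norm_cmult[OF r(1), of y\<^sub>0 energy])
  finally show ?thesis .
qed

text \<open>In \<open>position_identity\<close> the mixed term is bounded below by the square of
  \<open>q + radial\<close>; this costs one of the \<open>DIM('a)\<close> copies of q^2 and the
  square of \<open>radial\<close>, which \<open>radial_square_le\<close> bounds by the
  energy.\<close>

lemma poincare:
  assumes r: "0 < r" "r < R"
  shows "(real DIM('a) - 1) * ball_integral y\<^sub>0 r (\<lambda>y. (q y)\<^sup>2)
    \<le> r * sphere_integral y\<^sub>0 r (\<lambda>y. (q y)\<^sup>2) + r\<^sup>2 * ball_integral y\<^sub>0 r energy"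
proof -
  note cs = continuous_on_subset[OF cq sub_cball(1)[OF r(2)]]
    continuous_on_subset[OF continuous_radial sub_cball(1)[OF r(2)]]
    continuous_on_subset[OF continuous_energy sub_cball(1)[OF r(2)]]
  have "(real DIM('a) - 1) * ball_integral y\<^sub>0 r (\<lambda>y. (q y)\<^sup>2) - r\<^sup>2 * ball_integral y\<^sub>0 r energy
      = ball_integral y\<^sub>0 r (\<lambda>y. (real DIM('a) - 1) * (q y)\<^sup>2 - r\<^sup>2 * energy y)"
    unfolding ball_integral_cmult[symmetric]
    by (rule ball_integral_diff[symmetric]) (intro continuous_intros cs)+
  also have "\<dots> \<le> ball_integral y\<^sub>0 r (\<lambda>y. DIM('a) * (q y)\<^sup>2 + 2 * (q y * radial y))"
  proof (rule ball_integral_mono)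
    fix y assume "y \<in> ball y\<^sub>0 r"
    then have "(radial y)\<^sup>2 \<le> r\<^sup>2 * energy y" by (intro radial_square_le) auto
    moreover have "0 \<le> (q y + radial y)\<^sup>2" by simp
    ultimately show "(real DIM('a) - 1) * (q y)\<^sup>2 - r\<^sup>2 * energy y
        \<le> DIM('a) * (q y)\<^sup>2 + 2 * (q y * radial y)"
      by (simp add: power2_sum algebra_simps)
  qed (intro continuous_intros cs)+
  also have "\<dots> = r * sphere_integral y\<^sub>0 r (\<lambda>y. (q y)\<^sup>2)"
    by (rule position_identity[OF r, symmetric])
  finally show ?thesis by simp
qed

end

section \<open>The derivative of the frequency\<close>

locale frequency_pair =
  g: C2_cball g Gg G2g y\<^sub>0 R + h: C2_cball h Gh G2h y\<^sub>0 R
  for g h :: "'a::euclidean_space \<Rightarrow> real" and Gg Gh G2g G2h y\<^sub>0 R +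
  fixes lam :: real
  assumes lapl_g: "y \<in> cball y\<^sub>0 R \<Longrightarrow> g.lapl y = h y + 2 * lam * g y"
    and lapl_h: "y \<in> cball y\<^sub>0 R \<Longrightarrow> h.lapl y = 0"
    and lam: "lam > 1"
    and dim: "DIM('a) \<ge> 3"
begin

definition "D s = ball_integral y\<^sub>0 s (\<lambda>y. g.energy y + h.energy y + g y * h y + 2 * lam * (g y)\<^sup>2)"
definition "H s = sphere_integral y\<^sub>0 s (\<lambda>y. (g y)\<^sup>2 + (h y)\<^sup>2)"
definition "A s = ball_integral y\<^sub>0 s (\<lambda>y. g.energy y + h.energy y)"
definition "E s = ball_integral y\<^sub>0 s (\<lambda>y. (g y)\<^sup>2 + (h y)\<^sup>2)"
definition "X s = ball_integral y\<^sub>0 s (\<lambda>y. g y * h y)"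
definition "E\<^sub>g s = ball_integral y\<^sub>0 s (\<lambda>y. (g y)\<^sup>2)"
definition "Z s = ball_integral y\<^sub>0 s (\<lambda>y. g.radial y * h y)"
definition "S\<^sub>X s = sphere_integral y\<^sub>0 s (\<lambda>y. g y * h y)"
definition "S\<^sub>N s = sphere_integral y\<^sub>0 s (\<lambda>y. (g.radial y)\<^sup>2 + (h.radial y)\<^sup>2)"

lemmas conts = g.cq h.cq g.continuous_radial h.continuous_radial g.continuous_energy h.continuous_energy

lemma conts_ball:
  assumes "s < R"
  shows "continuous_on (cball y\<^sub>0 s) g" "continuous_on (cball y\<^sub>0 s) h"
    "continuous_on (cball y\<^sub>0 s) g.radial" "continuous_on (cball y\<^sub>0 s) h.radial"
    "continuous_on (cball y\<^sub>0 s) g.energy" "continuous_on (cball y\<^sub>0 s) h.energy"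
  using conts[THEN continuous_on_subset[OF _ g.sub_cball(1)[OF assms]]] .

lemma conts_sphere:
  assumes "s < R"
  shows "continuous_on (sphere y\<^sub>0 s) g" "continuous_on (sphere y\<^sub>0 s) h"
    "continuous_on (sphere y\<^sub>0 s) g.radial" "continuous_on (sphere y\<^sub>0 s) h.radial"
    "continuous_on (sphere y\<^sub>0 s) g.energy" "continuous_on (sphere y\<^sub>0 s) h.energy"
  using conts[THEN continuous_on_subset[OF _ g.sub_cball(2)[OF assms]]] .

lemma D_eq:
  assumes "s < R"
  shows "D s = A s + X s + 2 * lam * E\<^sub>g s"
proof -
  have "D s = ball_integral y\<^sub>0 s (\<lambda>y. (g.energy y + h.energy y) + g y * h y) + ball_integral y\<^sub>0 s (\<lambda>y. 2 * lam * (g y)\<^sup>2)"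
    unfolding D_def by (rule ball_integral_add) (intro continuous_intros conts_ball assms)+
  also have "ball_integral y\<^sub>0 s (\<lambda>y. (g.energy y + h.energy y) + g y * h y) = A s + X s"
    unfolding A_def X_def by (rule ball_integral_add) (intro continuous_intros conts_ball assms)+
  finally show ?thesis by (simp add: ball_integral_cmult E\<^sub>g_def)
qed

text \<open>The two equations turn the integrand of \<open>D\<close> into
  \<open>energy + q * lapl\<close> summed over \<open>g\<close> and \<open>h\<close>, so Green's
  identity applies. This is the origin of the terms \<open>g * h\<close> and
  \<open>2 * lam * g^2\<close> in the frequency.\<close>

lemma boundary_form:
  assumes s: "0 < s" "s < R"
  shows "s * D s = sphere_integral y\<^sub>0 s (\<lambda>y. g y * g.radial y + h y * h.radial y)"
proof -
  have sub: "ball y\<^sub>0 s \<subseteq> cball y\<^sub>0 R" using s by auto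
  have "D s = ball_integral y\<^sub>0 s (\<lambda>y. (g.energy y + g y * (h y + 2 * lam * g y)) + h.energy y)"
    unfolding D_def by (rule ball_integral_cong) (simp add: algebra_simps power2_eq_square)
  also have "\<dots> = ball_integral y\<^sub>0 s (\<lambda>y. g.energy y + g y * (h y + 2 * lam * g y)) + ball_integral y\<^sub>0 s h.energy"
    by (rule ball_integral_add) (intro continuous_intros conts_ball s)+
  also have "ball_integral y\<^sub>0 s (\<lambda>y. g.energy y + g y * (h y + 2 * lam * g y))
      = ball_integral y\<^sub>0 s (\<lambda>y. g.energy y + g y * g.lapl y)"
    by (rule ball_integral_cong) (use sub lapl_g in auto)
  also have "ball_integral y\<^sub>0 s h.energy = ball_integral y\<^sub>0 s (\<lambda>y. h.energy y + h y * h.lapl y)"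
    by (rule ball_integral_cong) (use sub lapl_h in auto)
  finally have "s * D s = sphere_integral y\<^sub>0 s (\<lambda>y. g y * g.radial y) + sphere_integral y\<^sub>0 s (\<lambda>y. h y * h.radial y)"
    by (simp add: distrib_left g.green[OF s] h.green[OF s])
  also have "\<dots> = sphere_integral y\<^sub>0 s (\<lambda>y. g y * g.radial y + h y * h.radial y)"
    by (rule sphere_integral_add[symmetric]) (intro continuous_intros conts_sphere s)+
  finally show ?thesis .
qed

lemma H_split:
  assumes s: "0 < s" "s < R"
  shows "H s = sphere_integral y\<^sub>0 s (\<lambda>y. (g y)\<^sup>2) + sphere_integral y\<^sub>0 s (\<lambda>y. (h y)\<^sup>2)"
  unfolding H_def by (rule sphere_integral_add) (intro continuous_intros conts_sphere s)+

lemma H_volume_form: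
  assumes s: "0 < s" "s < R"
  shows "s * H s = ball_integral y\<^sub>0 s (\<lambda>y. DIM('a) * ((g y)\<^sup>2 + (h y)\<^sup>2) + 2 * (g y * g.radial y + h y * h.radial y))"
proof -
  have "s * H s = ball_integral y\<^sub>0 s (\<lambda>y. DIM('a) * (g y)\<^sup>2 + 2 * (g y * g.radial y))
      + ball_integral y\<^sub>0 s (\<lambda>y. DIM('a) * (h y)\<^sup>2 + 2 * (h y * h.radial y))"
    by (simp add: H_split[OF s] distrib_left g.position_identity[OF s] h.position_identity[OF s])
  also have "\<dots> = ball_integral y\<^sub>0 s (\<lambda>y. (DIM('a) * (g y)\<^sup>2 + 2 * (g y * g.radial y))
      + (DIM('a) * (h y)\<^sup>2 + 2 * (h y * h.radial y)))"
    by (rule ball_integral_add[symmetric]) (intro continuous_intros conts_ball s)+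
  also have "\<dots> = ball_integral y\<^sub>0 s (\<lambda>y. DIM('a) * ((g y)\<^sup>2 + (h y)\<^sup>2) + 2 * (g y * g.radial y + h y * h.radial y))"
    by (rule ball_integral_cong) (simp add: algebra_simps)
  finally show ?thesis .
qed

text \<open>The ball integral in \<open>H_volume_form\<close> is differentiated instead of
  \<open>H\<close>. Its derivative is evaluated by \<open>boundary_form\<close>, and the division by
  the radius lowers the coefficient \<open>DIM('a)\<close> of \<open>H r / r\<close> by one.\<close>

lemma H_derivative:
  assumes r: "0 < r" "r < R"
  shows "(H has_real_derivative ((real DIM('a) - 1) * H r / r + 2 * D r)) (at r)"
proof -
  let ?m = "real DIM('a)"
  let ?k = "\<lambda>y. ?m * ((g y)\<^sup>2 + (h y)\<^sup>2) + 2 * (g y * g.radial y + h y * h.radial y)"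
  have "sphere_integral y\<^sub>0 r ?k
      = sphere_integral y\<^sub>0 r (\<lambda>y. ?m * ((g y)\<^sup>2 + (h y)\<^sup>2)) + sphere_integral y\<^sub>0 r (\<lambda>y. 2 * (g y * g.radial y + h y * h.radial y))"
    by (rule sphere_integral_add) (intro continuous_intros conts_sphere r)+
  also have "\<dots> = ?m * H r + 2 * (r * D r)"
    unfolding sphere_integral_cmult by (simp add: H_def boundary_form[OF r])
  finally have S: "sphere_integral y\<^sub>0 r ?k = ?m * H r + 2 * (r * D r)" .
  have "((\<lambda>s. ball_integral y\<^sub>0 s ?k) has_real_derivative ?m * H r + 2 * (r * D r)) (at r)"
    unfolding S[symmetric] by (rule has_real_derivative_ball_integral[OF r]) (intro continuous_intros conts)
  then have "((\<lambda>s. ball_integral y\<^sub>0 s ?k / s) has_real_derivative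
      ((?m * H r + 2 * (r * D r)) * r - ball_integral y\<^sub>0 r ?k * 1) / (r * r)) (at r)"
    by (rule DERIV_divide) (use r in auto)
  then have "(H has_real_derivative
      ((?m * H r + 2 * (r * D r)) * r - ball_integral y\<^sub>0 r ?k * 1) / (r * r)) (at r)"
  proof (rule has_field_derivative_transform_within_open[where S = "{0<..<R}"])
    fix s assume "s \<in> {0<..<R}"
    then have s: "0 < s" "s < R" by auto
    show "ball_integral y\<^sub>0 s ?k / s = H s" unfolding H_volume_form[OF s, symmetric] using s by simp
  qed (use r in auto)
  also have "((?m * H r + 2 * (r * D r)) * r - ball_integral y\<^sub>0 r ?k * 1) / (r * r)
      = (?m - 1) * H r / r + 2 * D r"
    unfolding H_volume_form[OF r, symmetric] using r by (simp add: field_simps)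
  finally show ?thesis .
qed

text \<open>Rellich's identity; the boundary term \<open>2 \<lambda> g\<^sup>2\<close> cancels against the volume term
  \<open>(x \<bullet> \<nabla>g) \<lambda> g\<close>.\<close>

lemma D_derivative:
  assumes r: "0 < r" "r < R"
  shows "\<exists>d. (D has_real_derivative d) (at r) \<and>
    r\<^sup>2 * d = 2 * S\<^sub>N r + r * (real DIM('a) - 2) * A r - 2 * r * Z r + r\<^sup>2 * S\<^sub>X r + 2 * lam * real DIM('a) * r * E\<^sub>g r"
proof -
  let ?m = "real DIM('a)"
  define d where "d = sphere_integral y\<^sub>0 r (\<lambda>y. g.energy y + h.energy y + g y * h y + 2 * lam * (g y)\<^sup>2)"
  have der: "(D has_real_derivative d) (at r)"
    unfolding D_def[abs_def] d_def
    by (rule has_real_derivative_ball_integral[OF r]) (intro continuous_intros conts)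
  let ?Sg2 = "sphere_integral y\<^sub>0 r (\<lambda>y. (g y)\<^sup>2)"
  let ?gX = "ball_integral y\<^sub>0 r (\<lambda>y. g y * g.radial y)"
  have d: "d = sphere_integral y\<^sub>0 r g.energy + sphere_integral y\<^sub>0 r h.energy + S\<^sub>X r + 2 * lam * ?Sg2"
  proof -
    have "d = sphere_integral y\<^sub>0 r (\<lambda>y. (g.energy y + h.energy y) + g y * h y) + sphere_integral y\<^sub>0 r (\<lambda>y. 2 * lam * (g y)\<^sup>2)"
      unfolding d_def by (rule sphere_integral_add) (intro continuous_intros conts_sphere r)+
    also have "sphere_integral y\<^sub>0 r (\<lambda>y. (g.energy y + h.energy y) + g y * h y)
        = sphere_integral y\<^sub>0 r (\<lambda>y. g.energy y + h.energy y) + S\<^sub>X r"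
      unfolding S\<^sub>X_def by (rule sphere_integral_add) (intro continuous_intros conts_sphere r)+
    also have "sphere_integral y\<^sub>0 r (\<lambda>y. g.energy y + h.energy y) = sphere_integral y\<^sub>0 r g.energy + sphere_integral y\<^sub>0 r h.energy"
      by (rule sphere_integral_add) (intro continuous_intros conts_sphere r)+
    finally show ?thesis by (simp add: sphere_integral_cmult)
  qed
  have A: "A r = ball_integral y\<^sub>0 r g.energy + ball_integral y\<^sub>0 r h.energy"
    unfolding A_def by (rule ball_integral_add) (intro continuous_intros conts_ball r)+
  have SN: "S\<^sub>N r = sphere_integral y\<^sub>0 r (\<lambda>y. (g.radial y)\<^sup>2) + sphere_integral y\<^sub>0 r (\<lambda>y. (h.radial y)\<^sup>2)"
    unfolding S\<^sub>N_def by (rule sphere_integral_add) (intro continuous_intros conts_sphere r)+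
  have "ball_integral y\<^sub>0 r (\<lambda>y. 2 * (g.radial y * g.lapl y) + (2 - ?m) * g.energy y)
      = ball_integral y\<^sub>0 r (\<lambda>y. (2 * (g.radial y * h y) + (4 * lam) * (g y * g.radial y)) + (2 - ?m) * g.energy y)"
    by (rule ball_integral_cong) (use r lapl_g in \<open>auto simp: algebra_simps\<close>)
  also have "\<dots> = ball_integral y\<^sub>0 r (\<lambda>y. 2 * (g.radial y * h y) + (4 * lam) * (g y * g.radial y))
      + ball_integral y\<^sub>0 r (\<lambda>y. (2 - ?m) * g.energy y)"
    by (rule ball_integral_add) (intro continuous_intros conts_ball r)+
  also have "ball_integral y\<^sub>0 r (\<lambda>y. 2 * (g.radial y * h y) + (4 * lam) * (g y * g.radial y))
      = ball_integral y\<^sub>0 r (\<lambda>y. 2 * (g.radial y * h y)) + ball_integral y\<^sub>0 r (\<lambda>y. (4 * lam) * (g y * g.radial y))"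
    by (rule ball_integral_add) (intro continuous_intros conts_ball r)+
  finally have Rg: "r * (2 * Z r + 4 * lam * ?gX + (2 - ?m) * ball_integral y\<^sub>0 r g.energy)
      = 2 * sphere_integral y\<^sub>0 r (\<lambda>y. (g.radial y)\<^sup>2) - r\<^sup>2 * sphere_integral y\<^sub>0 r g.energy"
    using g.rellich[OF r] by (simp add: ball_integral_cmult Z_def)
  have "ball_integral y\<^sub>0 r (\<lambda>y. 2 * (h.radial y * h.lapl y) + (2 - ?m) * h.energy y)
      = ball_integral y\<^sub>0 r (\<lambda>y. (2 - ?m) * h.energy y)"
    by (rule ball_integral_cong) (use r lapl_h in auto)
  then have Rh: "r * ((2 - ?m) * ball_integral y\<^sub>0 r h.energy)
      = 2 * sphere_integral y\<^sub>0 r (\<lambda>y. (h.radial y)\<^sup>2) - r\<^sup>2 * sphere_integral y\<^sub>0 r h.energy"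
    using h.rellich[OF r] by (simp add: ball_integral_cmult)
  have "r * ?Sg2 = ball_integral y\<^sub>0 r (\<lambda>y. ?m * (g y)\<^sup>2) + ball_integral y\<^sub>0 r (\<lambda>y. 2 * (g y * g.radial y))"
    unfolding g.position_identity[OF r]
    by (rule ball_integral_add) (intro continuous_intros conts_ball r)+
  \<comment> \<open>Multiplied by \<open>2 * lam\<close>, the term \<open>2 * ?gX\<close> cancels
    \<open>4 * lam * ?gX\<close> from \<open>Rg\<close>. What remains with a factor
    \<open>lam\<close> is a multiple of \<open>E\<^sub>g\<close>, which has a sign.\<close>
  then have P: "r * ?Sg2 = ?m * E\<^sub>g r + 2 * ?gX" by (simp add: ball_integral_cmult E\<^sub>g_def)
  have e1: "r\<^sup>2 * sphere_integral y\<^sub>0 r g.energy = 2 * sphere_integral y\<^sub>0 r (\<lambda>y. (g.radial y)\<^sup>2)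
      - r * (2 * Z r + 4 * lam * ?gX + (2 - ?m) * ball_integral y\<^sub>0 r g.energy)"
    using Rg by linarith
  have e2: "r\<^sup>2 * sphere_integral y\<^sub>0 r h.energy = 2 * sphere_integral y\<^sub>0 r (\<lambda>y. (h.radial y)\<^sup>2)
      - r * ((2 - ?m) * ball_integral y\<^sub>0 r h.energy)"
    using Rh by linarith
  have "r\<^sup>2 * d = r\<^sup>2 * sphere_integral y\<^sub>0 r g.energy + r\<^sup>2 * sphere_integral y\<^sub>0 r h.energy
      + r\<^sup>2 * S\<^sub>X r + 2 * lam * r * (r * ?Sg2)"
    unfolding d by (simp add: algebra_simps power2_eq_square)
  also have "\<dots> = 2 * S\<^sub>N r + r * (?m - 2) * A r - 2 * r * Z r + r\<^sup>2 * S\<^sub>X r + 2 * lam * ?m * r * E\<^sub>g r"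
  proof -
    have "(2 * b - r * (2 * z + 4 * l * x + (2 - m) * a)) + (2 * b' - r * ((2 - m) * a'))
        + r\<^sup>2 * t + 2 * l * r * (m * e + 2 * x)
      = 2 * (b + b') + r * (m - 2) * (a + a') - 2 * r * z + r\<^sup>2 * t + 2 * l * m * r * e"
      for a a' b b' z l x m t e :: real by (simp add: algebra_simps)
    then show ?thesis unfolding P SN A e1 e2 .
  qed
  finally show ?thesis using der by (intro exI[of _ d] conjI)
qed

lemma cauchy_schwarz_sphere:
  assumes r: "0 < r" "r < R" and H: "H r > 0"
  shows "(r * D r)\<^sup>2 \<le> H r * S\<^sub>N r"
proof -
  \<comment> \<open>The minimiser of the quadratic in \<open>k\<close> below; its nonnegative
    minimum is the claimed inequality.\<close>
  define k where "k = r * D r / H r"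
  have "0 \<le> sphere_integral y\<^sub>0 r (\<lambda>y. (g.radial y - k * g y)\<^sup>2 + (h.radial y - k * h y)\<^sup>2)"
    by (rule sphere_integral_nonneg) (use r in auto)
  also have "\<dots> = sphere_integral y\<^sub>0 r (\<lambda>y. ((g.radial y)\<^sup>2 + (h.radial y)\<^sup>2)
      - (2 * k * (g y * g.radial y + h y * h.radial y) - k\<^sup>2 * ((g y)\<^sup>2 + (h y)\<^sup>2)))"
    by (rule sphere_integral_cong[OF r(1)]) (simp add: power2_diff algebra_simps power2_eq_square)
  also have "\<dots> = S\<^sub>N r - sphere_integral y\<^sub>0 r (\<lambda>y. 2 * k * (g y * g.radial y + h y * h.radial y) - k\<^sup>2 * ((g y)\<^sup>2 + (h y)\<^sup>2))"
    unfolding S\<^sub>N_def by (rule sphere_integral_diff) (intro continuous_intros conts_sphere r)+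
  also have "sphere_integral y\<^sub>0 r (\<lambda>y. 2 * k * (g y * g.radial y + h y * h.radial y) - k\<^sup>2 * ((g y)\<^sup>2 + (h y)\<^sup>2))
      = sphere_integral y\<^sub>0 r (\<lambda>y. 2 * k * (g y * g.radial y + h y * h.radial y))
        - sphere_integral y\<^sub>0 r (\<lambda>y. k\<^sup>2 * ((g y)\<^sup>2 + (h y)\<^sup>2))"
    by (rule sphere_integral_diff) (intro continuous_intros conts_sphere r)+
  also have "\<dots> = 2 * k * (r * D r) - k\<^sup>2 * H r"
    unfolding sphere_integral_cmult by (simp add: H_def boundary_form[OF r])
  also have "\<dots> = (r * D r)\<^sup>2 / H r"
    using H by (simp add: k_def power2_eq_square)
  finally show ?thesis using H by (simp add: divide_le_eq mult.commute)
qed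

text \<open>\<open>X\<close>, \<open>Z\<close> and \<open>S\<^sub>X\<close> have no sign and must be
  small compared with \<open>r * D r\<close>. Poincare supplies the extra factor \<open>r\<close>,
  with the hypothesis \<open>H r \<le> r * D r\<close> controlling its boundary term.\<close>

lemma remainder_bounds:
  assumes r: "0 < r" "r < R" "r \<le> 1" and N: "H r \<le> r * D r" and D: "D r > 0"
  shows "\<bar>X r\<bar> \<le> r * D r" "2 * \<bar>Z r\<bar> \<le> 3 * (r * D r)" "2 * \<bar>S\<^sub>X r\<bar> \<le> r * D r" "E\<^sub>g r \<ge> 0"
proof -
  let ?m = "real DIM('a)"
  have A: "A r = ball_integral y\<^sub>0 r g.energy + ball_integral y\<^sub>0 r h.energy"
    unfolding A_def by (rule ball_integral_add) (intro continuous_intros conts_ball r)+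
  have E: "E r = E\<^sub>g r + ball_integral y\<^sub>0 r (\<lambda>y. (h y)\<^sup>2)"
    unfolding E_def E\<^sub>g_def by (rule ball_integral_add) (intro continuous_intros conts_ball r)+
  have nn: "A r \<ge> 0" "E r \<ge> 0"
    unfolding A_def E_def
    by (auto intro!: ball_integral_nonneg add_nonneg_nonneg g.energy_nonneg h.energy_nonneg)
  show Eg: "E\<^sub>g r \<ge> 0" unfolding E\<^sub>g_def by (auto intro!: ball_integral_nonneg)
  have "(?m - 1) * E r \<le> r * H r + r\<^sup>2 * A r"
    using g.poincare[OF r(1,2)] h.poincare[OF r(1,2)]
    unfolding E E\<^sub>g_def A H_split[OF r(1,2)] distrib_left by linarith
  moreover have "2 * E r \<le> (?m - 1) * E r" using dim nn(2) by (intro mult_right_mono) auto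
  moreover have "r * H r \<le> r * (r * D r)" using N r by (intro mult_left_mono) auto
  ultimately have E2: "2 * E r \<le> r\<^sup>2 * (D r + A r)" by (simp add: power2_eq_square algebra_simps)
  have r2: "r\<^sup>2 \<le> r" using r mult_left_mono[of r 1 r] by (simp add: power2_eq_square)
  have absX: "2 * \<bar>X r\<bar> \<le> E r"
  proof -
    have pw: "2 * (g y * h y) \<le> (g y)\<^sup>2 + (h y)\<^sup>2" "- ((g y)\<^sup>2 + (h y)\<^sup>2) \<le> 2 * (g y * h y)" for y
      using sum_squares_bound[of "g y" "h y"] sum_squares_bound[of "g y" "- h y"] by simp_all
    have "2 * X r \<le> E r"
      unfolding X_def E_def ball_integral_cmult[symmetric]
      by (rule ball_integral_mono) (intro continuous_intros conts_ball r pw)+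
    moreover have "- E r \<le> 2 * X r"
    proof -
      have "ball_integral y\<^sub>0 r (\<lambda>y. (-1) * ((g y)\<^sup>2 + (h y)\<^sup>2)) \<le> ball_integral y\<^sub>0 r (\<lambda>y. 2 * (g y * h y))"
        using pw(2) by (intro ball_integral_mono continuous_intros conts_ball r) simp
      then show ?thesis unfolding X_def E_def ball_integral_cmult by simp
    qed
    ultimately show ?thesis by linarith
  qed
  have lamE: "lam * E\<^sub>g r \<ge> 0" using lam Eg by simp
  \<comment> \<open>The \<open>lam\<close> term of \<open>D\<close> is discarded by its sign alone,
    which keeps the bounds free of \<open>lam\<close>.\<close>
  have "A r \<le> D r + E r / 2"
    using D_eq[OF r(2)] absX lamE by linarith
  moreover have "2 * E r \<le> D r + A r"
  proof -
    have "r\<^sup>2 * (D r + A r) \<le> 1 * (D r + A r)" using r2 r D nn(1) by (intro mult_right_mono) auto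
    then show ?thesis using E2 by (simp only: mult_1 order_trans)
  qed
  \<comment> \<open>Inserting \<open>E r / 2 \<le> (D r + A r) / 4\<close> leaves a coefficient
    \<open>3 / 4\<close> at \<open>A r\<close>, so the energy can be absorbed.\<close>
  ultimately have A53: "3 * A r \<le> 5 * D r" by linarith
  have "r\<^sup>2 * (D r + A r) \<le> r * (D r + A r)" using r2 D nn(1) by (intro mult_right_mono) auto
  also have "\<dots> \<le> r * (8 / 3 * D r)" using A53 r by (intro mult_left_mono) auto
  finally have E43: "3 * E r \<le> 4 * (r * D r)" using E2 by linarith
  show "\<bar>X r\<bar> \<le> r * D r" using absX E43 D r by (simp add: mult_pos_pos)
  have "2 * \<bar>Z r\<bar> \<le> r\<^sup>2 * A r + E r"
  proof -
    have pw: "2 * (g.radial y * h y) \<le> r\<^sup>2 * (g.energy y + h.energy y) + ((g y)\<^sup>2 + (h y)\<^sup>2)"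
      "- (r\<^sup>2 * (g.energy y + h.energy y) + ((g y)\<^sup>2 + (h y)\<^sup>2)) \<le> 2 * (g.radial y * h y)"
      if "y \<in> ball y\<^sub>0 r" for y
    proof -
      have "(g.radial y)\<^sup>2 \<le> r\<^sup>2 * g.energy y" using that by (intro g.radial_square_le) auto
      also have "\<dots> \<le> r\<^sup>2 * (g.energy y + h.energy y)"
        using h.energy_nonneg by (intro mult_left_mono) auto
      finally have "(g.radial y)\<^sup>2 \<le> r\<^sup>2 * (g.energy y + h.energy y)" .
      moreover have "2 * (g.radial y * h y) \<le> (g.radial y)\<^sup>2 + (h y)\<^sup>2"
        "- ((g.radial y)\<^sup>2 + (h y)\<^sup>2) \<le> 2 * (g.radial y * h y)"
        using sum_squares_bound[of "g.radial y" "h y"] sum_squares_bound[of "g.radial y" "- h y"] by simp_all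
      moreover have "(g y)\<^sup>2 \<ge> 0" by simp
      ultimately show "2 * (g.radial y * h y) \<le> r\<^sup>2 * (g.energy y + h.energy y) + ((g y)\<^sup>2 + (h y)\<^sup>2)"
        "- (r\<^sup>2 * (g.energy y + h.energy y) + ((g y)\<^sup>2 + (h y)\<^sup>2)) \<le> 2 * (g.radial y * h y)"
        by linarith+
    qed
    have sum: "ball_integral y\<^sub>0 r (\<lambda>y. r\<^sup>2 * (g.energy y + h.energy y) + ((g y)\<^sup>2 + (h y)\<^sup>2)) = r\<^sup>2 * A r + E r"
      unfolding A_def E_def ball_integral_cmult[symmetric]
      by (rule ball_integral_add) (intro continuous_intros conts_ball r)+
    have "2 * Z r \<le> r\<^sup>2 * A r + E r"
      unfolding Z_def sum[symmetric] ball_integral_cmult[symmetric]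
      by (rule ball_integral_mono) (intro continuous_intros conts_ball r pw | assumption)+
    moreover have "- (r\<^sup>2 * A r + E r) \<le> 2 * Z r"
    proof -
      have "ball_integral y\<^sub>0 r (\<lambda>y. (-1) * (r\<^sup>2 * (g.energy y + h.energy y) + ((g y)\<^sup>2 + (h y)\<^sup>2)))
          \<le> ball_integral y\<^sub>0 r (\<lambda>y. 2 * (g.radial y * h y))"
        using pw(2) by (intro ball_integral_mono continuous_intros conts_ball r) simp
      then show ?thesis unfolding ball_integral_cmult sum Z_def by simp
    qed
    ultimately show ?thesis by linarith
  qed
  moreover have "r\<^sup>2 * A r \<le> r * (5 / 3 * D r)" using r2 A53 nn(1) r by (intro mult_mono) auto
  \<comment> \<open>Here \<open>3\<close> is \<open>5 / 3\<close> from the energy plus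
    \<open>4 / 3\<close> from \<open>E\<close>.\<close>
  ultimately show "2 * \<bar>Z r\<bar> \<le> 3 * (r * D r)" using E43 by linarith
  have "2 * \<bar>S\<^sub>X r\<bar> \<le> H r"
  proof -
    have pw: "2 * (g y * h y) \<le> (g y)\<^sup>2 + (h y)\<^sup>2" "(-1) * ((g y)\<^sup>2 + (h y)\<^sup>2) \<le> 2 * (g y * h y)" for y
      using sum_squares_bound[of "g y" "h y"] sum_squares_bound[of "g y" "- h y"] by simp_all
    have "2 * S\<^sub>X r \<le> H r"
      unfolding S\<^sub>X_def H_def sphere_integral_cmult[symmetric]
      by (rule sphere_integral_mono) (intro continuous_intros conts_sphere r pw)+
    moreover have "(-1) * H r \<le> 2 * S\<^sub>X r"
      unfolding S\<^sub>X_def H_def sphere_integral_cmult[symmetric]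
      by (rule sphere_integral_mono) (intro continuous_intros conts_sphere r pw)+
    ultimately show ?thesis by linarith
  qed
  then show "2 * \<bar>S\<^sub>X r\<bar> \<le> r * D r" using N by linarith
qed

text \<open>\<open>c\<close> stands for the unknown ratio of Hausdorff to surface measure; as a
  constant factor under the logarithm it does not affect the derivative.\<close>

lemma log_frequency_derivative:
  assumes r: "0 < r" "r < R" "r \<le> 1" and H: "H r > 0" and N: "H r \<le> r * D r" and c: "c > 0"
  shows "\<exists>d. ((\<lambda>s. ln (s * D s / (c * H s))) has_real_derivative d) (at r) \<and> d \<ge> - (real DIM('a) + 3)"
proof -
  let ?m = "real DIM('a)"
  have D: "D r > 0" using H N r by (smt (verit) zero_less_mult_pos)
  obtain d where d: "(D has_real_derivative d) (at r)"
    "r\<^sup>2 * d = 2 * S\<^sub>N r + r * (?m - 2) * A r - 2 * r * Z r + r\<^sup>2 * S\<^sub>X r + 2 * lam * ?m * r * E\<^sub>g r"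
    using D_derivative[OF r(1,2)] by blast
  have dH: "(H has_real_derivative ((?m - 1) * H r / r + 2 * D r)) (at r)"
    by (rule H_derivative[OF r(1,2)])
  define L where "L = 1 / r + d / D r - ((?m - 1) / r + 2 * D r / H r)"
  have "((\<lambda>s. ln (s * D s / (c * H s))) has_real_derivative L) (at r)"
    using r H D c unfolding L_def
    by (auto intro!: derivative_eq_intros d(1) dH simp: field_simps)
  moreover have "L \<ge> - (?m + 3)"
  proof -
    note b = remainder_bounds[OF r N D]
    have rD: "r * D r > 0" using r D by simp
    \<comment> \<open>By Cauchy-Schwarz the boundary term of the derivative of \<open>D\<close>
      outweighs the term \<open>2 * D r / H r\<close> from the derivative of
      \<open>ln (H s)\<close>: the top-order terms have the right sign.\<close>
    have "2 * (r * D r)\<^sup>2 / H r \<le> 2 * S\<^sub>N r"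
      using cauchy_schwarz_sphere[OF r(1,2) H] H by (simp add: divide_le_eq mult.commute)
    then have SN: "2 * S\<^sub>N r \<ge> (r * (r * D r)) * (2 * D r / H r)"
      by (simp add: power2_eq_square mult_ac)
    have "(r * (r * D r)) * L = r\<^sup>2 * d - (?m - 2) * (r * D r) - (r * (r * D r)) * (2 * D r / H r)"
      using r D by (simp add: L_def field_simps power2_eq_square)
    also have "\<dots> \<ge> r * (?m - 2) * A r - 2 * r * Z r + r\<^sup>2 * S\<^sub>X r + 2 * lam * ?m * r * E\<^sub>g r - (?m - 2) * (r * D r)"
      using SN unfolding d(2) by linarith
    \<comment> \<open>Expanding \<open>D\<close> by \<open>D_eq\<close> cancels \<open>A\<close>. Of
      the \<open>lam\<close> terms \<open>4 * (lam * E\<^sub>g r)\<close> is left, with the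
      favourable sign.\<close>
    also have "r * (?m - 2) * A r - 2 * r * Z r + r\<^sup>2 * S\<^sub>X r + 2 * lam * ?m * r * E\<^sub>g r - (?m - 2) * (r * D r)
        = r * (4 * (lam * E\<^sub>g r) - (?m - 2) * X r - 2 * Z r + r * S\<^sub>X r)"
      unfolding D_eq[OF r(2)] by (simp add: algebra_simps power2_eq_square)
    finally have "r * (4 * (lam * E\<^sub>g r) - (?m - 2) * X r - 2 * Z r + r * S\<^sub>X r) \<le> r * ((r * D r) * L)"
      by (simp add: mult_ac)
    then have "4 * (lam * E\<^sub>g r) - (?m - 2) * X r - 2 * Z r + r * S\<^sub>X r \<le> (r * D r) * L"
      using r by simp
    moreover have "lam * E\<^sub>g r \<ge> 0" using lam b(4) by simp
    moreover have "(?m - 2) * X r \<le> (?m - 2) * (r * D r)"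
      using b(1) dim by (intro mult_left_mono) auto
    moreover have "r * S\<^sub>X r \<ge> - (r * D r)"
    proof -
      have "\<bar>r * S\<^sub>X r\<bar> \<le> 1 * (r * D r)"
        unfolding abs_mult using r b(3) rD by (intro mult_mono) auto
      then show ?thesis by linarith
    qed
    moreover have "2 * Z r \<le> 3 * (r * D r)" using b(2) by linarith
    \<comment> \<open>In units of \<open>r * D r\<close> the losses are \<open>?m - 2\<close> from
      \<open>X\<close>, \<open>3\<close> from \<open>Z\<close> and \<open>1\<close> from
      \<open>S\<^sub>X\<close>, together \<open>?m + 2\<close>.\<close>
    ultimately have "- ((?m - 2) * (r * D r) + 3 * (r * D r) + r * D r) \<le> (r * D r) * L"
      by linarith
    then have "(r * D r) * (- (?m + 2)) \<le> (r * D r) * L" by (simp add: algebra_simps)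
    then have "- (?m + 2) \<le> L" using rD by (simp only: mult_le_cancel_left_pos)
    then show ?thesis by simp
  qed
  ultimately show ?thesis by blast
qed

end

section \<open>Exponential lifts of bi-Laplace eigenfunctions\<close>

lemma partial_deriv_eqI: "(f has_derivative f') (at x) \<Longrightarrow> partial_deriv i f x = f' i"
  unfolding partial_deriv_def by (simp add: frechet_derivative_at[symmetric])

lemma has_derivative_partial_deriv:
  assumes "f differentiable (at x)"
  shows "(f has_derivative (\<lambda>v. \<Sum>i\<in>Basis. (v \<bullet> i) * partial_deriv i f x)) (at x)"
proof -
  obtain f' where f': "(f has_derivative f') (at x)" using assms by (auto simp: differentiable_def)
  interpret bounded_linear f' using f' by (rule has_derivative_bounded_linear)
  have "f' v = (\<Sum>i\<in>Basis. (v \<bullet> i) * partial_deriv i f x)" for v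
  proof -
    have "f' v = f' (\<Sum>i\<in>Basis. (v \<bullet> i) *\<^sub>R i)" by (simp add: euclidean_representation)
    also have "\<dots> = (\<Sum>i\<in>Basis. (v \<bullet> i) * f' i)" by (simp add: sum scaleR)
    finally show ?thesis by (simp add: partial_deriv_eqI[OF f'])
  qed
  then have "f' = (\<lambda>v. \<Sum>i\<in>Basis. (v \<bullet> i) * partial_deriv i f x)" by blast
  then show ?thesis using f' by simp
qed

lemma partial_deriv_cong:
  assumes "open S" "x \<in> S" "\<And>y. y \<in> S \<Longrightarrow> f y = g y" "g differentiable (at x)"
  shows "partial_deriv i f x = partial_deriv i g x"
  unfolding partial_deriv_def
  using frechet_derivative_transform_within_open[of g x S f] assms by simp

lemma differentiable_cong:
  assumes "open S" "x \<in> S" "\<And>y. y \<in> S \<Longrightarrow> f y = g y" "g differentiable (at x)"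
  shows "f differentiable (at x)"
  using assms has_derivative_transform_within_open[of g _ x UNIV S f]
  unfolding differentiable_def by auto

text \<open>The rules for \<open>partial_deriv\<close> hold only at points of differentiability, so
  regularity has to be transported along equality on an open set rather than equality of
  functions.\<close>

lemma Ck_on_cong:
  assumes "open S" "\<And>x. x \<in> S \<Longrightarrow> f x = g x" "Ck_on k g S"
  shows "Ck_on k f S"
  using assms(2,3)
proof (induction k arbitrary: f g)
  case 0
  then show ?case by (simp cong: continuous_on_cong)
next
  case (Suc k)
  have dg: "g differentiable (at x)" if "x \<in> S" for x using Suc.prems(2) that by simp
  have "f differentiable (at x)" if "x \<in> S" for x
    by (rule differentiable_cong[OF assms(1) that Suc.prems(1) dg[OF that]])
  moreover have "Ck_on k (partial_deriv i f) S" if "i \<in> Basis" for i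
    by (rule Suc.IH[OF partial_deriv_cong[OF assms(1) _ Suc.prems(1) dg]]) (use Suc.prems(2) that in auto)
  ultimately show ?case by simp
qed

lemma Ck_on_Suc_imp: "Ck_on (Suc k) f S \<Longrightarrow> Ck_on k f S"
proof (induction k arbitrary: f)
  case 0
  then show ?case
    by (auto intro!: continuous_at_imp_continuous_on differentiable_imp_continuous_within)
next
  case (Suc k)
  then show ?case by (metis Ck_on.simps(2))
qed

lemma Ck_on_mono: "j \<le> k \<Longrightarrow> Ck_on k f S \<Longrightarrow> Ck_on j f S"
  by (induction k rule: dec_induct[consumes 1]) (auto dest: Ck_on_Suc_imp simp del: Ck_on.simps)

lemma partial_deriv_add:
  assumes "f differentiable (at x)" "g differentiable (at x)"
  shows "partial_deriv i (\<lambda>x. f x + g x) x = partial_deriv i f x + partial_deriv i g x"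
proof -
  obtain f' g' where *: "(f has_derivative f') (at x)" "(g has_derivative g') (at x)"
    using assms by (auto simp: differentiable_def)
  show ?thesis
    using partial_deriv_eqI[OF has_derivative_add[OF *]] by (simp add: *[THEN partial_deriv_eqI])
qed

lemma partial_deriv_cmult:
  assumes "f differentiable (at x)"
  shows "partial_deriv i (\<lambda>x. c * f x) x = c * partial_deriv i f x"
proof -
  obtain f' where *: "(f has_derivative f') (at x)" using assms by (auto simp: differentiable_def)
  show ?thesis
    using partial_deriv_eqI[OF has_derivative_mult_right[OF *, of c]] by (simp add: partial_deriv_eqI[OF *])
qed

lemma Ck_on_add:
  assumes "open S" "Ck_on k f S" "Ck_on k g S"
  shows "Ck_on k (\<lambda>x. f x + g x) S"
  using assms(2,3)
proof (induction k arbitrary: f g)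
  case 0
  then show ?case by (simp add: continuous_on_add)
next
  case (Suc k)
  have d: "f differentiable (at x)" "g differentiable (at x)" if "x \<in> S" for x
    using Suc.prems that by simp_all
  have "Ck_on k (partial_deriv i (\<lambda>x. f x + g x)) S" if "i \<in> Basis" for i
    by (rule Ck_on_cong[OF assms(1) partial_deriv_add[OF d]])
      (use Suc that in auto)
  then show ?case using d by simp
qed

lemma Ck_on_cmult:
  assumes "open S" "Ck_on k f S"
  shows "Ck_on k (\<lambda>x. c * f x) S"
  using assms(2)
proof (induction k arbitrary: f)
  case 0
  then show ?case by (simp add: continuous_on_mult_left)
next
  case (Suc k)
  have d: "f differentiable (at x)" if "x \<in> S" for x using Suc.prems that by simp
  have "Ck_on k (partial_deriv i (\<lambda>x. c * f x)) S" if "i \<in> Basis" for i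
    by (rule Ck_on_cong[OF assms(1) partial_deriv_cmult[OF d]]) (use Suc that in auto)
  then show ?case using d by simp
qed

lemma Ck_on_zero: "open S \<Longrightarrow> Ck_on k (\<lambda>x. 0) S"
proof (induction k)
  case (Suc k)
  have "partial_deriv i (\<lambda>x::'a. 0) = (\<lambda>x. 0)" for i
    by (rule ext) (simp add: partial_deriv_def)
  then show ?case using Suc by simp
qed simp

lemma Ck_on_sum:
  assumes "open S" "finite I" "\<And>i. i \<in> I \<Longrightarrow> Ck_on k (f i) S"
  shows "Ck_on k (\<lambda>x. \<Sum>i\<in>I. f i x) S"
  using assms(2,3) by (induction I rule: finite_induct) (simp_all add: Ck_on_zero Ck_on_add assms(1))

lemma Ck_on_laplacian:
  assumes "open S" "Ck_on (Suc (Suc k)) f S"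
  shows "Ck_on k (laplacian f) S"
proof -
  have "Ck_on k (\<lambda>x. \<Sum>i\<in>Basis. partial_deriv i (partial_deriv i f) x) S"
    by (rule Ck_on_sum) (use assms in auto)
  then show ?thesis unfolding laplacian_def[abs_def] .
qed

lemma laplacian_add_cmult:
  assumes S: "open S" "x \<in> S" and f: "Ck_on 2 f S" "Ck_on 2 g S"
  shows "laplacian (\<lambda>x. f x + c * g x) x = laplacian f x + c * laplacian g x"
proof -
  have f1: "Ck_on (Suc (Suc 0)) f S" "Ck_on (Suc (Suc 0)) g S"
    using f by (simp_all add: numeral_2_eq_2)
  have d: "f differentiable (at y)" "g differentiable (at y)" "(\<lambda>x. c * g x) differentiable (at y)"
    if "y \<in> S" for y using f1 that by auto
  have dp: "partial_deriv i f differentiable (at x)" "partial_deriv i g differentiable (at x)"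
    "(\<lambda>x. c * partial_deriv i g x) differentiable (at x)" if "i \<in> Basis" for i
    using f1 that S by auto
  have "partial_deriv i (partial_deriv i (\<lambda>x. f x + c * g x)) x
      = partial_deriv i (partial_deriv i f) x + c * partial_deriv i (partial_deriv i g) x"
    if i: "i \<in> Basis" for i
  proof -
    have "partial_deriv i (partial_deriv i (\<lambda>x. f x + c * g x)) x
        = partial_deriv i (\<lambda>x. partial_deriv i f x + c * partial_deriv i g x) x"
      by (rule partial_deriv_cong[OF S])
        (use d dp[OF i] in \<open>auto simp: partial_deriv_add partial_deriv_cmult\<close>)
    then show ?thesis using dp[OF i] by (simp add: partial_deriv_add partial_deriv_cmult)
  qed
  then show ?thesis by (simp add: laplacian_def sum.distrib sum_distrib_left)
qed

lemma norm_grad_squared: "(norm (grad f x))\<^sup>2 = (\<Sum>i\<in>Basis. (partial_deriv i f x)\<^sup>2)"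
  unfolding power2_norm_eq_inner euclidean_inner[of "grad f x" "grad f x"]
  by (simp add: grad_def power2_eq_square)

text \<open>The clause that is not immediate is the symmetry of the second derivatives, which comes
  from \<open>second_derivative_commute\<close>.\<close>

lemma C2_cball_Ck_on:
  assumes S: "open S" "cball y\<^sub>0 R \<subseteq> S" and f: "Ck_on 2 f S"
  shows "C2_cball f (\<lambda>i. partial_deriv i f) (\<lambda>i k. partial_deriv k (partial_deriv i f)) y\<^sub>0 R"
proof
  have f1: "Ck_on (Suc (Suc 0)) f S" using f by (simp add: numeral_2_eq_2)
  have D: "(f has_derivative (\<lambda>v. \<Sum>i\<in>Basis. (v \<bullet> i) * partial_deriv i f y)) (at y)" if "y \<in> S" for y
    using f1 that by (intro has_derivative_partial_deriv) auto
  have D2: "(partial_deriv i f has_derivative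
      (\<lambda>v. \<Sum>k\<in>Basis. (v \<bullet> k) * partial_deriv k (partial_deriv i f) y)) (at y)"
    if "i \<in> Basis" "y \<in> S" for i y
    using f1 that by (intro has_derivative_partial_deriv) auto
  have c: "continuous_on S (partial_deriv k (partial_deriv i f))" if "i \<in> Basis" "k \<in> Basis" for i k
    using f1 that by simp
  show "(f has_derivative (\<lambda>v. \<Sum>i\<in>Basis. (v \<bullet> i) * partial_deriv i f y)) (at y)"
    if "y \<in> cball y\<^sub>0 R" for y using D that S by blast
  show "(partial_deriv i f has_derivative
      (\<lambda>v. \<Sum>k\<in>Basis. (v \<bullet> k) * partial_deriv k (partial_deriv i f) y)) (at y)"
    if "i \<in> Basis" "y \<in> cball y\<^sub>0 R" for i y using D2 that S by blast
  show "continuous_on (cball y\<^sub>0 R) (partial_deriv k (partial_deriv i f))" if "i \<in> Basis" "k \<in> Basis" for i k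
    using c[OF that] S(2) by (rule continuous_on_subset)
  show "partial_deriv k (partial_deriv i f) y = partial_deriv i (partial_deriv k f) y"
    if ik: "i \<in> Basis" "k \<in> Basis" and y: "y \<in> cball y\<^sub>0 R" for i k y
  proof -
    have yS: "y \<in> S" using y S by blast
    let ?f' = "\<lambda>y v. \<Sum>i\<in>Basis. (v \<bullet> i) * partial_deriv i f y"
    let ?D2 = "\<lambda>i y v. \<Sum>k\<in>Basis. (v \<bullet> k) * partial_deriv k (partial_deriv i f) y"
    have "?D2 i y k = ?D2 k y i"
    proof (rule second_derivative_commute[OF S(1) yS, of f ?f' i "?D2 i" k "?D2 k"])
      show "((\<lambda>y. ?f' y i) has_derivative ?D2 i z) (at z)" if "z \<in> S" for z
        using D2[OF ik(1) that] by (simp add: sum_inner_Basis ik)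
      show "((\<lambda>y. ?f' y k) has_derivative ?D2 k z) (at z)" if "z \<in> S" for z
        using D2[OF ik(2) that] by (simp add: sum_inner_Basis ik)
      show "continuous_on S (\<lambda>y. ?D2 i y k)" "continuous_on S (\<lambda>y. ?D2 k y i)"
        using c ik by (simp_all add: sum_inner_Basis)
    qed (use D in auto)
    then show ?thesis using ik by (simp add: sum_inner_Basis)
  qed
qed

section \<open>Derivatives of exponential lifts\<close>

lemma has_derivative_exp_lift:
  assumes "w differentiable (at (fst y))"
  shows "(exp_lift lam w has_derivative (\<lambda>v.
      ((\<Sum>i\<in>Basis. (fst v \<bullet> i) * partial_deriv i w (fst y)) + sqrt lam * snd v * w (fst y))
        * exp (sqrt lam * snd y))) (at y)"
proof -
  have 1: "((\<lambda>y. w (fst y)) has_derivative (\<lambda>v. \<Sum>i\<in>Basis. (fst v \<bullet> i) * partial_deriv i w (fst y))) (at y)"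
    by (rule has_derivative_compose[of fst fst, OF _ has_derivative_partial_deriv[OF assms]])
      (rule has_derivative_fst[OF has_derivative_ident])
  have 2: "((\<lambda>y. exp (sqrt lam * snd y)) has_derivative (\<lambda>v. sqrt lam * snd v * exp (sqrt lam * snd y))) (at y)"
    by (auto intro!: derivative_eq_intros)
  show ?thesis
    unfolding exp_lift_def[abs_def]
    by (rule has_derivative_eq_rhs[OF has_derivative_mult[OF 1 2]]) (simp add: algebra_simps)
qed

text \<open>Partial derivatives of a lift are again lifts, so regularity and Laplacian of the lift
  follow by iterating these two rules.\<close>

lemma partial_deriv_exp_lift:
  assumes "w differentiable (at (fst y))"
  shows "i \<in> Basis \<Longrightarrow> partial_deriv (i, 0) (exp_lift lam w) y = exp_lift lam (partial_deriv i w) y"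
    and "partial_deriv (0, 1) (exp_lift lam w) y = exp_lift lam (\<lambda>x. sqrt lam * w x) y"
proof -
  note eq = partial_deriv_eqI[OF has_derivative_exp_lift[OF assms]]
  show "partial_deriv (i, 0) (exp_lift lam w) y = exp_lift lam (partial_deriv i w) y" if "i \<in> Basis"
    unfolding eq exp_lift_def by (simp add: sum_inner_Basis that)
  show "partial_deriv (0, 1) (exp_lift lam w) y = exp_lift lam (\<lambda>x. sqrt lam * w x) y"
    unfolding eq exp_lift_def by simp
qed

lemma Ck_on_exp_lift:
  fixes w :: "real ^ 'n \<Rightarrow> real"
  assumes "open \<Omega>" "Ck_on k w \<Omega>"
  shows "Ck_on k (exp_lift lam w) (\<Omega> \<times> UNIV)"
  using assms(2)
proof (induction k arbitrary: w)
  case 0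
  have w: "continuous_on \<Omega> w" using 0 by simp
  have "continuous_on (\<Omega> \<times> (UNIV :: real set)) (\<lambda>y. w (fst y))"
    by (rule continuous_on_compose2[OF w continuous_on_fst[OF continuous_on_id]]) auto
  then have "continuous_on (\<Omega> \<times> (UNIV :: real set)) (\<lambda>y. w (fst y) * exp (sqrt lam * snd y))"
    by (intro continuous_intros)
  then show ?case by (simp add: exp_lift_def[abs_def])
next
  case (Suc k)
  have d: "w differentiable (at (fst y))" if "y \<in> \<Omega> \<times> (UNIV :: real set)" for y
    using Suc.prems that by auto
  have op: "open (\<Omega> \<times> (UNIV :: real set))" using assms(1) by (intro open_Times) auto
  have "exp_lift lam w differentiable (at y)" if "y \<in> \<Omega> \<times> UNIV" for y
    using has_derivative_exp_lift[OF d[OF that]] by (auto simp: differentiable_def)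
  moreover have "Ck_on k (partial_deriv j (exp_lift lam w)) (\<Omega> \<times> UNIV)"
    if "j \<in> Basis" for j :: "(real ^ 'n) \<times> real"
  proof -
    from that consider i where "j = (i, 0)" "i \<in> Basis" | "j = (0, 1)"
      by (auto simp: Basis_prod_def)
    then show ?thesis
    proof cases
      case 1
      show ?thesis unfolding 1
        by (rule Ck_on_cong[OF op partial_deriv_exp_lift(1)[OF d 1(2)] Suc.IH]) (use Suc.prems 1 in auto)
    next
      case 2
      show ?thesis unfolding 2
        by (rule Ck_on_cong[OF op partial_deriv_exp_lift(2)[OF d] Suc.IH])
          (use Ck_on_cmult[OF assms(1) Ck_on_Suc_imp[OF Suc.prems]] in auto)
    qed
  qed
  ultimately show ?case by simp
qed

lemma sum_Basis_prod_real:
  fixes f :: "'a::euclidean_space \<times> real \<Rightarrow> real"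
  shows "sum f Basis = (\<Sum>i\<in>Basis. f (i, 0)) + f (0, 1)"
proof -
  have "inj_on (\<lambda>u::'a. (u, 0::real)) Basis" by (auto intro!: inj_onI)
  then show ?thesis
    unfolding Basis_prod_def by (subst sum.union_disjoint) (auto simp: sum.reindex)
qed

text \<open>Two vertical derivatives contribute \<open>sqrt lam * sqrt lam\<close>, which is
  \<open>lam\<close> because \<open>lam \<ge> 0\<close>.\<close>

lemma laplacian_exp_lift:
  fixes w :: "real ^ 'n \<Rightarrow> real"
  assumes \<Omega>: "open \<Omega>" "Ck_on 2 w \<Omega>" and y: "fst y \<in> \<Omega>" and lam: "lam \<ge> 0"
  shows "laplacian (exp_lift lam w) y = exp_lift lam (\<lambda>x. laplacian w x + lam * w x) y"
proof -
  have w: "Ck_on (Suc (Suc 0)) w \<Omega>" using \<Omega>(2) by (simp add: numeral_2_eq_2)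
  have op: "open (\<Omega> \<times> (UNIV :: real set))" using \<Omega>(1) by (intro open_Times) auto
  have yS: "y \<in> \<Omega> \<times> UNIV" using y by (cases y) auto
  have d: "w differentiable (at (fst z))" if "z \<in> \<Omega> \<times> (UNIV :: real set)" for z
    using w that by auto
  have ed: "exp_lift lam f differentiable (at y)" if "f differentiable (at (fst y))" for f :: "real ^ 'n \<Rightarrow> real"
    using has_derivative_exp_lift[OF that] by (auto simp: differentiable_def)
  have p: "partial_deriv i w differentiable (at (fst y))" if "i \<in> Basis" for i
    using w that y by auto
  have 1: "partial_deriv (i, 0) (partial_deriv (i, 0) (exp_lift lam w)) y
      = exp_lift lam (partial_deriv i (partial_deriv i w)) y" if i: "i \<in> Basis" for i
    by (rule trans[OF partial_deriv_cong[OF op yS partial_deriv_exp_lift(1)[OF d i] ed[OF p[OF i]]]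
          partial_deriv_exp_lift(1)[OF p[OF i] i]])
  have dc: "(\<lambda>x. sqrt lam * w x) differentiable (at (fst y))" using d[OF yS] by simp
  have 2: "partial_deriv (0, 1) (partial_deriv (0, 1) (exp_lift lam w)) y
      = exp_lift lam (\<lambda>x. sqrt lam * (sqrt lam * w x)) y"
    by (rule trans[OF partial_deriv_cong[OF op yS partial_deriv_exp_lift(2)[OF d] ed[OF dc]]
          partial_deriv_exp_lift(2)[OF dc]])
  have "laplacian (exp_lift lam w) y
      = (\<Sum>i\<in>Basis. exp_lift lam (partial_deriv i (partial_deriv i w)) y)
        + exp_lift lam (\<lambda>x. sqrt lam * (sqrt lam * w x)) y"
    unfolding laplacian_def by (subst sum_Basis_prod_real) (simp add: 1 2)
  then show ?thesis
    using lam by (simp add: laplacian_def exp_lift_def distrib_right sum_distrib_right mult.assoc[symmetric])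
qed

text \<open>Differentiating the frequency at \<open>r\<close> needs slightly larger balls inside the
  domain; compactness of the closed ball provides the room.\<close>

lemma cball_enlarge:
  fixes y\<^sub>0 :: "'a::euclidean_space"
  assumes "cball y\<^sub>0 r \<subseteq> S" "open S" "r > 0"
  obtains R where "R > r" "cball y\<^sub>0 R \<subseteq> S"
proof -
  obtain e where e: "e > 0" "(\<Union>x\<in>cball y\<^sub>0 r. ball x e) \<subseteq> S"
    using compact_subset_open_imp_ball_epsilon_subset[OF compact_cball assms(2,1)] by blast
  have "cball y\<^sub>0 (r + e / 2) \<subseteq> S"
  proof
    fix y assume y: "y \<in> cball y\<^sub>0 (r + e / 2)"
    show "y \<in> S"
    proof (cases "y \<in> cball y\<^sub>0 r")
      case False
      define d where "d = norm (y - y\<^sub>0)"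
      have d: "r < d" "d \<le> r + e / 2" using y False by (auto simp: d_def dist_norm norm_minus_commute)
      \<comment> \<open>The radial projection of \<open>y\<close> onto the sphere of radius
        \<open>r\<close>.\<close>
      define x where "x = y\<^sub>0 + (r / d) *\<^sub>R (y - y\<^sub>0)"
      have "x \<in> cball y\<^sub>0 r" using d assms(3) by (simp add: x_def dist_norm d_def[symmetric])
      moreover have "y - x = (1 - r / d) *\<^sub>R (y - y\<^sub>0)" by (simp add: x_def algebra_simps)
      then have "norm (y - x) = (1 - r / d) * d"
        using d assms(3) by (simp add: d_def[symmetric])
      then have "norm (y - x) = d - r" using d assms(3) by (simp add: left_diff_distrib)
      then have "y \<in> ball x e" using d e(1) by (simp add: dist_norm norm_minus_commute)
      ultimately show ?thesis using e(2) by blast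
    qed (use assms in blast)
  qed
  with that[of "r + e / 2"] e show ?thesis by simp
qed

text \<open>Lifting adds \<open>lam\<close> times the function to the Laplacian. For
  \<open>g\<close> this gives laplacian u + lam u = v + 2 lam u; for \<open>h\<close> it gives
  \<open>0\<close>, since laplacian v = lam^2 u - lam laplacian u = - lam v. Class C^4 of
  \<open>u\<close> makes \<open>v\<close> of class C^2.\<close>

lemma frequency_pair_exp_lift:
  fixes u :: "real ^ 'n \<Rightarrow> real"
  assumes \<Omega>: "open \<Omega>" "bilaplace_solution \<Omega> lam u" "lam > 1" and n: "CARD('n) \<ge> 2"
    and R: "cball y\<^sub>0 R \<subseteq> \<Omega> \<times> UNIV"
  defines "g \<equiv> freq_g lam u" and "h \<equiv> freq_h lam u"
  shows "frequency_pair g h (\<lambda>i. partial_deriv i g) (\<lambda>i. partial_deriv i h)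
    (\<lambda>i k. partial_deriv k (partial_deriv i g)) (\<lambda>i k. partial_deriv k (partial_deriv i h)) y\<^sub>0 R lam"
proof -
  have u4: "Ck_on 4 u \<Omega>" and eq: "\<And>x. x \<in> \<Omega> \<Longrightarrow> laplacian (laplacian u) x = lam\<^sup>2 * u x"
    using \<Omega>(2) by (auto simp: bilaplace_solution_def)
  have u2: "Ck_on 2 u \<Omega>" using u4 Ck_on_mono[of 2 4] by simp
  have L2: "Ck_on 2 (laplacian u) \<Omega>"
    using u4 by (intro Ck_on_laplacian \<Omega>(1)) (simp add: numeral_eq_Suc)
  have v: "freq_v lam u = (\<lambda>x. laplacian u x + (- lam) * u x)"
    by (rule ext) (simp add: freq_v_def)
  have v2: "Ck_on 2 (freq_v lam u) \<Omega>"
    unfolding v by (intro Ck_on_add Ck_on_cmult \<Omega>(1) L2 u2)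
  have op: "open (\<Omega> \<times> (UNIV :: real set))" using \<Omega>(1) by (intro open_Times) auto
  interpret g: C2_cball g "\<lambda>i. partial_deriv i g" "\<lambda>i k. partial_deriv k (partial_deriv i g)" y\<^sub>0 R
    unfolding g_def freq_g_def by (rule C2_cball_Ck_on[OF op R Ck_on_exp_lift[OF \<Omega>(1) u2]])
  interpret h: C2_cball h "\<lambda>i. partial_deriv i h" "\<lambda>i k. partial_deriv k (partial_deriv i h)" y\<^sub>0 R
    unfolding h_def freq_h_def by (rule C2_cball_Ck_on[OF op R Ck_on_exp_lift[OF \<Omega>(1) v2]])
  show ?thesis
  proof
    fix y assume "y \<in> cball y\<^sub>0 R"
    then have y: "fst y \<in> \<Omega>" using R by (metis mem_Times_iff subsetD)
    have "g.lapl y = laplacian g y" by (simp add: g.lapl_def laplacian_def)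
    also have "\<dots> = exp_lift lam (\<lambda>x. laplacian u x + lam * u x) y"
      unfolding g_def freq_g_def using \<Omega>(3) by (intro laplacian_exp_lift[OF \<Omega>(1) u2 y]) simp
    finally show "g.lapl y = h y + 2 * lam * g y"
      by (simp add: g_def h_def freq_g_def freq_h_def freq_v_def exp_lift_def algebra_simps)
    have "h.lapl y = laplacian h y" by (simp add: h.lapl_def laplacian_def)
    also have "\<dots> = exp_lift lam (\<lambda>x. laplacian (freq_v lam u) x + lam * freq_v lam u x) y"
      unfolding h_def freq_h_def using \<Omega>(3) by (intro laplacian_exp_lift[OF \<Omega>(1) v2 y]) simp
    also have "\<dots> = 0"
      using laplacian_add_cmult[OF \<Omega>(1) y L2 u2, of "- lam"] eq[OF y]
      by (simp add: v exp_lift_def power2_eq_square algebra_simps)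
    finally show "h.lapl y = 0" .
  qed (use \<Omega>(3) n in auto)
qed

theorem theorem2p3:
  assumes "CARD('n::finite) \<ge> 2"
  shows "\<exists>C\<^sub>0>0. \<exists>C>0.
    \<forall>(\<Omega> :: (real ^ 'n) set) (lam::real) (u :: real ^ 'n \<Rightarrow> real)
      (y\<^sub>0 :: (real ^ 'n) \<times> real) (r::real).
      bounded_domain \<Omega> \<and> lam > 1 \<and>
      bilaplace_solution \<Omega> lam u \<and> (\<exists>x\<in>\<Omega>. u x \<noteq> 0) \<and>
      0 < r \<and> r \<le> 1 \<and>
      closure (ball y\<^sub>0 r) \<subseteq> \<Omega> \<times> UNIV \<and>
      frequency lam u y\<^sub>0 r \<ge> C\<^sub>0
      \<longrightarrow> (\<exists>D. ((\<lambda>s. ln (frequency lam u y\<^sub>0 s)) has_real_derivative D) (at r) \<and> D \<ge> - C)"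
proof -
  let ?m = "DIM((real ^ 'n) \<times> real)"
  have m: "?m = CARD('n) + 1" by simp
  obtain c where c: "c \<ge> 0" "\<And>(y\<^sub>0 :: (real ^ 'n) \<times> real) r f. r > 0 \<Longrightarrow> continuous_on (sphere y\<^sub>0 r) f \<Longrightarrow>
     (LINT y:sphere y\<^sub>0 r|hausdorff_measure CARD('n). f y)
       = c * (r ^ CARD('n) * (LINT \<omega>:sphere 0 1|sphere_measure. f (y\<^sub>0 + r *\<^sub>R \<omega>)))"
    using hausdorff_sphere_integral[of "CARD('n)", where 'a = "(real ^ 'n) \<times> real"] by blast
  \<comment> \<open>\<open>sphere_integral\<close> already contains the factor \<open>DIM\<close>,
    which \<open>c\<close> does not account for.\<close>
  define k where "k = c / ?m"
  have k: "k \<ge> 0" using c(1) by (simp add: k_def)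
  have sphere: "(LINT y:sphere y\<^sub>0 r|hausdorff_measure CARD('n). f y) = k * sphere_integral y\<^sub>0 r f"
    if "r > 0" "continuous_on (sphere y\<^sub>0 r) f" for y\<^sub>0 :: "(real ^ 'n) \<times> real" and r f
    unfolding c(2)[OF that] by (simp add: k_def sphere_integral_def)
  \<comment> \<open>The threshold \<open>1 / k\<close> is exactly what turns the hypothesis on the
    frequency into \<open>F.H r \<le> r * F.D r\<close>.\<close>
  define C\<^sub>0 where "C\<^sub>0 = (if k = 0 then 1 else 1 / k)"
  have C0: "C\<^sub>0 > 0" using k by (simp add: C\<^sub>0_def)
  have main: "\<exists>D. ((\<lambda>s. ln (frequency lam u y\<^sub>0 s)) has_real_derivative D) (at r) \<and> D \<ge> - (real ?m + 3)"
    if dom: "bounded_domain \<Omega>" and lam: "lam > 1" and sol: "bilaplace_solution \<Omega> lam u"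
      and r: "0 < r" "r \<le> 1" and ball: "closure (ball y\<^sub>0 r) \<subseteq> \<Omega> \<times> UNIV"
      and N: "frequency lam u y\<^sub>0 r \<ge> C\<^sub>0"
    for \<Omega> :: "(real ^ 'n) set" and lam r :: real and u :: "real ^ 'n \<Rightarrow> real" and y\<^sub>0 :: "(real ^ 'n) \<times> real"
  proof -
    have op: "open \<Omega>" using dom by (simp add: bounded_domain_def)
    have "cball y\<^sub>0 r \<subseteq> \<Omega> \<times> UNIV" using ball r(1) by simp
    then obtain R where R: "R > r" "cball y\<^sub>0 R \<subseteq> \<Omega> \<times> UNIV"
      using cball_enlarge[OF _ open_Times[OF op open_UNIV] r(1)] by blast
    let ?g = "freq_g lam u" and ?h = "freq_h lam u"
    interpret F: frequency_pair ?g ?h "\<lambda>i. partial_deriv i ?g" "\<lambda>i. partial_deriv i ?h"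
      "\<lambda>i k. partial_deriv k (partial_deriv i ?g)" "\<lambda>i k. partial_deriv k (partial_deriv i ?h)" y\<^sub>0 R lam
      by (rule frequency_pair_exp_lift[OF op sol lam assms R(2)])
    have freq: "frequency lam u y\<^sub>0 s = s * F.D s / (k * F.H s)" if s: "0 < s" "s < R" for s
    proof -
      have "(LINT y:sphere y\<^sub>0 s|hausdorff_measure CARD('n). (?g y)\<^sup>2 + (?h y)\<^sup>2) = k * F.H s"
        unfolding F.H_def by (rule sphere[OF s(1)]) (intro continuous_intros F.conts_sphere s)+
      then show ?thesis
        by (simp add: frequency_def F.D_def ball_integral_def norm_grad_squared F.g.energy_def F.h.energy_def)
    qed
    have H0: "F.H r \<ge> 0" unfolding F.H_def using r(1) by (intro sphere_integral_nonneg) auto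
    have N': "r * F.D r / (k * F.H r) \<ge> C\<^sub>0" using N freq[OF r(1) R(1)] by simp
    \<comment> \<open>Division by zero gives \<open>0\<close>, so a positive lower bound on the
      quotient excludes a vanishing denominator.\<close>
    then have nz: "k \<noteq> 0" "F.H r \<noteq> 0" using C0 by auto
    then have kp: "k > 0" and H: "F.H r > 0" using k H0 by simp_all
    have "F.H r \<le> r * F.D r"
      using N' kp H by (simp add: C\<^sub>0_def field_simps)
    then obtain d where d: "((\<lambda>s. ln (s * F.D s / (k * F.H s))) has_real_derivative d) (at r)" "d \<ge> - (real ?m + 3)"
      using F.log_frequency_derivative[OF r(1) R(1) r(2) H _ kp] by blast
    \<comment> \<open>The formula \<open>freq\<close> holds for all radii in
      \<open>{0<..<R}\<close>, a neighbourhood of \<open>r\<close>, so the derivative carries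
      over.\<close>
    have "((\<lambda>s. ln (frequency lam u y\<^sub>0 s)) has_real_derivative d) (at r)"
      by (rule has_field_derivative_transform_within_open[OF d(1), where S = "{0<..<R}"])
        (use r R freq in auto)
    with d(2) show ?thesis by blast
  qed
  show ?thesis
    by (rule exI[of _ C\<^sub>0], intro conjI C0, rule exI[of _ "real ?m + 3"]) (use main in \<open>auto simp: add_pos_pos\<close>)
qed

end
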